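(* (Nonoscillatory co-periodic and subharmonic instabilities) Let $W$ be an $X$-periodic roll wave of the inviscid Saint-Venant equations, and let $\alpha_0$ and $\alpha_1$ be the coefficients in the expansion, uniform in $\xi\in[-\pi/X,\pi/X]$ as $\lambda\to0$, $$\hat\Delta(\lambda,\xi)=\alpha_0\,\lambda+\frac{e^{i\xi X}-1}{iX}\,\alpha_1+O(|\lambda|(|\lambda|+|\xi|)),$$ where $\Delta(\lambda,\xi)=\lambda\hat\Delta(\lambda,\xi)$ is the periodic Evans-Lopatinsky determinant of $W$, with a normalization ensuring that $\Delta(\lambda,0)$ and $\Delta(\lambda,\pi/X)$ are real when $\lambda$ is real. Assume that $\alpha_0\neq0$ and let $\alpha=\alpha_1/(i\alpha_0)$ be the real coefficient in the expansion $\lambda_1(\xi)=-i\xi\alpha\,(1-i\xi\gamma+O(\xi^2))$ of the nontrivial spectral curve through the origin. Then: (i) The sign of $\alpha_0=\partial_\lambda^2\Delta(0,0)/2$ determines the parity of the number of real positive roots of $\Delta(\cdot,0)$. (ii) $\alpha_1$ is purely imaginary and, if $\alpha_1\neq0$, then the sign of $\alpha_1/i=\partial^2_{\lambda\xi}\Delta(0,0)/i$ determines the parity of the number of real positive roots of $\Delta(\cdot,\pi/X)$. (iii) In particular, if $\alpha<0$ then $W$ is spectrally unstable.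
   Context: Equations. The inviscid Saint-Venant equations are $\partial_t h+\partial_x q=0$, $\partial_t q+\partial_x\big(\tfrac{q^2}{h}+\tfrac{h^2}{2F^2}\big)=h-\tfrac{|q|q}{h^2}$, with Froude number $F$. Roll waves. Fix $F>2$. A roll wave is determined by $H_s>0$ and $H_-$ with $\frac{1+2F+\sqrt{1+4F}}{2F^2}H_s<H_-<H_s$. Put $q_0=H_s^{3/2}/F$, $c=H_s^{1/2}(1+1/F)$, and let $H_+>H_s$ be the unique solution of $\frac{q_0^2}{H_+}+\frac{H_+^2}{2F^2}=\frac{q_0^2}{H_-}+\frac{H_-^2}{2F^2}$. Let $H:[0,X]\to[H_-,H_+]$ be the (increasing) solution of $H'=F^2\,\frac{H^2+(H_s-c^2)H+q_0^2/H_s}{H^2+H_sH+H_s^2}$ with $H(0)=H_-$, where $X>0$ is determined by $H(X)=H_+$, and let $Q=cH-q_0$. The $X$-periodic extension of $(H,Q)|_{(0,X)}$, with shocks at $jX$, $j\in\mathbb{Z}$, is the profile $W$, and $(h,q)(x,t)=(H,Q)(x-ct)$ is the roll wave. Let $x_s\in(0,X)$ be the sonic point, where $H(x_s)=H_s$. Interior eigenvalue equations. For $\lambda\in\mathbb{C}$, consider on $(0,X)$ $$\lambda h+\partial_x(-ch+q)=0,\qquad \lambda q+\partial_x\Big(\big(\tfrac{2Q}{H}-c\big)q+\big(-\tfrac{Q^2}{H^2}+\tfrac{H}{F^2}\big)h\Big)=h-\tfrac{2Q}{H^2}q+\tfrac{2Q^2}{H^3}h.$$ This system is singular at $x_s$.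 For $\Re(\lambda)>-\tfrac{F-2}{2\sqrt{H_s}}$ its space of analytic solutions is one-dimensional; let $(h,q)=(h,q)(\cdot;\lambda)$ be a nonzero analytic solution depending analytically on $\lambda$. Choosing it amounts to choosing a normalization. Evans-Lopatinsky determinant. For $\Re(\lambda)>-\tfrac{F-2}{2\sqrt{H_s}}$ and $\xi\in[-\pi/X,\pi/X]$, with $\{f\}:=f(X^-)-f(0^+)$ and $\{f\}_\xi:=f(X^-)-e^{i\xi X}f(0^+)$, $$\Delta(\lambda,\xi):=\det\begin{pmatrix}\{\lambda H\}&\{-ch+q\}_\xi\\ \{\lambda Q-(H-\tfrac{Q^2}{H^2})\}&\{(-\tfrac{Q^2}{H^2}+\tfrac{H}{F^2})h+(\tfrac{2Q}{H}-c)q\}_\xi\end{pmatrix}.$$ An example of a normalization for which $\Delta(\lambda,0)$ and $\Delta(\lambda,\pi/X)$ are real for real $\lambda$ is $$\begin{pmatrix}h\\ q\end{pmatrix}(x_s)=\frac{F-2}{2(F+1)}\sqrt{H_s}\begin{pmatrix}\big(\lambda+\tfrac23\tfrac{F+1}{\sqrt{H_s}}\big)F\\ \lambda\sqrt{H_s}(F-1)+\tfrac23(F+1)^2\end{pmatrix}.$$ One has $\Delta(0,\xi)=0$ for all $\xi$, and $\hat\Delta$ is the analytic function with $\Delta(\lambda,\xi)=\lambda\hat\Delta(\lambda,\xi)$; in particular $\alpha_0=\partial_\lambda\hat\Delta(0,0)$ and $\alpha_1=\partial_\xi\hat\Delta(0,0)$. When $\alpha_0\neq0$, the roots of $\Delta(\cdot,\xi)$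 near $0$, for $\xi$ near $0$, are exactly $\lambda_1(\xi)$ and $\lambda_2(\xi)\equiv0$, with $\lambda_1$ analytic in $\xi$ and expanding as in the claim with real constants $\alpha,\gamma$. Spectral stability. $W$ is spectrally stable if $\Delta(\cdot,\xi)$ has no root $\lambda$ with $\Re(\lambda)>0$ for any $\xi\in[-\pi/X,\pi/X]$, and spectrally unstable otherwise.
   Formalization: In (iii) the condition α<0 is replaced by α>0: with the stated conventions (i) and (ii) force instability exactly when α>0, while for F=3, H_s=1, H_-≈0.63 one has α≈-0.044<0 and (numerically) a spectrally stable roll wave. *)

theory Defs
  imports "HOL-Complex_Analysis.Complex_Analysis"
begin

definition real_analytic_on :: "(real \<Rightarrow> complex) \<Rightarrow> real set \<Rightarrow> bool" where
  "real_analytic_on f S \<longleftrightarrow>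
     (\<forall>x0\<in>S. \<exists>r>0. \<exists>a. \<forall>x. \<bar>x - x0\<bar> < r \<longrightarrow>
        (\<lambda>n. a n * complex_of_real (x - x0) ^ n) sums f x)"

definition roll_wave_params :: "real \<Rightarrow> real \<Rightarrow> real \<Rightarrow> bool" where
  "roll_wave_params F Hs Hm \<longleftrightarrow>
     F > 2 \<and> Hs > 0 \<and> (1 + 2 * F + sqrt (1 + 4 * F)) / (2 * F\<^sup>2) * Hs < Hm \<and> Hm < Hs"

definition flux_const :: "real \<Rightarrow> real \<Rightarrow> real" where
  "flux_const F Hs = Hs powr (3 / 2) / F"

definition wave_speed :: "real \<Rightarrow> real \<Rightarrow> real" where
  "wave_speed F Hs = sqrt Hs * (1 + 1 / F)"

definition H_plus :: "real \<Rightarrow> real \<Rightarrow> real \<Rightarrow> real" where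
  "H_plus F Hs Hm =
     (THE Hp. Hp > Hs \<and>
        (flux_const F Hs)\<^sup>2 / Hp + Hp\<^sup>2 / (2 * F\<^sup>2) =
        (flux_const F Hs)\<^sup>2 / Hm + Hm\<^sup>2 / (2 * F\<^sup>2))"

definition profile_rhs :: "real \<Rightarrow> real \<Rightarrow> real \<Rightarrow> real" where
  "profile_rhs F Hs y =
     F\<^sup>2 * ((y\<^sup>2 + (Hs - (wave_speed F Hs)\<^sup>2) * y + (flux_const F Hs)\<^sup>2 / Hs) /
            (y\<^sup>2 + Hs * y + Hs\<^sup>2))"

text \<open>One period of the profile. The wave is its \<open>X\<close>-periodic extension, which has shocks at the
  multiples of \<open>X\<close>; all that enters below is the restriction to one period.\<close>

definition roll_wave :: "real \<Rightarrow> real \<Rightarrow> real \<Rightarrow> real \<Rightarrow> (real \<Rightarrow> real) \<Rightarrow> bool" where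
  "roll_wave F Hs Hm X H \<longleftrightarrow>
     roll_wave_params F Hs Hm \<and> X > 0 \<and> H 0 = Hm \<and> H X = H_plus F Hs Hm \<and>
     (\<forall>x\<in>{0..X}. H x \<in> {Hm..H_plus F Hs Hm} \<and>
        (H has_real_derivative profile_rhs F Hs (H x)) (at x within {0..X}))"

definition Q_profile :: "real \<Rightarrow> real \<Rightarrow> (real \<Rightarrow> real) \<Rightarrow> real \<Rightarrow> real" where
  "Q_profile F Hs H x = wave_speed F Hs * H x - flux_const F Hs"

text \<open>The two components of the linearized flux in the frame of the wave, applied to \<open>(h, q)\<close>.\<close>

definition lin_flux1 ::
  "real \<Rightarrow> real \<Rightarrow> (real \<Rightarrow> complex) \<Rightarrow> (real \<Rightarrow> complex) \<Rightarrow> real \<Rightarrow> complex" where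
  "lin_flux1 F Hs h q x = - complex_of_real (wave_speed F Hs) * h x + q x"

definition lin_flux2 ::
  "real \<Rightarrow> real \<Rightarrow> (real \<Rightarrow> real) \<Rightarrow> (real \<Rightarrow> complex) \<Rightarrow> (real \<Rightarrow> complex) \<Rightarrow> real \<Rightarrow> complex" where
  "lin_flux2 F Hs H h q x =
     complex_of_real (2 * Q_profile F Hs H x / H x - wave_speed F Hs) * q x +
     complex_of_real (- (Q_profile F Hs H x)\<^sup>2 / (H x)\<^sup>2 + H x / F\<^sup>2) * h x"

text \<open>Analyticity makes both fluxes differentiable on \<open>(0, X)\<close>, so the vector derivatives below are
  genuine derivatives, also at the sonic point.\<close>

definition eigen_solution ::
  "real \<Rightarrow> real \<Rightarrow> real \<Rightarrow> (real \<Rightarrow> real) \<Rightarrow> complex \<Rightarrow>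
   (real \<Rightarrow> complex) \<Rightarrow> (real \<Rightarrow> complex) \<Rightarrow> bool" where
  "eigen_solution F Hs X H l h q \<longleftrightarrow>
     real_analytic_on h {0<..<X} \<and> real_analytic_on q {0<..<X} \<and>
     (\<forall>x\<in>{0<..<X}.
        l * h x + vector_derivative (lin_flux1 F Hs h q) (at x) = 0 \<and>
        l * q x + vector_derivative (lin_flux2 F Hs H h q) (at x) =
          h x - complex_of_real (2 * Q_profile F Hs H x / (H x)\<^sup>2) * q x
              + complex_of_real (2 * (Q_profile F Hs H x)\<^sup>2 / (H x) ^ 3) * h x)"

definition spectral_domain :: "real \<Rightarrow> real \<Rightarrow> complex set" where
  "spectral_domain F Hs = {l. Re l > - ((F - 2) / (2 * sqrt Hs))}"

text \<open>A choice, for each \<open>l\<close>, of a nonzero analytic solution \<open>(h l, q l)\<close>, depending analytically on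
  \<open>l\<close>. The choice is unique up to a nowhere vanishing analytic factor of \<open>l\<close>: it is what is called a
  normalization.\<close>

definition eigen_family ::
  "real \<Rightarrow> real \<Rightarrow> real \<Rightarrow> (real \<Rightarrow> real) \<Rightarrow>
   (complex \<Rightarrow> real \<Rightarrow> complex) \<Rightarrow> (complex \<Rightarrow> real \<Rightarrow> complex) \<Rightarrow> bool" where
  "eigen_family F Hs X H h q \<longleftrightarrow>
     (\<forall>l\<in>spectral_domain F Hs.
        eigen_solution F Hs X H l (h l) (q l) \<and> (\<exists>x\<in>{0<..<X}. h l x \<noteq> 0 \<or> q l x \<noteq> 0)) \<and>
     (\<forall>x\<in>{0<..<X}. (\<lambda>l. h l x) holomorphic_on spectral_domain F Hs \<and>
                    (\<lambda>l. q l x) holomorphic_on spectral_domain F Hs)"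

definition jump :: "real \<Rightarrow> (real \<Rightarrow> complex) \<Rightarrow> complex" where
  "jump X f = Lim (at_left X) f - Lim (at_right 0) f"

definition bloch_jump :: "real \<Rightarrow> real \<Rightarrow> (real \<Rightarrow> complex) \<Rightarrow> complex" where
  "bloch_jump X \<xi> f = Lim (at_left X) f - exp (\<i> * complex_of_real (\<xi> * X)) * Lim (at_right 0) f"

definition evans ::
  "real \<Rightarrow> real \<Rightarrow> real \<Rightarrow> (real \<Rightarrow> real) \<Rightarrow>
   (complex \<Rightarrow> real \<Rightarrow> complex) \<Rightarrow> (complex \<Rightarrow> real \<Rightarrow> complex) \<Rightarrow> complex \<Rightarrow> real \<Rightarrow> complex" where
  "evans F Hs X H h q l \<xi> =
     det (vector
       [vector [jump X (\<lambda>x. l * complex_of_real (H x)),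
                bloch_jump X \<xi> (lin_flux1 F Hs (h l) (q l))],
        vector [jump X (\<lambda>x. l * complex_of_real (Q_profile F Hs H x)
                            - complex_of_real (H x - (Q_profile F Hs H x)\<^sup>2 / (H x)\<^sup>2)),
                bloch_jump X \<xi> (lin_flux2 F Hs H (h l) (q l))]] :: complex ^ 2 ^ 2)"

text \<open>For a function \<open>D\<close> of \<open>(l, \<xi>)\<close> that is analytic in \<open>l\<close> with \<open>D 0 \<xi> = 0\<close>, the analytic function
  \<open>Dhat\<close> with \<open>D l \<xi> = l * Dhat l \<xi>\<close>.\<close>

definition reduced :: "(complex \<Rightarrow> real \<Rightarrow> complex) \<Rightarrow> complex \<Rightarrow> real \<Rightarrow> complex" where
  "reduced D l \<xi> = (if l = 0 then deriv (\<lambda>z. D z \<xi>) 0 else D l \<xi> / l)"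

definition alpha0 :: "(complex \<Rightarrow> real \<Rightarrow> complex) \<Rightarrow> complex" where
  "alpha0 D = deriv (\<lambda>l. reduced D l 0) 0"

definition alpha1 :: "(complex \<Rightarrow> real \<Rightarrow> complex) \<Rightarrow> complex" where
  "alpha1 D = vector_derivative (\<lambda>\<xi>. reduced D 0 \<xi>) (at 0)"

definition low_freq_expansion :: "real \<Rightarrow> (complex \<Rightarrow> real \<Rightarrow> complex) \<Rightarrow> complex \<Rightarrow> complex \<Rightarrow> bool" where
  "low_freq_expansion X D a0 a1 \<longleftrightarrow>
     (\<exists>C. \<exists>\<delta>>0. \<forall>l. \<forall>\<xi>\<in>{- pi / X..pi / X}. norm l < \<delta> \<longrightarrow>
        norm (reduced D l \<xi> -
              (a0 * l + (exp (\<i> * complex_of_real (\<xi> * X)) - 1) / (\<i> * complex_of_real X) * a1))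
          \<le> C * (norm l * (norm l + \<bar>\<xi>\<bar>)))"

text \<open>Near \<open>l = 0\<close> and for small \<open>\<xi>\<close>, the roots of \<open>D \<cdot> \<xi>\<close> are \<open>0\<close> and \<open>lam \<xi>\<close>, where \<open>lam\<close> is
  analytic with \<open>lam \<xi> = - \<i> \<xi> \<alpha> (1 - \<i> \<xi> \<gamma> + O(\<xi>^2))\<close>.\<close>

definition critical_curve_expansion :: "(complex \<Rightarrow> real \<Rightarrow> complex) \<Rightarrow> real \<Rightarrow> bool" where
  "critical_curve_expansion D \<alpha> \<longleftrightarrow>
     (\<exists>lam. \<exists>\<gamma>::real. \<exists>\<delta>>0. \<exists>\<epsilon>>0. \<exists>C.
        real_analytic_on lam {-\<delta><..<\<delta>} \<and>
        (\<forall>\<xi>\<in>{-\<delta><..<\<delta>}.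
           {l. norm l < \<epsilon> \<and> D l \<xi> = 0} = {0, lam \<xi>} \<and>
           (\<exists>r. norm r \<le> C * \<xi>\<^sup>2 \<and>
              lam \<xi> = - \<i> * complex_of_real \<xi> * complex_of_real \<alpha> *
                       (1 - \<i> * complex_of_real \<xi> * complex_of_real \<gamma> + r))))"

definition positive_real_roots :: "(complex \<Rightarrow> complex) \<Rightarrow> complex set" where
  "positive_real_roots f = {z. z \<in> \<real> \<and> Re z > 0 \<and> f z = 0}"

text \<open>Roots are counted with multiplicity, as is required for parity statements.\<close>

definition num_positive_real_roots :: "(complex \<Rightarrow> complex) \<Rightarrow> int" where
  "num_positive_real_roots f = (\<Sum>z\<in>positive_real_roots f. zorder f z)"

text \<open>Changing the normalization multiplies \<open>D\<close> by a nowhere vanishing factor, so this does not depend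
  on it.

  By contrast the signs of \<open>alpha0 D\<close> and \<open>alpha1 D / \<i>\<close> are only meaningful relative to the
  orientation of a real normalization, given by the sign of the real number \<open>h l xs\<close>, which does not
  vanish on the spectral domain (\<open>xs\<close> the sonic point); for the normalization
  \<open>h l xs = (F - 2) / (2 (F + 1)) * sqrt Hs * (l + 2/3 (F + 1) / sqrt Hs) * F\<close> it is positive at
  \<open>l = 0\<close>. As \<open>l\<close> tends to \<open>\<infinity>\<close> along the reals, \<open>D l 0\<close> and \<open>D l (pi / X)\<close> both have that sign,
  since the contribution of the left end \<open>x = 0\<close> of the period is exponentially dominated. Near
  \<open>l = 0\<close> they are equivalent to \<open>alpha0 D * l^2\<close> and \<open>- (2 / X) * (alpha1 D / \<i>) * l\<close>. It is thus a
  positive quotient \<open>\<alpha> = alpha1 D / (\<i> * alpha0 D)\<close> that forces an odd number of positive real roots at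
  one of the two frequencies.\<close>

definition spectrally_stable :: "real \<Rightarrow> (complex \<Rightarrow> real \<Rightarrow> complex) \<Rightarrow> bool" where
  "spectrally_stable X D \<longleftrightarrow> (\<forall>\<xi>\<in>{- pi / X..pi / X}. \<forall>l. Re l > 0 \<longrightarrow> D l \<xi> \<noteq> 0)"

end

theory Submission
  imports Defs
begin

text \<open>In the variables \<open>u = q - c h\<close> and \<open>h\<close> the eigenvalue equations read \<open>u' = - l h\<close>,
  \<open>a h' = (\<beta> - l k) h - (e + l) u\<close>, where \<open>a\<close> changes sign exactly at the sonic point, where also
  \<open>\<beta> = 0\<close>. The determinant splits as \<open>D l \<xi> = A l - exp (\<i> \<xi> X) B l\<close>, with \<open>A\<close> and \<open>B\<close> built from
  the right and left end of the period. At \<open>l = 0\<close> the solution is \<open>u = 0\<close>, \<open>h = \<kappa> H'\<close>, which gives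
  \<open>A 0 = B 0 = 0\<close> and \<open>A' 0 = B' 0\<close>; everything about small \<open>l\<close> follows from this. For large real \<open>l\<close>,
  barriers for the ratio of \<open>h\<close> and \<open>- u\<close> show that \<open>- u\<close> grows exponentially to the right
  of the sonic point and decreases to its left, so \<open>\<bar>B\<bar> < A\<close> for the normalization \<open>h xs = 1\<close>. Hence
  \<open>D l 0 = A l - B l\<close> and \<open>D l (pi / X) = A l + B l\<close> have the sign of \<open>h l xs\<close> at infinity, and comparing
  with their signs near \<open>l = 0\<close> gives the parities.\<close>

section \<open>Linear systems on an interval\<close>

lemma continuous_on_first_zero:
  fixes f :: "real \<Rightarrow> real"
  assumes cont: "continuous_on {s..t} f" and start: "f s > 0" and x: "x \<in> {s..t}" "f x \<le> 0"
  obtains z where "s < z" "z \<le> t" "f z = 0" "\<And>y. s \<le> y \<Longrightarrow> y < z \<Longrightarrow> f y > 0"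
proof -
  have zero_below: "\<exists>w. s \<le> w \<and> w \<le> y \<and> f w = 0" if "y \<in> {s..t}" "f y \<le> 0" for y
    using IVT2'[of f y 0 s] that start continuous_on_subset[OF cont, of "{s..y}"] by auto
  define Z where "Z = {w \<in> {s..t}. f w = 0}"
  have "closed Z" unfolding Z_def
    using continuous_closed_preimage_constant[OF cont] by simp
  moreover have "Z \<noteq> {}" using zero_below[OF x] x(1) unfolding Z_def by force
  moreover have bdd: "bdd_below Z" unfolding Z_def by (auto intro: bdd_belowI[of _ s])
  ultimately have Inf: "Inf Z \<in> Z" by (rule closed_contains_Inf[rotated 2])
  show ?thesis
  proof
    have bounds: "s \<le> Inf Z" "Inf Z \<le> t" "f (Inf Z) = 0" using Inf by (simp_all add: Z_def)
    then show "Inf Z \<le> t" "f (Inf Z) = 0" by auto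
    show "s < Inf Z" using bounds start by (cases "s = Inf Z") (metis less_irrefl, linarith)
    fix y assume y: "s \<le> y" "y < Inf Z"
    show "f y > 0"
    proof (rule ccontr)
      assume "\<not> f y > 0"
      moreover have "y \<in> {s..t}" using y Inf unfolding Z_def by auto
      ultimately obtain w where w: "s \<le> w" "w \<le> y" "f w = 0" using zero_below[of y] by auto
      then have "w \<in> Z" using \<open>y \<in> {s..t}\<close> unfolding Z_def by auto
      then show False using cInf_lower[OF _ bdd, of w] w y by auto
    qed
  qed
qed

lemma nonvanishing_same_sign:
  fixes f :: "real \<Rightarrow> real"
  assumes "a \<le> b" and cont: "continuous_on {a..b} f" and nz: "\<And>x. x \<in> {a..b} \<Longrightarrow> f x \<noteq> 0"
  shows "f a * f b > 0"
proof (rule ccontr)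
  assume "\<not> ?thesis"
  then have "f a \<le> 0 \<and> 0 \<le> f b \<or> f b \<le> 0 \<and> 0 \<le> f a"
    by (smt (verit) mult_pos_pos mult_neg_neg)
  then obtain x where "x \<in> {a..b}" "f x = 0"
    using IVT'[of f a 0 b] IVT2'[of f b 0 a] cont assms(1) by force
  then show False using nz by blast
qed

lemma norm_gronwall:
  fixes z :: "real \<Rightarrow> 'a::real_inner"
  assumes "s \<le> t"
    and deriv: "\<And>x. x \<in> {s..t} \<Longrightarrow> (z has_vector_derivative z' x) (at x)"
    and bound: "\<And>x. x \<in> {s..t} \<Longrightarrow> norm (z' x) \<le> K * norm (z x)"
  shows "norm (z t) \<le> exp (K * (t - s)) * norm (z s)"
    and "norm (z s) \<le> exp (K * (t - s)) * norm (z t)"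
proof -
  have D: "((\<lambda>x. inner (z x) (z x) * exp (c * x)) has_real_derivative
      (2 * inner (z x) (z' x) + c * inner (z x) (z x)) * exp (c * x)) (at x)"
    if "x \<in> {s..t}" for x c
  proof -
    have "((\<lambda>x. inner (z x) (z x)) has_real_derivative 2 * inner (z x) (z' x)) (at x)"
      unfolding has_field_derivative_def
      using deriv[OF that] unfolding has_vector_derivative_def
      by (auto intro!: derivative_eq_intros simp: inner_commute algebra_simps fun_eq_iff)
    then show ?thesis by (auto intro!: derivative_eq_intros simp: algebra_simps)
  qed
  have le: "\<bar>inner (z x) (z' x)\<bar> \<le> K * inner (z x) (z x)" if "x \<in> {s..t}" for x
  proof -
    have "\<bar>inner (z x) (z' x)\<bar> \<le> norm (z x) * norm (z' x)" by (rule Cauchy_Schwarz_ineq2)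
    also have "\<dots> \<le> norm (z x) * (K * norm (z x))"
      using bound[OF that] by (rule mult_left_mono) simp
    finally show ?thesis by (simp add: dot_square_norm power2_eq_square mult_ac)
  qed
  have sq: "norm y \<le> exp (K * (t - s)) * norm x"
    if "inner y y \<le> exp (2 * K * (t - s)) * inner x x" for x y :: 'a
  proof -
    have "(norm y)\<^sup>2 \<le> (exp (K * (t - s)) * norm x)\<^sup>2"
      using that by (simp add: power_mult_distrib dot_square_norm mult.assoc flip: exp_double)
    then show ?thesis by (rule power2_le_imp_le) simp
  qed
  have "inner (z t) (z t) * exp (- 2 * K * t) \<le> inner (z s) (z s) * exp (- 2 * K * s)"
  proof (rule DERIV_nonpos_imp_nonincreasing[OF \<open>s \<le> t\<close>])
    fix x assume x: "s \<le> x" "x \<le> t"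
    have "(2 * inner (z x) (z' x) + (- 2 * K) * inner (z x) (z x)) * exp (- 2 * K * x) \<le> 0"
      using le[of x] x by (auto simp: mult_le_0_iff)
    then show "\<exists>y. ((\<lambda>x. inner (z x) (z x) * exp (- 2 * K * x)) has_real_derivative y) (at x) \<and> y \<le> 0"
      using D[of x "- 2 * K"] x by auto
  qed
  then have "inner (z t) (z t) * exp (- 2 * K * t) * exp (2 * K * t)
      \<le> inner (z s) (z s) * exp (- 2 * K * s) * exp (2 * K * t)"
    by (rule mult_right_mono) simp
  then have "inner (z t) (z t) \<le> exp (2 * K * (t - s)) * inner (z s) (z s)"
    by (simp add: mult.assoc algebra_simps flip: exp_add)
  then show "norm (z t) \<le> exp (K * (t - s)) * norm (z s)" by (rule sq)
  have "inner (z s) (z s) * exp (2 * K * s) \<le> inner (z t) (z t) * exp (2 * K * t)"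
  proof (rule DERIV_nonneg_imp_nondecreasing[OF \<open>s \<le> t\<close>])
    fix x assume x: "s \<le> x" "x \<le> t"
    have "(2 * inner (z x) (z' x) + (2 * K) * inner (z x) (z x)) * exp (2 * K * x) \<ge> 0"
      using le[of x] x by auto
    then show "\<exists>y. ((\<lambda>x. inner (z x) (z x) * exp (2 * K * x)) has_real_derivative y) (at x) \<and> 0 \<le> y"
      using D[of x "2 * K"] x by auto
  qed
  then have "inner (z s) (z s) * exp (2 * K * s) * exp (- 2 * K * s)
      \<le> inner (z t) (z t) * exp (2 * K * t) * exp (- 2 * K * s)"
    by (rule mult_right_mono) simp
  then have "inner (z s) (z s) \<le> exp (2 * K * (t - s)) * inner (z t) (z t)"
    by (simp add: mult.assoc algebra_simps flip: exp_add)
  then show "norm (z s) \<le> exp (K * (t - s)) * norm (z t)" by (rule sq)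
qed

lemma gronwall_limit_left:
  fixes z :: "real \<Rightarrow> 'a::euclidean_space"
  assumes "s < t" "K \<ge> 0"
    and deriv: "\<And>x. s \<le> x \<Longrightarrow> x < t \<Longrightarrow> (z has_vector_derivative z' x) (at x)"
    and bound: "\<And>x. s \<le> x \<Longrightarrow> x < t \<Longrightarrow> norm (z' x) \<le> K * norm (z x)"
  obtains L where "(z \<longlongrightarrow> L) (at_left t)"
    "\<And>x. s \<le> x \<Longrightarrow> x < t \<Longrightarrow>
       norm (z x - L) \<le> K * exp (K * (t - s)) * norm (z s) * (t - x)"
proof -
  define B where "B = K * exp (K * (t - s)) * norm (z s)"
  have B: "norm (z' x) \<le> B" if "s \<le> x" "x < t" for x
  proof -
    have "norm (z x) \<le> exp (K * (x - s)) * norm (z s)"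
      by (rule norm_gronwall(1)[where z' = z']) (use that deriv bound in auto)
    also have "\<dots> \<le> exp (K * (t - s)) * norm (z s)"
      using that \<open>K \<ge> 0\<close> by (intro mult_right_mono) (auto intro!: mult_left_mono)
    finally have "K * norm (z x) \<le> B" unfolding B_def using \<open>K \<ge> 0\<close>
      by (simp add: mult_left_mono mult.assoc)
    then show ?thesis using bound[OF that] by linarith
  qed
  have "B \<ge> 0" unfolding B_def using \<open>K \<ge> 0\<close> by simp
  have lip: "norm (z x - z y) \<le> B * norm (x - y)" if "x \<in> {s..<t}" "y \<in> {s..<t}" for x y
  proof (rule differentiable_bound[of "{s..<t}" z "\<lambda>x h. h *\<^sub>R z' x"])
    show "onorm (\<lambda>h. h *\<^sub>R z' x) \<le> B" if "x \<in> {s..<t}" for x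
      by (rule onorm_le) (use B[of x] that in \<open>auto simp: mult.commute[of B] intro!: mult_left_mono\<close>)
    show "(z has_derivative (\<lambda>h. h *\<^sub>R z' x)) (at x within {s..<t})" if "x \<in> {s..<t}" for x
      using deriv[of x] that unfolding has_vector_derivative_def
      by (auto intro: has_derivative_at_withinI)
  qed (use that in auto)
  have ucont: "uniformly_continuous_on {s..<t} z"
  proof (rule lipschitz_on_uniformly_continuous)
    show "B-lipschitz_on {s..<t} z"
      by (rule lipschitz_onI) (use lip \<open>B \<ge> 0\<close> in \<open>auto simp: dist_norm\<close>)
  qed
  have cl: "t \<in> closure {s..<t}" using \<open>s < t\<close> by simp
  obtain L where "(z \<longlongrightarrow> L) (at t within {s..<t})"
    using uniformly_continuous_on_extension_at_closure[OF ucont cl] by blast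
  moreover have "at t within {s..<t} = at_left t"
    by (rule at_within_nhd[of _ "{s<..}"]) (use \<open>s < t\<close> in auto)
  ultimately have L: "(z \<longlongrightarrow> L) (at_left t)" by simp
  show ?thesis
  proof
    show "(z \<longlongrightarrow> L) (at_left t)" by fact
    fix x assume x: "s \<le> x" "x < t"
    show "norm (z x - L) \<le> K * exp (K * (t - s)) * norm (z s) * (t - x)"
      unfolding B_def[symmetric]
    proof (rule tendsto_le[OF trivial_limit_at_left_real])
      show "((\<lambda>y. norm (z x - z y)) \<longlongrightarrow> norm (z x - L)) (at_left t)"
        by (intro tendsto_intros L)
      show "((\<lambda>y. B * (y - x)) \<longlongrightarrow> B * (t - x)) (at_left t)"
        by (intro tendsto_intros)
      show "\<forall>\<^sub>F y in at_left t. norm (z x - z y) \<le> B * (y - x)"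
        using eventually_at_left_real[OF x(2)]
      proof eventually_elim
        case (elim y)
        then show ?case using lip[of x y] x by (simp add: abs_if)
      qed
    qed
  qed
qed

lemma gronwall_limit_right:
  fixes z :: "real \<Rightarrow> 'a::euclidean_space"
  assumes "s < t" "K \<ge> 0"
    and deriv: "\<And>x. s < x \<Longrightarrow> x \<le> t \<Longrightarrow> (z has_vector_derivative z' x) (at x)"
    and bound: "\<And>x. s < x \<Longrightarrow> x \<le> t \<Longrightarrow> norm (z' x) \<le> K * norm (z x)"
  obtains L where "(z \<longlongrightarrow> L) (at_right s)"
    "\<And>x. s < x \<Longrightarrow> x \<le> t \<Longrightarrow>
       norm (z x - L) \<le> K * exp (K * (t - s)) * norm (z t) * (x - s)"
proof -
  have "((\<lambda>x. z (- x)) has_vector_derivative - z' (- x)) (at x)" if "- t \<le> x" "x < - s" for x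
  proof -
    have "(uminus has_vector_derivative - 1) (at x)"
      by (auto intro!: derivative_eq_intros simp flip: has_real_derivative_iff_has_vector_derivative)
    from vector_diff_chain_at[OF this, of z "z' (- x)"] show ?thesis
      using deriv[of "- x"] that by (simp add: o_def)
  qed
  then obtain L where L: "((\<lambda>x. z (- x)) \<longlongrightarrow> L) (at_left (- s))"
    "\<And>x. - t \<le> x \<Longrightarrow> x < - s \<Longrightarrow>
       norm (z (- x) - L) \<le> K * exp (K * (- s - - t)) * norm (z (- (- t))) * (- s - x)"
    using gronwall_limit_left[of "- t" "- s" K "\<lambda>x. z (- x)" "\<lambda>x. - z' (- x)"] assms(1,2) bound
    by (metis (no_types, lifting) minus_less_iff minus_le_iff neg_less_iff_less norm_minus_cancel)
  show ?thesis
  proof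
    show "(z \<longlongrightarrow> L) (at_right s)"
      using L(1) by (simp add: at_left_minus filterlim_filtermap)
    show "norm (z x - L) \<le> K * exp (K * (t - s)) * norm (z t) * (x - s)" if "s < x" "x \<le> t" for x
      using L(2)[of "- x"] that by (simp add: add.commute)
  qed
qed

lemma continuous_on_Icc_bound:
  fixes f :: "real \<Rightarrow> real"
  assumes "continuous_on {s..t} f"
  obtains B where "B > 0" "\<And>x. x \<in> {s..t} \<Longrightarrow> \<bar>f x\<bar> \<le> B"
proof -
  have "bounded (f ` {s..t})"
    by (intro compact_imp_bounded compact_continuous_image assms) auto
  then obtain B where "B > 0" "\<forall>y\<in>f ` {s..t}. norm y \<le> B" by (auto simp: bounded_pos)
  then show ?thesis using that by auto
qed

lemma continuous_on_compact_pos_bound: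
  fixes f :: "'a::topological_space \<Rightarrow> real"
  assumes "continuous_on S f" "compact S" "\<And>x. x \<in> S \<Longrightarrow> f x > 0"
  obtains m where "m > 0" "\<And>x. x \<in> S \<Longrightarrow> m \<le> f x"
proof (cases "S = {}")
  case True then show ?thesis using that[of 1] by auto
next
  case False
  then obtain y where "y \<in> S" "\<forall>x\<in>S. f y \<le> f x"
    using continuous_attains_inf[OF assms(2) False assms(1)] by auto
  then show ?thesis using that[of "f y"] assms(3) by auto
qed

section \<open>Holomorphic functions that are real on the real axis\<close>

lemma deriv_real:
  assumes hol: "f holomorphic_on S" and S: "open S" "complex_of_real x \<in> S"
    and real: "\<And>y. complex_of_real y \<in> S \<Longrightarrow> f (of_real y) \<in> \<real>"
  shows "deriv f (of_real x) \<in> \<real>"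
proof -
  have "(f has_field_derivative deriv f (of_real x)) (at (of_real x))"
    by (rule holomorphic_derivI[OF hol S])
  then have lim: "((\<lambda>h. (f (of_real x + h) - f (of_real x)) / h) \<longlongrightarrow> deriv f (of_real x)) (at 0)"
    by (simp add: DERIV_def)
  have "filterlim complex_of_real (at 0) (at 0)"
    by (auto simp: filterlim_at eventually_at_filter intro!: tendsto_eq_intros)
  from filterlim_compose[OF lim this]
  have lim': "((\<lambda>t. (f (of_real x + of_real t) - f (of_real x)) / complex_of_real t) \<longlongrightarrow> deriv f (of_real x)) (at (0::real))" .
  have "((\<lambda>t::real. complex_of_real x + of_real t) \<longlongrightarrow> of_real x) (at 0)"
    by (auto intro!: tendsto_eq_intros)
  from topological_tendstoD[OF this S]
  have "\<forall>\<^sub>F t in at (0::real). (f (of_real x + of_real t) - f (of_real x)) / complex_of_real t \<in> \<real>"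
  proof eventually_elim
    case (elim t)
    then show ?case using real[of "x + t"] real[OF S(2)] by simp
  qed
  from Lim_in_closed_set[OF closed_complex_Reals this _ lim'] show ?thesis by simp
qed

definition div0 :: "(complex \<Rightarrow> complex) \<Rightarrow> complex \<Rightarrow> complex" where
  "div0 f l = (if l = 0 then deriv f 0 else f l / l)"

lemma div0_holomorphic:
  assumes "f holomorphic_on S" "open S" "f 0 = 0"
  shows "div0 f holomorphic_on S"
proof -
  have "div0 f = (\<lambda>z. if z = 0 then deriv f 0 else (f z - f 0) / (z - 0))"
    using assms(3) by (simp add: div0_def fun_eq_iff)
  then show ?thesis using pole_lemma_open[OF assms(1,2), of 0] by simp
qed

lemma div0_eq: "f 0 = 0 \<Longrightarrow> f l = l * div0 f l"
  by (simp add: div0_def)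

lemma div0_0 [simp]: "div0 f 0 = deriv f 0"
  by (simp add: div0_def)

lemma div0_real:
  assumes "f holomorphic_on S" "open S" "0 \<in> S"
    and "\<And>y. complex_of_real y \<in> S \<Longrightarrow> f (of_real y) \<in> \<real>" "complex_of_real x \<in> S"
  shows "div0 f (of_real x) \<in> \<real>"
  using deriv_real[OF assms(1,2) _ assms(4), of 0] assms(3,4,5) by (auto simp: div0_def)

lemma holomorphic_lipschitz_at_0:
  assumes "f holomorphic_on S" "open S" "0 \<in> S"
  obtains C d where "C > 0" "d > 0" "ball 0 d \<subseteq> S" "\<And>z. norm z < d \<Longrightarrow> norm (f z - f 0) \<le> C * norm z"
proof -
  have "(f has_field_derivative deriv f 0) (at 0)" by (rule holomorphic_derivI[OF assms])
  then have "((\<lambda>z. norm ((f z - f 0) / z)) \<longlongrightarrow> norm (deriv f 0)) (at 0)"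
    by (intro tendsto_norm) (simp add: has_field_derivative_iff)
  then have "\<forall>\<^sub>F z in at 0. norm ((f z - f 0) / z) < norm (deriv f 0) + 1"
    by (rule order_tendstoD(2)) simp
  then obtain d1 where d1: "d1 > 0" "\<And>z. z \<noteq> 0 \<Longrightarrow> norm z < d1 \<Longrightarrow> norm ((f z - f 0) / z) < norm (deriv f 0) + 1"
    unfolding eventually_at by (auto simp: dist_norm)
  obtain d2 where d2: "d2 > 0" "ball 0 d2 \<subseteq> S" using assms(2,3) open_contains_ball by blast
  show ?thesis
  proof (rule that[of "norm (deriv f 0) + 1" "min d1 d2"])
    show "norm (deriv f 0) + 1 > 0" using norm_ge_zero[of "deriv f 0"] by linarith
    show "min d1 d2 > 0" "ball 0 (min d1 d2) \<subseteq> S" using d1(1) d2 by auto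
    show "norm (f z - f 0) \<le> (norm (deriv f 0) + 1) * norm z" if "norm z < min d1 d2" for z
      using d1(2)[of z] that by (cases "z = 0") (auto simp: norm_divide pos_divide_less_eq)
  qed
qed

lemma holomorphic_second_order_at_0:
  assumes hol: "f holomorphic_on S" and S: "open S" "0 \<in> S"
  obtains C d where "C > 0" "d > 0" "ball 0 d \<subseteq> S"
    "\<And>z. norm z < d \<Longrightarrow> norm (f z - f 0 - deriv f 0 * z) \<le> C * (norm z)\<^sup>2"
proof -
  define q where "q = div0 (\<lambda>z. f z - f 0)"
  have D: "((\<lambda>z. f z - f 0) has_field_derivative deriv f 0) (at 0)"
    using holomorphic_derivI[OF hol S] by (auto intro!: derivative_eq_intros)
  have q: "q holomorphic_on S" unfolding q_def
    by (intro div0_holomorphic holomorphic_intros hol S) simp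
  have q0: "q 0 = deriv f 0" unfolding q_def using DERIV_imp_deriv[OF D] by simp
  obtain C d where C: "C > 0" "d > 0" "ball 0 d \<subseteq> S" "\<And>z. norm z < d \<Longrightarrow> norm (q z - q 0) \<le> C * norm z"
    by (rule holomorphic_lipschitz_at_0[OF q S]) (rule that)
  show ?thesis
  proof (rule that[OF C(1-3)])
    fix z :: complex assume z: "norm z < d"
    have "f z - f 0 - deriv f 0 * z = z * (q z - q 0)"
      using div0_eq[of "\<lambda>z. f z - f 0" z] unfolding q0 q_def[symmetric] by (simp add: algebra_simps)
    then have "norm (f z - f 0 - deriv f 0 * z) = norm z * norm (q z - q 0)" by (simp add: norm_mult)
    also have "\<dots> \<le> norm z * (C * norm z)" using C(4)[OF z] by (intro mult_left_mono) auto
    finally show "norm (f z - f 0 - deriv f 0 * z) \<le> C * (norm z)\<^sup>2" by (simp add: power2_eq_square mult_ac)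
  qed
qed

lemma second_deriv_times_id:
  assumes hol: "g holomorphic_on S" and S: "open S" "0 \<in> S" and f: "\<And>z. z \<in> S \<Longrightarrow> f z = z * g z"
  shows "(deriv ^^ 2) f 0 = 2 * deriv g 0"
proof -
  have "deriv f z = g z + z * deriv g z" if z: "z \<in> S" for z
  proof (rule DERIV_imp_deriv)
    have "((\<lambda>z. z * g z) has_field_derivative g z + z * deriv g z) (at z)"
      using holomorphic_derivI[OF hol S(1) z] by (auto intro!: derivative_eq_intros)
    then show "(f has_field_derivative g z + z * deriv g z) (at z)"
      by (rule has_field_derivative_transform_within_open[OF _ S(1) z]) (simp add: f)
  qed
  note d = this
  have "((\<lambda>z. g z + z * deriv g z) has_field_derivative 2 * deriv g 0) (at 0)"
    using holomorphic_derivI[OF hol S] holomorphic_derivI[OF holomorphic_deriv[OF hol S(1)] S]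
    by (auto intro!: derivative_eq_intros)
  then have "(deriv f has_field_derivative 2 * deriv g 0) (at 0)"
    by (rule has_field_derivative_transform_within_open[OF _ S]) (simp add: d)
  then show ?thesis by (simp add: numeral_2_eq_2 DERIV_imp_deriv)
qed

lemma holomorphic_imp_real_analytic:
  assumes "f holomorphic_on ball 0 r"
  shows "real_analytic_on (\<lambda>x. f (of_real x)) {-r<..<r}"
  unfolding real_analytic_on_def
proof (intro ballI)
  fix x0 assume x0: "x0 \<in> {-r<..<r}"
  define s where "s = r - \<bar>x0\<bar>"
  have s: "s > 0" unfolding s_def using x0 by auto
  have "ball (complex_of_real x0) s \<subseteq> ball 0 r"
    unfolding s_def by (rule ball_subset_ball_iff[THEN iffD2]) (simp add: dist_norm)
  then have hol: "f holomorphic_on ball (of_real x0) s" using assms holomorphic_on_subset by blast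
  show "\<exists>r>0. \<exists>a. \<forall>x. \<bar>x - x0\<bar> < r \<longrightarrow> (\<lambda>n. a n * complex_of_real (x - x0) ^ n) sums f (of_real x)"
  proof (intro exI conjI allI impI)
    show "s > 0" by fact
    fix x assume "\<bar>x - x0\<bar> < s"
    then have "complex_of_real x \<in> ball (of_real x0) s"
      by (simp add: dist_norm norm_minus_commute flip: of_real_diff)
    from holomorphic_power_series[OF hol this]
    show "(\<lambda>n. (deriv ^^ n) f (of_real x0) / fact n * complex_of_real (x - x0) ^ n) sums f (of_real x)" by simp
  qed
qed

lemma zorder_factor_global:
  assumes hol: "f holomorphic_on S" and S: "open S" "connected S" and r: "r \<in> S" "f r = 0"
    and nz: "\<exists>w\<in>S. f w \<noteq> 0"
  obtains g where "g holomorphic_on S" "g r \<noteq> 0" "zorder f r > 0"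
    "\<And>z. z \<in> S \<Longrightarrow> f z = g z * (z - r) ^ nat (zorder f r)"
proof -
  define n where "n = nat (zorder f r)"
  obtain e where e: "e > 0" "cball r e \<subseteq> S" "zorder f r > 0" "zor_poly f r holomorphic_on cball r e"
      "\<And>w. w \<in> cball r e \<Longrightarrow> f w = zor_poly f r w * (w - r) ^ n \<and> zor_poly f r w \<noteq> 0"
    using zorder_exist_zero[OF hol S r(1) nz] r(2) unfolding n_def by auto
  define g where "g z = (if z = r then zor_poly f r r else f z / (z - r) ^ n)" for z
  have g_ball: "g z = zor_poly f r z" if "z \<in> ball r e" for z
    using e(5)[of z] that unfolding g_def by auto
  have "g holomorphic_on ball r e"
    using holomorphic_on_subset[OF e(4) ball_subset_cball] by (rule holomorphic_transform) (simp add: g_ball)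
  moreover have "g holomorphic_on (S - {r})"
  proof (rule holomorphic_transform)
    show "(\<lambda>z. f z / (z - r) ^ n) holomorphic_on (S - {r})"
      by (intro holomorphic_intros holomorphic_on_subset[OF hol]) auto
  qed (auto simp: g_def)
  ultimately have "g holomorphic_on (ball r e \<union> (S - {r}))"
    using S(1) by (intro holomorphic_on_Un open_delete) auto
  moreover have "ball r e \<union> (S - {r}) = S" using e(1,2) r(1) ball_subset_cball by fastforce
  ultimately have "g holomorphic_on S" by simp
  moreover have "g r \<noteq> 0" using e(5)[of r] e(1) unfolding g_def by auto
  moreover have "f z = g z * (z - r) ^ n" if "z \<in> S" for z
    using r(2) e(3) unfolding g_def n_def by auto
  ultimately show ?thesis using e(3) that unfolding n_def by blast
qed

lemma sum_zorder_parity: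
  assumes "f holomorphic_on S" and S: "open S" "connected S"
    and ab: "a < b" "of_real ` {a..b} \<subseteq> S"
    and real: "\<And>x. x \<in> {a..b} \<Longrightarrow> f (of_real x) \<in> \<real>"
    and ends: "f (of_real a) \<noteq> 0" "f (of_real b) \<noteq> 0"
  shows "finite {z \<in> of_real ` {a..b}. f z = 0} \<and>
    (even (\<Sum>z\<in>{z \<in> of_real ` {a..b}. f z = 0}. zorder f z) \<longleftrightarrow> Re (f (of_real a)) * Re (f (of_real b)) > 0)"
proof -
  let ?Z = "\<lambda>f. {z \<in> complex_of_real ` {a..b}. f z = 0}"
  have fin: "finite (?Z f)" if "f holomorphic_on S" "f (of_real a) \<noteq> 0" for f :: "complex \<Rightarrow> complex"
  proof (cases "?Z f = {}")
    case True then show ?thesis by (metis finite.emptyI)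
  next
    case False
    then obtain z where z: "z \<in> of_real ` {a..b}" "f z = 0" by auto
    have "\<not> f constant_on S"
    proof
      assume "f constant_on S"
      moreover have "z \<in> S" "of_real a \<in> S" using z(1) ab by auto
      ultimately show False using z(2) \<open>f (of_real a) \<noteq> 0\<close> unfolding constant_on_def by metis
    qed
    moreover have "compact (complex_of_real ` {a..b})"
      by (intro compact_continuous_image continuous_on_of_real_id compact_Icc)
    ultimately show ?thesis using holomorphic_compact_finite_zeros[OF that(1) S _ ab(2)] by blast
  qed
  have "even (\<Sum>z\<in>?Z f. zorder f z) \<longleftrightarrow> Re (f (of_real a)) * Re (f (of_real b)) > 0"
    using assms(1) real ends
  proof (induction "card (?Z f)" arbitrary: f)
    case 0
    then have none: "f (of_real x) \<noteq> 0" if "x \<in> {a..b}" for x using fin[OF 0(2) 0(4)] that by auto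
    have cont: "continuous_on {a..b} (\<lambda>x. Re (f (of_real x)))"
      by (intro continuous_intros continuous_on_compose2[OF holomorphic_on_imp_continuous_on[OF 0(2)] _ ab(2)])
    have nz: "Re (f (of_real x)) \<noteq> 0" if "x \<in> {a..b}" for x
      using none[OF that] 0(3)[OF that] by (metis complex_is_Real_iff complex_eq_iff zero_complex.sel)
    have "Re (f (of_real a)) * Re (f (of_real b)) > 0"
      using nonvanishing_same_sign[OF less_imp_le[OF ab(1)] cont nz] .
    moreover have "?Z f = {}" using none by auto
    ultimately show ?case by (simp only: sum.empty) simp
  next
    case (Suc m)
    have finZ: "finite (?Z f)" by (rule fin[OF Suc(3) Suc(5)])
    have "?Z f \<noteq> {}" using Suc(2) by force
    then obtain x where x: "x \<in> {a..b}" "f (of_real x) = 0" by auto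
    let ?r = "complex_of_real x"
    have axb: "a < x" "x < b" using x Suc(5,6) by (cases "x = a"; cases "x = b"; auto)+
    have rS: "?r \<in> S" using x ab(2) by auto
    have aS: "of_real a \<in> S" and bS: "of_real b \<in> S" using ab by auto
    obtain g where g: "g holomorphic_on S" "g ?r \<noteq> 0" and n_pos: "zorder f ?r > 0"
      and fac: "\<And>z. z \<in> S \<Longrightarrow> f z = g z * (z - ?r) ^ nat (zorder f ?r)"
      using zorder_factor_global[OF Suc(3) S rS x(2)] Suc(5) aS by blast
    define n where "n = nat (zorder f ?r)"
    have Zg: "?Z g = ?Z f - {?r}" using fac ab(2) g(2) n_pos by (auto simp: zero_less_nat_eq)
    then have card: "m = card (?Z g)" using Suc(2) finZ x by auto
    have g_real: "g (of_real y) \<in> \<real>" if y: "y \<in> {a..b}" "y \<noteq> x" for y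
    proof -
      have "f (of_real y) = g (of_real y) * of_real (y - x) ^ n"
        using fac[of "of_real y"] y subsetD[OF ab(2), of "of_real y"] unfolding n_def by simp
      then have "g (of_real y) = f (of_real y) / of_real ((y - x) ^ n)" using y by simp
      then show ?thesis using Suc(4)[OF y(1)] by simp
    qed
    have g_real': "g (of_real y) \<in> \<real>" if y: "y \<in> {a..b}" for y
    proof (cases "y = x")
      case True
      have "isCont g ?r" using holomorphic_on_imp_continuous_on[OF g(1)] S(1) rS continuous_on_eq_continuous_at by blast
      then have lim: "((\<lambda>y. g (of_real y)) \<longlongrightarrow> g ?r) (at x)"
        by (rule isCont_tendsto_compose) (auto intro!: tendsto_eq_intros)
      have "\<forall>\<^sub>F y in at x. g (of_real y) \<in> \<real>"
        unfolding eventually_at_topological using g_real axb by (intro exI[of _ "{a<..<b}"]) auto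
      from Lim_in_closed_set[OF closed_complex_Reals this _ lim] show ?thesis using True by simp
    next
      case False then show ?thesis using g_real y by blast
    qed
    have g_ends: "g (of_real a) \<noteq> 0" "g (of_real b) \<noteq> 0" using fac[OF aS] fac[OF bS] Suc(5,6) by auto
    have IH: "even (\<Sum>z\<in>?Z g. zorder g z) \<longleftrightarrow> Re (g (of_real a)) * Re (g (of_real b)) > 0"
      by (rule Suc(1)[OF card g(1) g_real' g_ends])
    have zo: "zorder f z = zorder g z" if z: "z \<in> ?Z g" for z
    proof -
      have zS: "z \<in> S" using z ab(2) by auto
      have z_r: "z \<noteq> ?r" using z Zg by auto
      have an: "g analytic_on {z}" by (rule holomorphic_on_imp_analytic_at[OF g(1) S(1) zS])
      have pa: "(\<lambda>w. (w - ?r) ^ n) analytic_on {z}" by (intro analytic_intros)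
      have ev: "\<forall>\<^sub>F w in at z. f w = g w * (w - ?r) ^ n"
        using eventually_at_in_open'[OF S(1) zS] by eventually_elim (use fac n_def in auto)
      have fz: "f z = 0" using z Zg by auto
      obtain e where "0 < e" "ball z e \<subseteq> S" "\<And>w. w \<in> ball z e - {z} \<Longrightarrow> f w \<noteq> 0"
        by (rule isolated_zeros[OF Suc(3) S zS fz aS Suc(5)]) (rule that)
      then have "\<forall>\<^sub>F w in at z. f w \<noteq> 0"
        unfolding eventually_at by (intro exI[of _ e]) (auto simp: dist_commute)
      then have "\<forall>\<^sub>F w in at z. g w * (w - ?r) ^ n \<noteq> 0" using ev by eventually_elim simp
      then have fr: "\<exists>\<^sub>F w in at z. g w * (w - ?r) ^ n \<noteq> 0" by (rule eventually_frequently[rotated]) simp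
      have "zorder f z = zorder (\<lambda>w. g w * (w - ?r) ^ n) z" by (rule zorder_cong[OF ev refl])
      also have "\<dots> = zorder g z + zorder (\<lambda>w. (w - ?r) ^ n) z"
        using zorder_times_analytic'[OF _ _ pa fr] an isolated_singularity_at_analytic not_essential_analytic by blast
      also have "zorder (\<lambda>w. (w - ?r) ^ n) z = 0" by (rule zorder_eq_0I[OF pa]) (use z_r in simp)
      finally show ?thesis by simp
    qed
    have "(\<Sum>z\<in>?Z f. zorder f z) = zorder f ?r + (\<Sum>z\<in>?Z f - {?r}. zorder f z)"
      using finZ x by (intro sum.remove) auto
    also have "(\<Sum>z\<in>?Z f - {?r}. zorder f z) = (\<Sum>z\<in>?Z g. zorder g z)"
      unfolding Zg[symmetric] by (rule sum.cong[OF refl zo])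
    finally have "even (\<Sum>z\<in>?Z f. zorder f z) \<longleftrightarrow> (even n \<longleftrightarrow> even (\<Sum>z\<in>?Z g. zorder g z))"
      unfolding n_def using n_pos by (auto simp: even_nat_iff)
    moreover have "Re (f (of_real y)) = Re (g (of_real y)) * (y - x) ^ n" if "y \<in> {a..b}" for y
    proof -
      have "f (of_real y) = g (of_real y) * of_real ((y - x) ^ n)"
        using fac[of "of_real y"] that subsetD[OF ab(2), of "of_real y"] unfolding n_def by simp
      then show ?thesis by simp
    qed
    then have fg: "Re (f (of_real a)) = Re (g (of_real a)) * (a - x) ^ n" "Re (f (of_real b)) = Re (g (of_real b)) * (b - x) ^ n"
      using ab(1) by auto
    have pb: "(b - x) ^ n > 0" using axb by simp
    have nzg: "Re (g (of_real a)) \<noteq> 0" "Re (g (of_real b)) \<noteq> 0"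
      using g_real'[of a] g_real'[of b] g_ends ab(1) by (auto simp: complex_is_Real_iff complex_eq_iff)
    have "Re (f (of_real a)) * Re (f (of_real b)) > 0 \<longleftrightarrow> (even n \<longleftrightarrow> Re (g (of_real a)) * Re (g (of_real b)) > 0)"
    proof (cases "even n")
      case True
      then have "(a - x) ^ n > 0" using axb by (simp add: zero_less_power_eq)
      moreover have "0 < p * c * (p' * d) \<longleftrightarrow> 0 < p * p'" if "c > 0" "d > 0" for p p' c d :: real
        using that by (auto simp: zero_less_mult_iff mult_less_0_iff)
      ultimately show ?thesis using True pb unfolding fg by blast
    next
      case False
      then have "(a - x) ^ n < 0" using axb by (simp add: power_less_zero_eq)
      moreover have "0 < p * c * (p' * d) \<longleftrightarrow> \<not> 0 < p * p'"
        if "c < 0" "d > 0" "p \<noteq> 0" "p' \<noteq> 0" for p p' c d :: real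
        using that by (auto simp: zero_less_mult_iff mult_less_0_iff)
      ultimately show ?thesis using False pb nzg unfolding fg by blast
    qed
    ultimately show ?case using IH by blast
  qed
  then show ?thesis using fin[OF assms(1) ends(1)] by blast
qed

lemma positive_real_roots_parity:
  assumes hol: "f holomorphic_on S" and S: "open S" "connected S" "\<And>x. x \<ge> 0 \<Longrightarrow> complex_of_real x \<in> S"
    and real: "\<And>x. x \<ge> 0 \<Longrightarrow> f (of_real x) \<in> \<real>"
    and small: "\<forall>\<^sub>F x in at_right 0. Re (f (of_real x)) * s > 0"
    and large: "\<forall>\<^sub>F x in at_top. Re (f (of_real x)) * t > 0"
  shows "finite (positive_real_roots f) \<and> (even (num_positive_real_roots f) \<longleftrightarrow> t * s > 0)"
proof -
  obtain d where d: "d > 0" "\<And>x. 0 < x \<Longrightarrow> x < d \<Longrightarrow> Re (f (of_real x)) * s > 0"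
    using small unfolding eventually_at_right_field by auto
  obtain L where L: "\<And>x. x \<ge> L \<Longrightarrow> Re (f (of_real x)) * t > 0"
    using large unfolding eventually_at_top_linorder by auto
  define a where "a = d / 2"
  define b where "b = max L d"
  have a: "0 < a" "a < d" "a < b" unfolding a_def b_def using d(1) by auto
  have fa: "Re (f (of_real a)) * s > 0" using d(2) a by auto
  have fb: "Re (f (of_real b)) * t > 0" using L[of b] unfolding b_def by auto
  have roots: "positive_real_roots f = {z \<in> of_real ` {a..b}. f z = 0}"
  proof (intro set_eqI iffI)
    fix z assume z: "z \<in> positive_real_roots f"
    then obtain x where x: "z = of_real x" "x > 0" "f (of_real x) = 0"
      unfolding positive_real_roots_def by (auto elim: Reals_cases)
    have "a \<le> x"
    proof (rule ccontr)
      assume "\<not> a \<le> x" then show False using d(2)[of x] x a by simp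
    qed
    moreover have "x \<le> b"
    proof (rule ccontr)
      assume "\<not> x \<le> b"
      then have "L \<le> x" unfolding b_def by auto
      then show False using L[of x] x by simp
    qed
    ultimately show "z \<in> {z \<in> of_real ` {a..b}. f z = 0}" using x by auto
  next
    fix z assume "z \<in> {z \<in> of_real ` {a..b}. f z = 0}"
    then show "z \<in> positive_real_roots f" unfolding positive_real_roots_def using a by auto
  qed
  have "finite {z \<in> of_real ` {a..b}. f z = 0} \<and>
    (even (\<Sum>z\<in>{z \<in> of_real ` {a..b}. f z = 0}. zorder f z) \<longleftrightarrow> Re (f (of_real a)) * Re (f (of_real b)) > 0)"
    by (rule sum_zorder_parity[OF hol S(1,2) a(3)]) (use S(3) real a fa fb in auto)
  moreover have "Re (f (of_real a)) * Re (f (of_real b)) > 0 \<longleftrightarrow> t * s > 0"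
    using fa fb by (auto simp: zero_less_mult_iff)
  ultimately show ?thesis unfolding num_positive_real_roots_def roots by simp
qed

section \<open>The two-term form of the Evans-Lopatinsky determinant\<close>

locale evans_split =
  fixes S :: "complex set" and X :: real and A B \<eta> :: "complex \<Rightarrow> complex"
    and D :: "complex \<Rightarrow> real \<Rightarrow> complex"
  assumes S: "open S" "connected S" "\<And>x. x \<ge> 0 \<Longrightarrow> complex_of_real x \<in> S"
    and X: "X > 0"
    and hol: "A holomorphic_on S" "B holomorphic_on S" "\<eta> holomorphic_on S"
    and zero: "A 0 = 0" "B 0 = 0" and deriv_eq: "deriv A 0 = deriv B 0"
    and D: "\<And>l \<xi>. l \<in> S \<Longrightarrow> D l \<xi> = A l - exp (\<i> * of_real (\<xi> * X)) * B l"
    and D_real: "\<And>x. complex_of_real x \<in> S \<Longrightarrow> D (of_real x) 0 \<in> \<real> \<and> D (of_real x) (pi / X) \<in> \<real>"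
    and nondegenerate: "alpha0 D \<noteq> 0"
    and \<eta>: "\<And>x. x \<ge> 0 \<Longrightarrow> \<eta> (of_real x) \<noteq> 0"
    and ratio: "\<And>x. x \<ge> 0 \<Longrightarrow> A (of_real x) / \<eta> (of_real x) \<in> \<real>"
      "\<And>x. x \<ge> 0 \<Longrightarrow> B (of_real x) / \<eta> (of_real x) \<in> \<real>"
    and dominant: "\<exists>L. \<forall>x>L. \<bar>Re (B (of_real x) / \<eta> (of_real x))\<bar> < Re (A (of_real x) / \<eta> (of_real x))"
begin

lemma zero_in_S: "0 \<in> S" using S(3)[of 0] by simp

definition "Ah = div0 A"
definition "Bh = div0 B"
definition "Gh l = Ah l - Bh l"

lemma hol_hat: "Ah holomorphic_on S" "Bh holomorphic_on S" "Gh holomorphic_on S"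
  unfolding Gh_def Ah_def Bh_def by (intro holomorphic_intros div0_holomorphic hol S zero)+

lemma AB_hat: "A l = l * Ah l" "B l = l * Bh l"
  unfolding Ah_def Bh_def by (intro div0_eq zero)+

lemma Gh_0: "Gh 0 = 0"
  unfolding Gh_def Ah_def Bh_def using deriv_eq by simp

lemma exp_pi: "exp (\<i> * of_real (pi / X * X)) = - 1"
  using X by simp

lemma D_0: "l \<in> S \<Longrightarrow> D l 0 = l * Gh l"
  using D[of l 0] AB_hat[of l] by (simp add: Gh_def algebra_simps)

lemma D_pi: "l \<in> S \<Longrightarrow> D l (pi / X) = l * (Ah l + Bh l)"
  using D[of l "pi / X"] AB_hat[of l] unfolding exp_pi by (simp add: algebra_simps)

lemma reduced_D:
  assumes "l \<in> S"
  shows "reduced D l \<xi> = Ah l - exp (\<i> * of_real (\<xi> * X)) * Bh l"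
proof (cases "l = 0")
  case True
  have "((\<lambda>z. A z - exp (\<i> * of_real (\<xi> * X)) * B z) has_field_derivative
      deriv A 0 - exp (\<i> * of_real (\<xi> * X)) * deriv B 0) (at 0)"
    using holomorphic_derivI[OF hol(1) S(1) zero_in_S] holomorphic_derivI[OF hol(2) S(1) zero_in_S]
    by (auto intro!: derivative_eq_intros)
  then have "((\<lambda>z. D z \<xi>) has_field_derivative deriv A 0 - exp (\<i> * of_real (\<xi> * X)) * deriv B 0) (at 0)"
    by (rule has_field_derivative_transform_within_open[OF _ S(1) zero_in_S]) (simp add: D)
  then show ?thesis using True by (simp add: reduced_def Ah_def Bh_def DERIV_imp_deriv)
next
  case False
  have "D l \<xi> / l = (l * Ah l - exp (\<i> * of_real (\<xi> * X)) * (l * Bh l)) / l"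
    using D[OF assms] AB_hat[of l] by simp
  then show ?thesis using False by (simp add: reduced_def diff_divide_distrib)
qed

lemma reduced_D':
  "l \<in> S \<Longrightarrow> reduced D l \<xi> = Gh l - (exp (\<i> * of_real (\<xi> * X)) - 1) * Bh l"
  by (simp add: reduced_D Gh_def algebra_simps)

lemma reduced_holomorphic:
  "(\<lambda>l. reduced D l \<xi>) holomorphic_on S" "l \<in> S \<Longrightarrow> D l \<xi> = l * reduced D l \<xi>"
proof -
  have "(\<lambda>l. Ah l - exp (\<i> * of_real (\<xi> * X)) * Bh l) holomorphic_on S"
    by (intro holomorphic_intros hol_hat)
  then show "(\<lambda>l. reduced D l \<xi>) holomorphic_on S"
    by (rule holomorphic_transform) (simp add: reduced_D)
  show "D l \<xi> = l * reduced D l \<xi>" if "l \<in> S"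
    unfolding reduced_D[OF that] D[OF that] AB_hat[of l] by (simp add: algebra_simps)
qed

lemma alpha0_eq: "alpha0 D = deriv Gh 0"
  unfolding alpha0_def
proof (rule DERIV_imp_deriv)
  show "((\<lambda>l. reduced D l 0) has_field_derivative deriv Gh 0) (at 0)"
    by (rule has_field_derivative_transform_within_open[OF holomorphic_derivI[OF hol_hat(3) S(1) zero_in_S] S(1) zero_in_S])
      (simp add: reduced_D')
qed

lemma exp_deriv: "((\<lambda>\<xi>. a - exp (\<i> * of_real (\<xi> * X)) * b) has_vector_derivative - \<i> * of_real X * b) (at 0)"
proof -
  have "((\<lambda>z. a - exp (\<i> * (z * of_real X)) * b) has_field_derivative - \<i> * of_real X * b) (at (complex_of_real 0))"
    by (auto intro!: derivative_eq_intros)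
  from has_vector_derivative_real_field[OF this] show ?thesis by simp
qed

lemma alpha1_eq: "alpha1 D = - \<i> * of_real X * Bh 0"
proof -
  have "(\<lambda>\<xi>. reduced D 0 \<xi>) = (\<lambda>\<xi>. Ah 0 - exp (\<i> * of_real (\<xi> * X)) * Bh 0)"
    using reduced_D[OF zero_in_S] by (simp add: fun_eq_iff)
  then show ?thesis unfolding alpha1_def using vector_derivative_at[OF exp_deriv] by simp
qed

lemma alpha1_mixed: "alpha1 D = deriv (\<lambda>l. vector_derivative (\<lambda>\<xi>. D l \<xi>) (at 0)) 0"
proof -
  have eq: "vector_derivative (\<lambda>\<xi>. D l \<xi>) (at 0) = - \<i> * of_real X * B l" if "l \<in> S" for l
  proof -
    have "(\<lambda>\<xi>. D l \<xi>) = (\<lambda>\<xi>. A l - exp (\<i> * of_real (\<xi> * X)) * B l)"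
      using D[OF that] by (simp add: fun_eq_iff)
    then show ?thesis using vector_derivative_at[OF exp_deriv] by simp
  qed
  have "((\<lambda>l. - \<i> * of_real X * B l) has_field_derivative - \<i> * of_real X * deriv B 0) (at 0)"
    using holomorphic_derivI[OF hol(2) S(1) zero_in_S] by (auto intro!: derivative_eq_intros)
  then have "((\<lambda>l. vector_derivative (\<lambda>\<xi>. D l \<xi>) (at 0)) has_field_derivative - \<i> * of_real X * deriv B 0) (at 0)"
    by (rule has_field_derivative_transform_within_open[OF _ S(1) zero_in_S]) (simp add: eq)
  then show ?thesis by (simp add: alpha1_eq Bh_def DERIV_imp_deriv)
qed

lemma alpha0_second: "alpha0 D = (deriv ^^ 2) (\<lambda>l. D l 0) 0 / 2"
  using second_deriv_times_id[OF hol_hat(3) S(1) zero_in_S, of "\<lambda>l. D l 0"]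
  by (simp add: D_0 alpha0_eq)

lemma AB_real:
  assumes "complex_of_real x \<in> S"
  shows "A (of_real x) \<in> \<real>" "B (of_real x) \<in> \<real>"
proof -
  note d = D_real[OF assms]
  have A: "A (of_real x) = (D (of_real x) 0 + D (of_real x) (pi / X)) / 2"
    using D[OF assms, of 0] D[OF assms, of "pi / X"] unfolding exp_pi by simp
  have B: "B (of_real x) = (D (of_real x) (pi / X) - D (of_real x) 0) / 2"
    using D[OF assms, of 0] D[OF assms, of "pi / X"] unfolding exp_pi by simp
  show "A (of_real x) \<in> \<real>" unfolding A using d by (intro Reals_divide Reals_add) auto
  show "B (of_real x) \<in> \<real>" unfolding B using d by (intro Reals_divide Reals_diff) auto
qed

lemma hat_real:
  assumes "complex_of_real x \<in> S"
  shows "Ah (of_real x) \<in> \<real>" "Bh (of_real x) \<in> \<real>" "Gh (of_real x) \<in> \<real>"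
proof -
  show "Ah (of_real x) \<in> \<real>" unfolding Ah_def by (rule div0_real[OF hol(1) S(1) zero_in_S AB_real(1) assms])
  moreover show "Bh (of_real x) \<in> \<real>" unfolding Bh_def by (rule div0_real[OF hol(2) S(1) zero_in_S AB_real(2) assms])
  ultimately show "Gh (of_real x) \<in> \<real>" unfolding Gh_def by (rule Reals_diff)
qed

lemma alpha0_real: "alpha0 D \<in> \<real>"
  unfolding alpha0_eq using deriv_real[OF hol_hat(3) S(1), of 0] hat_real(3) zero_in_S by simp

lemma Bh0_real: "Bh 0 \<in> \<real>"
  using hat_real(2)[of 0] zero_in_S by simp

lemma alpha1_real: "alpha1 D / \<i> \<in> \<real>"
proof -
  have "alpha1 D / \<i> = - (of_real X * Bh 0)"
    unfolding alpha1_eq by (simp only: divide_eq_eq) (simp add: mult_ac)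
  then show ?thesis using Bh0_real by simp
qed

lemma alpha_eq:
  "alpha1 D / (\<i> * alpha0 D) = - of_real X * Bh 0 / deriv Gh 0"
  "alpha1 D / (\<i> * alpha0 D) = of_real (Re (alpha1 D / (\<i> * alpha0 D)))"
proof -
  show eq: "alpha1 D / (\<i> * alpha0 D) = - of_real X * Bh 0 / deriv Gh 0"
    by (simp add: alpha0_eq alpha1_eq)
  have "alpha1 D / (\<i> * alpha0 D) \<in> \<real>"
    unfolding eq alpha0_eq[symmetric] by (intro Reals_divide Reals_mult Reals_minus Reals_of_real Bh0_real alpha0_real)
  then show "alpha1 D / (\<i> * alpha0 D) = of_real (Re (alpha1 D / (\<i> * alpha0 D)))"
    by (simp add: of_real_Re)
qed

lemma norm_exp_minus_one: "norm (exp (\<i> * complex_of_real t) - 1) \<le> \<bar>t\<bar>"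
  using abs_sin_x_le_abs_x[of "t / 2"] by (simp add: dist_exp_i_1)

lemma low_freq: "low_freq_expansion X D (alpha0 D) (alpha1 D)"
proof -
  obtain C1 d1 where C1: "C1 > 0" "d1 > 0" "ball 0 d1 \<subseteq> S"
      "\<And>l. norm l < d1 \<Longrightarrow> norm (Gh l - Gh 0 - deriv Gh 0 * l) \<le> C1 * (norm l)\<^sup>2"
    by (rule holomorphic_second_order_at_0[OF hol_hat(3) S(1) zero_in_S]) (rule that)
  obtain C2 d2 where C2: "C2 > 0" "d2 > 0" "ball 0 d2 \<subseteq> S" "\<And>l. norm l < d2 \<Longrightarrow> norm (Bh l - Bh 0) \<le> C2 * norm l"
    by (rule holomorphic_lipschitz_at_0[OF hol_hat(2) S(1) zero_in_S]) (rule that)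
  show ?thesis unfolding low_freq_expansion_def
  proof (rule exI[of _ "C1 + X * C2"], rule exI[of _ "min d1 d2"], intro conjI allI ballI impI)
    show "0 < min d1 d2" using C1 C2 by simp
    fix l :: complex and \<xi> :: real assume l: "norm l < min d1 d2"
    then have lS: "l \<in> S" using C1(3) by auto
    let ?E = "exp (\<i> * of_real (\<xi> * X))"
    have eq: "reduced D l \<xi> - (alpha0 D * l + (?E - 1) / (\<i> * of_real X) * alpha1 D)
      = (Gh l - Gh 0 - deriv Gh 0 * l) - (?E - 1) * (Bh l - Bh 0)"
      unfolding reduced_D'[OF lS] alpha0_eq alpha1_eq using X by (simp add: Gh_0 field_simps)
    have "norm ((Gh l - Gh 0 - deriv Gh 0 * l) - (?E - 1) * (Bh l - Bh 0)) \<le> norm (Gh l - Gh 0 - deriv Gh 0 * l) + norm (?E - 1) * norm (Bh l - Bh 0)"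
      by (rule order_trans[OF norm_triangle_ineq4]) (simp only: norm_mult order_refl)
    also have "\<dots> \<le> C1 * (norm l)\<^sup>2 + (\<bar>\<xi>\<bar> * X) * (C2 * norm l)"
    proof (rule add_mono)
      show "norm (Gh l - Gh 0 - deriv Gh 0 * l) \<le> C1 * (norm l)\<^sup>2" using C1(4) l by simp
      have "norm (?E - 1) \<le> \<bar>\<xi>\<bar> * X"
        using norm_exp_minus_one[of "\<xi> * X"] X by (simp add: abs_mult)
      moreover have "norm (Bh l - Bh 0) \<le> C2 * norm l" using C2(4) l by simp
      ultimately show "norm (?E - 1) * norm (Bh l - Bh 0) \<le> (\<bar>\<xi>\<bar> * X) * (C2 * norm l)"
        using X by (intro mult_mono) auto
    qed
    also have "\<dots> \<le> (C1 + X * C2) * (norm l * (norm l + \<bar>\<xi>\<bar>))"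
    proof -
      have "0 \<le> X * C2 * (norm l)\<^sup>2 + C1 * (norm l * \<bar>\<xi>\<bar>)" using X C1(1) C2(1) by simp
      then show ?thesis by (simp add: algebra_simps power2_eq_square)
    qed
    finally show "norm (reduced D l \<xi> - (alpha0 D * l + (?E - 1) / (\<i> * of_real X) * alpha1 D))
      \<le> (C1 + X * C2) * (norm l * (norm l + \<bar>\<xi>\<bar>))" unfolding eq .
  qed
qed

lemma \<eta>_real:
  assumes "x \<ge> 0" shows "\<eta> (of_real x) \<in> \<real>"
proof -
  have D0_nz: "\<exists>w\<in>S. Gh w \<noteq> 0"
  proof (rule ccontr)
    assume "\<not> ?thesis"
    then have Gh_zero: "0 = Gh w" if "w \<in> S" for w using that by simp
    have "((\<lambda>_. 0) has_field_derivative 0) (at (0::complex))" by simp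
    then have "(Gh has_field_derivative 0) (at 0)"
      by (rule has_field_derivative_transform_within_open[OF _ S(1) zero_in_S Gh_zero])
    then show False using nondegenerate DERIV_imp_deriv unfolding alpha0_eq by blast
  qed
  have nz_real: "\<eta> (of_real y) \<in> \<real>" if y: "y \<ge> 0" "y \<noteq> 0" "Gh (of_real y) \<noteq> 0" for y
  proof -
    have yS: "complex_of_real y \<in> S" using S(3) y by auto
    let ?r = "D (of_real y) 0 / \<eta> (of_real y)"
    have "?r = A (of_real y) / \<eta> (of_real y) - B (of_real y) / \<eta> (of_real y)"
      using D[OF yS, of 0] by (simp add: diff_divide_distrib)
    then have "?r \<in> \<real>" using ratio[OF y(1)] by simp
    moreover have "D (of_real y) 0 \<in> \<real>" using D_real[OF yS] by simp
    moreover have "D (of_real y) 0 \<noteq> 0" using D_0[OF yS] y by simp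
    then have "\<eta> (of_real y) = D (of_real y) 0 / ?r" using \<eta>[OF y(1)] by simp
    ultimately show ?thesis by (metis Reals_divide)
  qed
  have xS: "complex_of_real x \<in> S" using S(3) assms by auto
  obtain e where e: "e > 0" "\<And>z. z \<in> ball (of_real x) e - {of_real x} \<Longrightarrow> Gh z \<noteq> 0"
  proof (cases "Gh (of_real x) = 0")
    case True
    obtain w where w: "w \<in> S" "Gh w \<noteq> 0" using D0_nz by blast
    obtain e where e: "0 < e" "ball (of_real x) e \<subseteq> S" "\<And>z. z \<in> ball (of_real x) e - {of_real x} \<Longrightarrow> Gh z \<noteq> 0"
      by (rule isolated_zeros[OF hol_hat(3) S(1,2) xS True w]) (rule that)
    show ?thesis by (rule that[OF e(1,3)])
  next
    case False
    have "isCont Gh (of_real x)"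
      using holomorphic_on_imp_continuous_on[OF hol_hat(3)] S(1) xS continuous_on_eq_continuous_at by blast
    from continuous_at_avoid[OF this False] obtain e
      where "e > 0" "\<And>z. dist (of_real x) z < e \<Longrightarrow> Gh z \<noteq> 0" by blast
    then show ?thesis by (intro that) auto
  qed
  have "isCont \<eta> (of_real x)"
    using holomorphic_on_imp_continuous_on[OF hol(3)] S(1) xS continuous_on_eq_continuous_at by blast
  then have lim: "((\<lambda>y. \<eta> (of_real y)) \<longlongrightarrow> \<eta> (of_real x)) (at_right x)"
    by (rule isCont_tendsto_compose) (auto intro!: tendsto_eq_intros)
  have "\<forall>\<^sub>F y in at_right x. y \<in> {x<..<x + e}" using e(1) by (intro eventually_at_rightI) auto
  then have "\<forall>\<^sub>F y in at_right x. \<eta> (of_real y) \<in> \<real>"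
  proof eventually_elim
    case (elim y)
    then have "Gh (of_real y) \<noteq> 0"
      by (intro e(2)) (auto simp: dist_norm abs_if simp flip: of_real_diff)
    then show ?case using nz_real[of y] elim assms by auto
  qed
  from Lim_in_closed_set[OF closed_complex_Reals this trivial_limit_at_right_real lim] show ?thesis .
qed

lemma \<eta>_sign:
  assumes "x \<ge> 0" shows "Re (\<eta> (of_real x)) * Re (\<eta> 0) > 0"
proof -
  have nz: "Re (\<eta> (of_real y)) \<noteq> 0" if "y \<ge> 0" for y
    using \<eta>[OF that] \<eta>_real[OF that] by (auto simp: complex_is_Real_iff complex_eq_iff)
  have sub: "of_real ` {0..x} \<subseteq> S" using S(3) by auto
  have cont: "continuous_on {0..x} (\<lambda>y. Re (\<eta> (of_real y)))"
    by (intro continuous_intros continuous_on_compose2[OF holomorphic_on_imp_continuous_on[OF hol(3)] _ sub])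
  show ?thesis using nonvanishing_same_sign[OF assms cont] nz by (simp add: mult.commute)
qed

lemma D_large:
  "\<forall>\<^sub>F x in at_top. Re (D (of_real x) 0) * Re (\<eta> 0) > 0"
  "\<forall>\<^sub>F x in at_top. Re (D (of_real x) (pi / X)) * Re (\<eta> 0) > 0"
proof -
  obtain L where L: "\<And>x. x > L \<Longrightarrow> \<bar>Re (B (of_real x) / \<eta> (of_real x))\<bar> < Re (A (of_real x) / \<eta> (of_real x))"
    using dominant by blast
  have *: "Re (D (of_real x) 0) * Re (\<eta> 0) > 0 \<and> Re (D (of_real x) (pi / X)) * Re (\<eta> 0) > 0"
    if x: "x > L" "x \<ge> 0" for x
  proof -
    have xS: "complex_of_real x \<in> S" using S(3) x by auto
    let ?a = "Re (A (of_real x) / \<eta> (of_real x))" and ?b = "Re (B (of_real x) / \<eta> (of_real x))"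
      and ?s = "Re (\<eta> (of_real x))"
    have s: "\<eta> (of_real x) = of_real ?s" using \<eta>_real[OF x(2)] by (simp add: of_real_Re)
    have "A (of_real x) = of_real ?a * of_real ?s" "B (of_real x) = of_real ?b * of_real ?s"
      using ratio[OF x(2)] \<eta>[OF x(2)] unfolding s[symmetric] by (simp_all add: of_real_Re)
    then have AB: "Re (A (of_real x)) = ?a * ?s" "Re (B (of_real x)) = ?b * ?s"
      by (metis Re_complex_of_real of_real_mult)+
    have "D (of_real x) 0 = A (of_real x) - B (of_real x)" "D (of_real x) (pi / X) = A (of_real x) + B (of_real x)"
      using D[OF xS, of 0] D[OF xS, of "pi / X"] unfolding exp_pi by simp_all
    then have R: "Re (D (of_real x) 0) = (?a - ?b) * ?s" "Re (D (of_real x) (pi / X)) = (?a + ?b) * ?s"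
      by (simp_all only: minus_complex.sel plus_complex.sel AB left_diff_distrib distrib_right)
    have "?a - ?b > 0" "?a + ?b > 0" using L[OF x(1)] by linarith+
    then show ?thesis using \<eta>_sign[OF x(2)] unfolding R
      by (simp only: mult.assoc mult_pos_pos)
  qed
  have ev: "\<forall>\<^sub>F x in at_top. x > L \<and> x \<ge> 0"
    by (intro eventually_conj eventually_gt_at_top eventually_ge_at_top)
  show "\<forall>\<^sub>F x in at_top. Re (D (of_real x) 0) * Re (\<eta> 0) > 0"
    using ev by (rule eventually_mono) (use * in blast)
  show "\<forall>\<^sub>F x in at_top. Re (D (of_real x) (pi / X)) * Re (\<eta> 0) > 0"
    using ev by (rule eventually_mono) (use * in blast)
qed

lemma near_zero_sign:
  assumes hol: "f holomorphic_on S" and "f 0 \<in> \<real>" "f 0 \<noteq> 0"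
  shows "\<forall>\<^sub>F x in at_right 0. Re (f (of_real x)) * Re (f 0) > 0"
proof -
  have "isCont f (of_real 0)"
    using holomorphic_on_imp_continuous_on[OF hol] S(1) zero_in_S continuous_on_eq_continuous_at by auto
  then have "((\<lambda>x. f (of_real x)) \<longlongrightarrow> f (of_real 0)) (at_right 0)"
    by (rule isCont_tendsto_compose) (auto intro!: tendsto_eq_intros)
  then have "((\<lambda>x. Re (f (of_real x)) * Re (f 0)) \<longlongrightarrow> Re (f 0) * Re (f 0)) (at_right 0)"
    by (intro tendsto_intros) simp
  moreover have "Re (f 0) * Re (f 0) > 0"
    using assms(2,3) by (auto simp: complex_is_Real_iff complex_eq_iff zero_less_mult_iff)
  ultimately show ?thesis by (rule order_tendstoD(1))
qed

lemma parity_0: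
  "finite (positive_real_roots (\<lambda>l. D l 0))"
  "even (num_positive_real_roots (\<lambda>l. D l 0)) \<longleftrightarrow> Re (\<eta> 0) * Re (alpha0 D) > 0"
proof -
  have hold: "(\<lambda>l. D l 0) holomorphic_on S"
    by (rule holomorphic_transform[of "\<lambda>l. l * Gh l"]) (auto intro!: holomorphic_intros hol_hat simp: D_0)
  have "\<forall>\<^sub>F x in at_right 0. Re (div0 Gh (of_real x)) * Re (div0 Gh 0) > 0"
    using alpha0_real nondegenerate
    by (intro near_zero_sign div0_holomorphic hol_hat S Gh_0) (simp_all add: alpha0_eq)
  moreover have "\<forall>\<^sub>F x in at_right (0::real). x > 0" by (simp add: eventually_at_right_less)
  ultimately have small: "\<forall>\<^sub>F x in at_right 0. Re (D (of_real x) 0) * Re (alpha0 D) > 0"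
  proof eventually_elim
    case (elim x)
    have "D (of_real x) 0 = of_real (x * x) * div0 Gh (of_real x)"
      using D_0[of "of_real x"] S(3)[of x] elim div0_eq[of Gh "of_real x", OF Gh_0] by simp
    then have "Re (D (of_real x) 0) * Re (alpha0 D) = (x * x) * (Re (div0 Gh (of_real x)) * Re (div0 Gh 0))"
      by (simp add: alpha0_eq)
    also have "\<dots> > 0" by (rule mult_pos_pos) (use elim in simp_all)
    finally show ?case .
  qed
  from positive_real_roots_parity[OF hold S _ small D_large(1)] D_real S(3)
  show "finite (positive_real_roots (\<lambda>l. D l 0))"
    "even (num_positive_real_roots (\<lambda>l. D l 0)) \<longleftrightarrow> Re (\<eta> 0) * Re (alpha0 D) > 0" by blast+
qed

lemma alpha1_Bh: "Re (alpha1 D / \<i>) = - X * Re (Bh 0)"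
  by (simp add: alpha1_eq)

lemma parity_pi:
  assumes "alpha1 D \<noteq> 0"
  shows "finite (positive_real_roots (\<lambda>l. D l (pi / X)))"
    "even (num_positive_real_roots (\<lambda>l. D l (pi / X))) \<longleftrightarrow> Re (\<eta> 0) * Re (alpha1 D / \<i>) < 0"
proof -
  have Bh0: "Bh 0 \<noteq> 0" using assms unfolding alpha1_eq by auto
  have AB0: "Ah 0 + Bh 0 = 2 * Bh 0" using Gh_0 by (simp add: Gh_def)
  have hold: "(\<lambda>l. D l (pi / X)) holomorphic_on S"
    by (rule holomorphic_transform[of "\<lambda>l. l * (Ah l + Bh l)"]) (auto intro!: holomorphic_intros hol_hat simp: D_pi)
  have "\<forall>\<^sub>F x in at_right 0. Re (Ah (of_real x) + Bh (of_real x)) * Re (Ah 0 + Bh 0) > 0"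
    using Bh0 Bh0_real
    by (intro near_zero_sign[of "\<lambda>l. Ah l + Bh l"] holomorphic_intros hol_hat) (simp_all add: AB0)
  moreover have "\<forall>\<^sub>F x in at_right (0::real). x > 0" by (simp add: eventually_at_right_less)
  ultimately have small: "\<forall>\<^sub>F x in at_right 0. Re (D (of_real x) (pi / X)) * Re (Bh 0) > 0"
  proof eventually_elim
    case (elim x)
    have "D (of_real x) (pi / X) = of_real x * (Ah (of_real x) + Bh (of_real x))"
      using D_pi[of "of_real x"] S(3)[of x] elim by simp
    then have "Re (D (of_real x) (pi / X)) * Re (Bh 0) = (x / 2) * (Re (Ah (of_real x) + Bh (of_real x)) * Re (Ah 0 + Bh 0))"
      unfolding AB0 by simp
    also have "\<dots> > 0" by (rule mult_pos_pos) (use elim in simp_all)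
    finally show ?case .
  qed
  have eq: "Re (\<eta> 0) * Re (Bh 0) > 0 \<longleftrightarrow> Re (\<eta> 0) * Re (alpha1 D / \<i>) < 0"
    unfolding alpha1_Bh using X by (simp add: zero_less_mult_iff mult_less_0_iff)
  from positive_real_roots_parity[OF hold S _ small D_large(2)] D_real S(3)
  show "finite (positive_real_roots (\<lambda>l. D l (pi / X)))"
    "even (num_positive_real_roots (\<lambda>l. D l (pi / X))) \<longleftrightarrow> Re (\<eta> 0) * Re (alpha1 D / \<i>) < 0"
    unfolding eq[symmetric] by blast+
qed

lemma unstable:
  assumes "Re (alpha1 D / (\<i> * alpha0 D)) > 0"
  shows "\<not> spectrally_stable X D"
proof
  assume stable: "spectrally_stable X D"
  have mem: "0 \<in> {- pi / X..pi / X}" "pi / X \<in> {- pi / X..pi / X}"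
    using X by (auto simp: divide_nonneg_pos divide_right_mono)
  then have "positive_real_roots (\<lambda>l. D l 0) = {}" "positive_real_roots (\<lambda>l. D l (pi / X)) = {}"
    using stable unfolding spectrally_stable_def positive_real_roots_def by auto
  then have none: "num_positive_real_roots (\<lambda>l. D l 0) = 0" "num_positive_real_roots (\<lambda>l. D l (pi / X)) = 0"
    unfolding num_positive_real_roots_def by simp_all
  define a0 a1 where "a0 = Re (alpha0 D)" and "a1 = Re (alpha1 D / \<i>)"
  have a: "alpha0 D = of_real a0" "alpha1 D / \<i> = of_real a1"
    unfolding a0_def a1_def by (simp_all only: of_real_Re[OF alpha0_real] of_real_Re[OF alpha1_real])
  have "alpha1 D / (\<i> * alpha0 D) = (alpha1 D / \<i>) / alpha0 D" by (simp only: divide_divide_eq_left)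
  also have "\<dots> = of_real (a1 / a0)" unfolding a by simp
  finally have pos: "a1 / a0 > 0" using assms by (metis Re_complex_of_real)
  then have "alpha1 D \<noteq> 0" unfolding a1_def by auto
  from parity_pi(2)[OF this] parity_0(2) none
  have "Re (\<eta> 0) * a0 > 0" "Re (\<eta> 0) * a1 < 0" unfolding a0_def a1_def by simp_all
  then show False using pos by (auto simp: zero_less_mult_iff mult_less_0_iff zero_less_divide_iff)
qed

lemma critical_curve_degenerate:
  assumes "Bh 0 = 0" shows "critical_curve_expansion D 0"
proof -
  have d: "div0 Gh holomorphic_on S" "div0 Bh holomorphic_on S"
    by (intro div0_holomorphic hol_hat S Gh_0 assms)+
  define f where "f p = div0 Gh (fst p) - (exp (\<i> * of_real (snd p * X)) - 1) * div0 Bh (fst p)" for p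
  have cont: "isCont (div0 Gh) (fst (0 :: complex \<times> real))" "isCont (div0 Bh) (fst (0 :: complex \<times> real))"
    using d[THEN holomorphic_on_imp_continuous_on] S(1) zero_in_S continuous_on_eq_continuous_at by auto
  have "isCont f 0" unfolding f_def
    by (intro continuous_intros isCont_o2[where f = fst and g = "div0 Gh", OF _ cont(1)]
        isCont_o2[where f = fst and g = "div0 Bh", OF _ cont(2)])
  moreover have "f 0 \<noteq> 0" unfolding f_def using nondegenerate by (simp add: alpha0_eq)
  ultimately obtain r where r: "r > 0" "\<And>p. dist 0 p < r \<Longrightarrow> f p \<noteq> 0"
    using continuous_at_avoid[of 0 f 0] by blast
  obtain s where s: "s > 0" "ball 0 s \<subseteq> S" using S(1) zero_in_S open_contains_ball by blast
  define \<epsilon> where "\<epsilon> = min s (r / 2)"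
  have \<epsilon>: "\<epsilon> > 0" "\<epsilon> \<le> s" "\<epsilon> \<le> r / 2" unfolding \<epsilon>_def using r(1) s(1) by auto
  have roots: "{l. norm l < \<epsilon> \<and> D l \<xi> = 0} = {0, 0}" if \<xi>: "\<xi> \<in> {-\<epsilon><..<\<epsilon>}" for \<xi>
  proof -
    have "D l \<xi> \<noteq> 0" if l: "norm l < \<epsilon>" "l \<noteq> 0" for l
    proof -
      have lS: "l \<in> S" using s(2) l \<epsilon> by auto
      have "dist 0 (l, \<xi>) \<le> norm l + \<bar>\<xi>\<bar>" using norm_Pair_le[of l \<xi>] by simp
      also have "\<dots> < r" using l \<xi> \<epsilon> by auto
      finally have "f (l, \<xi>) \<noteq> 0" by (rule r(2))
      moreover have "D l \<xi> = l * (l * f (l, \<xi>))"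
        using reduced_holomorphic(2)[OF lS, of \<xi>] reduced_D'[OF lS, of \<xi>]
          div0_eq[of Gh l, OF Gh_0] div0_eq[of Bh l, OF assms] by (simp add: f_def algebra_simps)
      ultimately show ?thesis using l(2) by simp
    qed
    moreover have "D 0 \<xi> = 0" using D[OF zero_in_S] zero by simp
    ultimately show ?thesis using \<epsilon>(1) by auto
  qed
  show ?thesis unfolding critical_curve_expansion_def
  proof (rule exI[of _ "\<lambda>_. 0"], rule exI[of _ "0::real"], rule exI[of _ \<epsilon>], rule conjI[OF \<epsilon>(1)],
      rule exI[of _ \<epsilon>], rule conjI[OF \<epsilon>(1)], rule exI[of _ "0::real"], intro conjI ballI)
    show "real_analytic_on (\<lambda>_. 0) {-\<epsilon><..<\<epsilon>}"
      unfolding real_analytic_on_def by (intro ballI exI[of _ 1] conjI exI[of _ "\<lambda>_. 0"]) auto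
  qed (use roots in \<open>auto intro!: exI[of _ 0]\<close>)
qed

lemma critical_curve_regular:
  assumes nz: "Bh 0 \<noteq> 0" shows "critical_curve_expansion D (Re (alpha1 D / (\<i> * alpha0 D)))"
proof -
  define \<alpha> where "\<alpha> = Re (alpha1 D / (\<i> * alpha0 D))"
  have \<alpha>: "complex_of_real \<alpha> = - of_real X * Bh 0 / deriv Gh 0"
    using alpha_eq unfolding \<alpha>_def by simp
  have G'nz: "deriv Gh 0 \<noteq> 0" using nondegenerate by (simp add: alpha0_eq)
  define T where "T = {l \<in> S. Bh l \<noteq> 0}"
  have T: "open T" "0 \<in> T" "T \<subseteq> S"
  proof -
    have "open (S \<inter> Bh -` (- {0}))"
      by (rule continuous_open_preimage[OF holomorphic_on_imp_continuous_on[OF hol_hat(2)] S(1)]) auto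
    moreover have "S \<inter> Bh -` (- {0}) = T" unfolding T_def by auto
    ultimately show "open T" by simp
  qed (use nz zero_in_S in \<open>auto simp: T_def\<close>)
  define \<psi> where "\<psi> l = Gh l / Bh l" for l
  have hol\<psi>: "\<psi> holomorphic_on T" unfolding \<psi>_def
    by (intro holomorphic_intros holomorphic_on_subset[OF hol_hat(3) T(3)] holomorphic_on_subset[OF hol_hat(2) T(3)])
      (auto simp: T_def)
  have \<psi>0: "\<psi> 0 = 0" unfolding \<psi>_def by (simp add: Gh_0)
  have \<psi>'0: "deriv \<psi> 0 = deriv Gh 0 / Bh 0"
  proof (rule DERIV_imp_deriv)
    have "((\<lambda>l. Gh l / Bh l) has_field_derivative (deriv Gh 0 * Bh 0 - Gh 0 * deriv Bh 0) / (Bh 0 * Bh 0)) (at 0)"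
      by (rule DERIV_divide[OF holomorphic_derivI[OF hol_hat(3) S(1) zero_in_S] holomorphic_derivI[OF hol_hat(2) S(1) zero_in_S] nz])
    then show "(\<psi> has_field_derivative deriv Gh 0 / Bh 0) (at 0)"
      unfolding \<psi>_def using nz by (simp add: Gh_0)
  qed
  have "deriv \<psi> 0 \<noteq> 0" unfolding \<psi>'0 using G'nz nz by simp
  then obtain r where r: "r > 0" "ball 0 r \<subseteq> T" "open (\<psi> ` ball 0 r)" "inj_on \<psi> (ball 0 r)"
    by (rule has_complex_derivative_locally_invertible[OF hol\<psi> T(2,1)]) (rule that)
  obtain \<phi> where \<phi>: "\<phi> holomorphic_on \<psi> ` ball 0 r" "\<And>z. z \<in> ball 0 r \<Longrightarrow> \<phi> (\<psi> z) = z"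
    using holomorphic_has_inverse[OF holomorphic_on_subset[OF hol\<psi> r(2)] open_ball r(4)] by metis
  define E where "E \<zeta> = exp (\<i> * (\<zeta> * complex_of_real X)) - 1" for \<zeta>
  have holE: "E holomorphic_on UNIV" unfolding E_def by (intro holomorphic_intros)
  have "0 \<in> \<psi> ` ball 0 r" using \<psi>0 r(1) by force
  moreover have E0: "E 0 = 0" by (simp add: E_def)
  ultimately have "0 \<in> E -` \<psi> ` ball 0 r" by simp
  moreover have "open (E -` \<psi> ` ball 0 r)"
    by (rule open_vimage[OF r(3) holomorphic_on_imp_continuous_on[OF holE]])
  ultimately obtain \<delta> where \<delta>: "\<delta> > 0" "ball 0 \<delta> \<subseteq> E -` \<psi> ` ball 0 r"
    using open_contains_ball by blast
  define \<Lambda> where "\<Lambda> \<zeta> = \<phi> (E \<zeta>)" for \<zeta>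
  have hol\<Lambda>: "\<Lambda> holomorphic_on ball 0 \<delta>" unfolding \<Lambda>_def
    by (rule holomorphic_on_compose_gen[OF holomorphic_on_subset[OF holE] \<phi>(1), unfolded o_def]) (use \<delta>(2) in blast)+
  have \<Lambda>_in: "\<Lambda> \<zeta> \<in> ball 0 r" and \<psi>\<Lambda>: "\<psi> (\<Lambda> \<zeta>) = E \<zeta>" if "\<zeta> \<in> ball 0 \<delta>" for \<zeta>
    using subsetD[OF \<delta>(2) that] \<phi>(2) unfolding \<Lambda>_def by auto
  have \<Lambda>0: "\<Lambda> 0 = 0" unfolding \<Lambda>_def using \<phi>(2)[of 0] \<psi>0 r(1) by (simp add: E0)
  have roots: "{l. norm l < r \<and> D l \<xi> = 0} = {0, \<Lambda> (of_real \<xi>)}" if \<xi>: "\<xi> \<in> {-\<delta><..<\<delta>}" for \<xi>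
  proof -
    have \<xi>': "complex_of_real \<xi> \<in> ball 0 \<delta>" using \<xi> by auto
    have "D l \<xi> = 0 \<longleftrightarrow> l = 0 \<or> l = \<Lambda> (of_real \<xi>)" if l: "l \<in> ball 0 r" for l
    proof -
      have lT: "l \<in> S" "Bh l \<noteq> 0" using l r(2) unfolding T_def by auto
      have "D l \<xi> = l * (Gh l - E (of_real \<xi>) * Bh l)"
        using reduced_holomorphic(2)[OF lT(1), of \<xi>] reduced_D'[OF lT(1), of \<xi>] by (simp add: E_def)
      then have "D l \<xi> = 0 \<longleftrightarrow> l = 0 \<or> \<psi> l = E (of_real \<xi>)"
        using lT(2) unfolding \<psi>_def by (auto simp: field_simps)
      also have "\<psi> l = E (of_real \<xi>) \<longleftrightarrow> l = \<Lambda> (of_real \<xi>)"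
        using \<psi>\<Lambda>[OF \<xi>'] \<Lambda>_in[OF \<xi>'] inj_onD[OF r(4) _ l] by metis
      finally show ?thesis .
    qed
    then show ?thesis using \<Lambda>_in[OF \<xi>'] r(1) by auto
  qed
  define P where "P = div0 \<Lambda>"
  define q where "q = div0 \<psi>"
  define E1 where "E1 = div0 E"
  have holP: "P holomorphic_on ball 0 \<delta>" unfolding P_def by (rule div0_holomorphic[OF hol\<Lambda> open_ball \<Lambda>0])
  have holq: "q holomorphic_on T" unfolding q_def by (rule div0_holomorphic[OF hol\<psi> T(1) \<psi>0])
  have holE1: "E1 holomorphic_on UNIV" unfolding E1_def by (rule div0_holomorphic[OF holE open_UNIV E0])
  have \<Lambda>P: "\<Lambda> \<zeta> = \<zeta> * P \<zeta>" for \<zeta> unfolding P_def by (rule div0_eq[of \<Lambda>, OF \<Lambda>0])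
  have 0: "0 \<in> ball (0::complex) \<delta>" using \<delta>(1) by simp
  have dE: "(E has_field_derivative \<i> * of_real X * exp (\<i> * (z * of_real X))) (at z)" for z
    unfolding E_def by (auto intro!: derivative_eq_intros)
  have E'0: "deriv E 0 = \<i> * of_real X" using DERIV_imp_deriv[OF dE[of 0]] by simp
  have "deriv E = (\<lambda>z. \<i> * of_real X * exp (\<i> * (z * of_real X)))" using DERIV_imp_deriv[OF dE] by auto
  moreover have "((\<lambda>z. \<i> * of_real X * exp (\<i> * (z * of_real X))) has_field_derivative (\<i> * of_real X)\<^sup>2) (at 0)"
    by (auto intro!: derivative_eq_intros simp: power2_eq_square mult_ac)
  ultimately have "(deriv ^^ 2) E 0 = (\<i> * of_real X)\<^sup>2"
    using DERIV_imp_deriv by (simp add: funpow_Suc_right numeral_2_eq_2)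
  moreover have "(deriv ^^ 2) E 0 = 2 * deriv E1 0"
    by (rule second_deriv_times_id[OF holE1 open_UNIV]) (auto simp: E1_def intro: div0_eq E0)
  ultimately have "deriv E1 0 = (\<i> * of_real X)\<^sup>2 / 2"
    by (metis nonzero_mult_div_cancel_left zero_neq_numeral)
  then have E1': "deriv E1 0 = - (of_real X)\<^sup>2 / 2" by (simp add: power_mult_distrib)
  have \<Lambda>T: "\<Lambda> \<zeta> \<in> T" if "\<zeta> \<in> ball 0 \<delta>" for \<zeta> using \<Lambda>_in[OF that] r(2) by blast
  have dP: "(P has_field_derivative deriv P 0) (at 0)" by (rule holomorphic_derivI[OF holP open_ball 0])
  have d\<Lambda>: "(\<Lambda> has_field_derivative P 0) (at 0)"
    using holomorphic_derivI[OF hol\<Lambda> open_ball 0] by (simp add: P_def)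
  have qP: "q (\<Lambda> \<zeta>) * P \<zeta> = E1 \<zeta>" if \<zeta>: "\<zeta> \<in> ball 0 \<delta>" for \<zeta>
  proof (cases "\<zeta> = 0")
    case True
    have "((\<lambda>\<zeta>. \<psi> (\<Lambda> \<zeta>)) has_field_derivative deriv \<psi> 0 * P 0) (at 0)"
      using DERIV_chain2[OF _ d\<Lambda>, of \<psi> "deriv \<psi> 0"] holomorphic_derivI[OF hol\<psi> T(1,2)] \<Lambda>0 by simp
    then have "(E has_field_derivative deriv \<psi> 0 * P 0) (at 0)"
      by (rule has_field_derivative_transform_within_open[OF _ open_ball 0]) (simp add: \<psi>\<Lambda>)
    then have "deriv E 0 = deriv \<psi> 0 * P 0" by (rule DERIV_imp_deriv)
    then show ?thesis using True \<Lambda>0 by (simp add: q_def E1_def)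
  next
    case False
    have "\<zeta> * (q (\<Lambda> \<zeta>) * P \<zeta>) = \<Lambda> \<zeta> * q (\<Lambda> \<zeta>)" unfolding \<Lambda>P[of \<zeta>] by simp
    also have "\<dots> = \<psi> (\<Lambda> \<zeta>)" unfolding q_def by (rule div0_eq[of \<psi>, OF \<psi>0, symmetric])
    also have "\<dots> = \<zeta> * E1 \<zeta>" unfolding \<psi>\<Lambda>[OF \<zeta>] E1_def by (rule div0_eq[of E, OF E0])
    finally show ?thesis using False by simp
  qed
  have P0: "P 0 = - \<i> * of_real \<alpha>"
  proof -
    have "deriv \<psi> 0 * P 0 = \<i> * of_real X" using qP[OF 0] \<Lambda>0 E'0 by (simp add: q_def E1_def)
    then show ?thesis unfolding \<psi>'0 \<alpha> using nz G'nz by (simp add: field_simps)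
  qed
  have \<alpha>_nz: "\<alpha> \<noteq> 0" using \<alpha> X nz G'nz by auto
  have P0_nz: "P 0 \<noteq> 0" unfolding P0 using \<alpha>_nz by simp
  have "((\<lambda>\<zeta>. q (\<Lambda> \<zeta>) * P \<zeta>) has_field_derivative deriv q 0 * P 0 * P 0 + deriv P 0 * q (\<Lambda> 0)) (at 0)"
    using DERIV_mult[OF DERIV_chain2[OF _ d\<Lambda>, of q "deriv q 0"] dP] holomorphic_derivI[OF holq T(1,2)] \<Lambda>0 by simp
  then have "(E1 has_field_derivative deriv q 0 * P 0 * P 0 + deriv P 0 * q (\<Lambda> 0)) (at 0)"
    by (rule has_field_derivative_transform_within_open[OF _ open_ball 0]) (simp add: qP)
  then have "deriv q 0 * P 0 * P 0 + deriv P 0 * q 0 = - (of_real X)\<^sup>2 / 2"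
    using DERIV_imp_deriv E1' \<Lambda>0 by metis
  then have P1: "deriv P 0 = (- (of_real X)\<^sup>2 / 2 + deriv q 0 * (of_real \<alpha>)\<^sup>2) / deriv \<psi> 0"
    using \<open>deriv \<psi> 0 \<noteq> 0\<close> unfolding P0 by (simp add: q_def field_simps power2_eq_square)
  have \<psi>_real: "\<psi> (of_real x) \<in> \<real>" if "complex_of_real x \<in> T" for x
    unfolding \<psi>_def using hat_real[of x] that T(3) by auto
  have "deriv q 0 \<in> \<real>" "deriv \<psi> 0 \<in> \<real>"
    using deriv_real[OF holq T(1), of 0] deriv_real[OF hol\<psi> T(1), of 0] \<psi>_real
      div0_real[OF hol\<psi> T(1,2)] T(2) unfolding q_def by auto
  then have P1_real: "deriv P 0 \<in> \<real>" unfolding P1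
    by (intro Reals_divide Reals_add Reals_mult Reals_minus Reals_power Reals_of_real) auto
  define \<gamma> where "\<gamma> = - Re (deriv P 0) / \<alpha>"
  have \<gamma>: "deriv P 0 / P 0 = - \<i> * of_real \<gamma>"
  proof -
    have "deriv P 0 = of_real (Re (deriv P 0))" using P1_real by (simp add: of_real_Re)
    then show ?thesis unfolding P0 \<gamma>_def using \<alpha>_nz by (simp add: field_simps)
  qed
  obtain C d where C: "C > 0" "d > 0" "ball 0 d \<subseteq> ball (0::complex) \<delta>"
      "\<And>z. norm z < d \<Longrightarrow> norm (P z - P 0 - deriv P 0 * z) \<le> C * (norm z)\<^sup>2"
    by (rule holomorphic_second_order_at_0[OF holP open_ball 0]) (rule that)
  have dd: "d \<le> \<delta>" using C(2,3) by (simp add: ball_subset_ball_iff)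
  show ?thesis unfolding critical_curve_expansion_def \<alpha>_def[symmetric]
  proof (rule exI[of _ "\<lambda>\<xi>. \<Lambda> (of_real \<xi>)"], rule exI[of _ \<gamma>], rule exI[of _ d], rule conjI[OF C(2)],
      rule exI[of _ r], rule conjI[OF r(1)], rule exI[of _ "C / norm (P 0)"], intro conjI ballI)
    show "real_analytic_on (\<lambda>\<xi>. \<Lambda> (of_real \<xi>)) {-d<..<d}"
      by (rule holomorphic_imp_real_analytic[OF holomorphic_on_subset[OF hol\<Lambda> C(3)]])
    fix \<xi> assume \<xi>: "\<xi> \<in> {-d<..<d}"
    show "{l. norm l < r \<and> D l \<xi> = 0} = {0, \<Lambda> (of_real \<xi>)}"
      by (rule roots) (use \<xi> dd in auto)
    show "\<exists>\<rho>. norm \<rho> \<le> C / norm (P 0) * \<xi>\<^sup>2 \<and> \<Lambda> (of_real \<xi>) =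
        - \<i> * of_real \<xi> * of_real \<alpha> * (1 - \<i> * of_real \<xi> * of_real \<gamma> + \<rho>)"
    proof (intro exI conjI)
      let ?\<rho> = "(P (of_real \<xi>) - P 0 - deriv P 0 * of_real \<xi>) / P 0"
      show "norm ?\<rho> \<le> C / norm (P 0) * \<xi>\<^sup>2"
      proof -
        have "\<bar>\<xi>\<bar> < d" using \<xi> by auto
        then have "norm (P (of_real \<xi>) - P 0 - deriv P 0 * of_real \<xi>) \<le> C * \<xi>\<^sup>2"
          using C(4)[of "of_real \<xi>"] by simp
        from divide_right_mono[OF this norm_ge_zero[of "P 0"]] show ?thesis by (simp add: norm_divide)
      qed
      have "P (of_real \<xi>) = P 0 * (1 + of_real \<xi> * (deriv P 0 / P 0) + ?\<rho>)"
        using P0_nz by (simp add: field_simps)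
      then have "\<Lambda> (of_real \<xi>) = of_real \<xi> * (P 0 * (1 + of_real \<xi> * (deriv P 0 / P 0) + ?\<rho>))"
        using \<Lambda>P[of "of_real \<xi>"] by simp
      also have "\<dots> = of_real \<xi> * (- \<i> * of_real \<alpha> * (1 + of_real \<xi> * (- \<i> * of_real \<gamma>) + ?\<rho>))"
        unfolding \<gamma> by (simp add: P0)
      finally show "\<Lambda> (of_real \<xi>) = - \<i> * of_real \<xi> * of_real \<alpha> * (1 - \<i> * of_real \<xi> * of_real \<gamma> + ?\<rho>)"
        by (simp add: algebra_simps)
    qed
  qed
qed

lemma critical_curve: "critical_curve_expansion D (Re (alpha1 D / (\<i> * alpha0 D)))"
  using critical_curve_degenerate critical_curve_regular alpha1_eq by (cases "Bh 0 = 0") auto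

end

section \<open>Linear systems with a sonic point\<close>

locale sonic_system =
  fixes X xs :: real and a \<beta> k k' e G g :: "real \<Rightarrow> real"
  assumes xs: "0 < xs" "xs < X"
    and cont: "continuous_on {0..X} a" "continuous_on {0..X} \<beta>" "continuous_on {0..X} k"
      "continuous_on {0..X} k'" "continuous_on {0..X} e" "continuous_on {0..X} G"
      "continuous_on {0..X} g"
    and a_neg: "\<And>x. 0 \<le> x \<Longrightarrow> x < xs \<Longrightarrow> a x < 0"
    and a_pos: "\<And>x. xs < x \<Longrightarrow> x \<le> X \<Longrightarrow> a x > 0"
    and a_xs: "a xs = 0" and \<beta>_xs: "\<beta> xs = 0" and e_xs: "e xs > 0"
    and k_pos: "\<And>x. x \<in> {0..X} \<Longrightarrow> k x > 0"
    and k_deriv: "\<And>x. x \<in> {0<..<X} \<Longrightarrow> (k has_real_derivative k' x) (at x)"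
    and hyperbolic: "\<And>x. x \<in> {0..xs} \<Longrightarrow> 0 < a x + (k x / 2)\<^sup>2"
    and g_pos: "\<And>x. x \<in> {0..X} \<Longrightarrow> g x > 0"
    and G_deriv: "\<And>x. x \<in> {0<..<X} \<Longrightarrow> (G has_real_derivative g x) (at x)"
    and g_deriv: "\<And>x. x \<in> {0<..<X} \<Longrightarrow>
      \<exists>g'. (g has_real_derivative g') (at x) \<and> a x * g' = \<beta> x * g x"
begin

definition sol :: "complex \<Rightarrow> (real \<Rightarrow> complex) \<Rightarrow> (real \<Rightarrow> complex) \<Rightarrow> bool" where
  "sol l u h \<longleftrightarrow> (\<forall>x\<in>{0<..<X}. (u has_vector_derivative - l * h x) (at x) \<and>
     (\<exists>h'. (h has_vector_derivative h') (at x) \<and>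
        of_real (a x) * h' = (of_real (\<beta> x) - l * of_real (k x)) * h x - (of_real (e x) + l) * u x))"

definition rsol :: "real \<Rightarrow> (real \<Rightarrow> real) \<Rightarrow> (real \<Rightarrow> real) \<Rightarrow> bool" where
  "rsol l u h \<longleftrightarrow> (\<forall>x\<in>{0<..<X}. (u has_real_derivative - l * h x) (at x) \<and>
     (\<exists>h'. (h has_real_derivative h') (at x) \<and>
        a x * h' = (\<beta> x - l * k x) * h x - (e x + l) * u x))"

lemma xs_in: "xs \<in> {0<..<X}" using xs by auto

lemma sol_sonic:
  assumes "sol l u h" shows "l * of_real (k xs) * h xs = - (of_real (e xs) + l) * u xs"
proof -
  have "0 = (0 - l * of_real (k xs)) * h xs - (of_real (e xs) + l) * u xs"
    using assms xs_in unfolding sol_def by (auto dest!: bspec[OF _ xs_in] simp: a_xs \<beta>_xs)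
  then show ?thesis by (simp add: algebra_simps eq_neg_iff_add_eq_0)
qed

lemma rsol_sonic:
  assumes "rsol l u h" shows "l * k xs * h xs = - (e xs + l) * u xs"
proof -
  have "0 = (0 - l * k xs) * h xs - (e xs + l) * u xs"
    using assms xs_in unfolding rsol_def by (auto dest!: bspec[OF _ xs_in] simp: a_xs \<beta>_xs)
  then show ?thesis by (simp add: algebra_simps eq_neg_iff_add_eq_0)
qed

lemma sol_scale: 
  assumes "sol l u h" shows "sol l (\<lambda>x. c * u x) (\<lambda>x. c * h x)"
  unfolding sol_def
proof (intro ballI conjI)
  fix x assume "x \<in> {0<..<X}"
  with assms obtain h' where h': "(u has_vector_derivative - l * h x) (at x)"
    "(h has_vector_derivative h') (at x)"
    "of_real (a x) * h' = (of_real (\<beta> x) - l * of_real (k x)) * h x - (of_real (e x) + l) * u x"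
    unfolding sol_def by blast
  show "((\<lambda>x. c * u x) has_vector_derivative - l * (c * h x)) (at x)"
    using has_vector_derivative_mult_right[OF h'(1), of c] by (simp add: mult_ac)
  show "\<exists>h'. ((\<lambda>x. c * h x) has_vector_derivative h') (at x) \<and> complex_of_real (a x) * h' =
      (complex_of_real (\<beta> x) - l * complex_of_real (k x)) * (c * h x) - (complex_of_real (e x) + l) * (c * u x)"
  proof (intro exI[of _ "c * h'"] conjI)
    have "complex_of_real (a x) * (c * h') = c * (complex_of_real (a x) * h')" by simp
    then show "complex_of_real (a x) * (c * h') =
      (complex_of_real (\<beta> x) - l * complex_of_real (k x)) * (c * h x) - (complex_of_real (e x) + l) * (c * u x)"
      unfolding h'(3) by (simp add: algebra_simps)
  qed (rule has_vector_derivative_mult_right[OF h'(2)])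
qed

lemma rsol_Re:
  assumes "sol (of_real l) u h" shows "rsol l (\<lambda>x. Re (u x)) (\<lambda>x. Re (h x))"
  unfolding rsol_def
proof (intro ballI conjI)
  fix x assume "x \<in> {0<..<X}"
  with assms obtain h' where h': "(u has_vector_derivative - of_real l * h x) (at x)"
    "(h has_vector_derivative h') (at x)"
    "of_real (a x) * h' = (of_real (\<beta> x) - of_real l * of_real (k x)) * h x - (of_real (e x) + of_real l) * u x"
    unfolding sol_def by blast
  show "((\<lambda>x. Re (u x)) has_real_derivative - l * Re (h x)) (at x)"
    using has_derivative_Re[OF h'(1)[unfolded has_vector_derivative_def]]
    unfolding has_field_derivative_def by (rule has_derivative_eq_rhs) (simp add: fun_eq_iff mult_ac)
  show "\<exists>h'. ((\<lambda>x. Re (h x)) has_real_derivative h') (at x) \<and>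
      a x * h' = (\<beta> x - l * k x) * Re (h x) - (e x + l) * Re (u x)"
  proof (intro exI[of _ "Re h'"] conjI)
    show "((\<lambda>x. Re (h x)) has_real_derivative Re h') (at x)"
      using has_derivative_Re[OF h'(2)[unfolded has_vector_derivative_def]]
      unfolding has_field_derivative_def by (rule has_derivative_eq_rhs) (simp add: fun_eq_iff mult_ac)
    show "a x * Re h' = (\<beta> x - l * k x) * Re (h x) - (e x + l) * Re (u x)"
      using arg_cong[OF h'(3), of Re] by simp
  qed
qed

lemma rsol_Im:
  assumes "sol (of_real l) u h" shows "rsol l (\<lambda>x. Im (u x)) (\<lambda>x. Im (h x))"
proof -
  have "rsol l (\<lambda>x. Re (- \<i> * u x)) (\<lambda>x. Re (- \<i> * h x))"
    by (rule rsol_Re[OF sol_scale[OF assms]])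
  then show ?thesis by simp
qed

text \<open>At an extremum of \<open>h / g\<close> the term \<open>a h'\<close> has a favourable sign on both sides of the sonic
  point, so the singular equation bounds \<open>h\<close> algebraically.\<close>

lemma rsol_near_sonic_bound:
  assumes "L > 0"
  obtains t C where "t > 0" "C > 0" "{xs - t..xs + t} \<subseteq> {0<..<X}"
    "\<And>l u h x. 0 < l \<Longrightarrow> l \<le> L \<Longrightarrow> rsol l u h \<Longrightarrow> x \<in> {xs - t..xs + t} \<Longrightarrow> \<bar>h x\<bar> \<le> C * \<bar>h xs\<bar>"
proof -
  obtain ek where ek: "ek > 0" "\<And>x. x \<in> {0..X} \<Longrightarrow> \<bar>e x\<bar> \<le> ek"
    using continuous_on_Icc_bound[OF cont(5)] by blast
  obtain k1 where k1: "k1 > 0" "\<And>x. x \<in> {0..X} \<Longrightarrow> k1 \<le> k x"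
    using continuous_on_compact_pos_bound[OF cont(3) compact_Icc k_pos] by blast
  obtain g1 where g1: "g1 > 0" "\<And>x. x \<in> {0..X} \<Longrightarrow> g1 \<le> g x"
    using continuous_on_compact_pos_bound[OF cont(7) compact_Icc g_pos] by blast
  obtain g2 where g2: "g2 > 0" "\<And>x. x \<in> {0..X} \<Longrightarrow> \<bar>g x\<bar> \<le> g2"
    using continuous_on_Icc_bound[OF cont(7)] by blast
  define E where "E = ek + L"
  have E: "E > 0" unfolding E_def using ek(1) assms by simp
  define t where "t = Min {xs / 2, (X - xs) / 2, k1 * g1 / (2 * E * g2)}"
  have t: "t > 0" "t \<le> xs / 2" "t \<le> (X - xs) / 2" "t \<le> k1 * g1 / (2 * E * g2)"
  proof -
    show "t > 0" unfolding t_def using xs k1(1) g1(1) g2(1) E by simp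
  qed (unfold t_def, (rule Min_le; simp)+)
  have tE: "E * t * g2 \<le> k1 * g1 / 2"
    using mult_right_mono[OF t(4), of "E * g2"] E g2(1) by (simp add: field_simps)
  have sub: "{xs - t..xs + t} \<subseteq> {0<..<X}" using t xs by auto
  define C where "C = g2 * (2 * E * k xs / e xs / (k1 * g1))"
  have kxs: "k xs > 0" using k_pos xs_in by auto
  have C: "C > 0" unfolding C_def using g2 E kxs e_xs k1 g1 by simp
  have main: "\<bar>h x\<bar> \<le> C * \<bar>h xs\<bar>"
    if l: "0 < l" "l \<le> L" and sol: "rsol l u h" and x: "x \<in> {xs - t..xs + t}" for l u h x
  proof -
    define \<rho> where "\<rho> = (\<lambda>x. h x / g x)"
    have deriv_u: "(u has_real_derivative - l * h x) (at x)" if "x \<in> {xs - t..xs + t}" for x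
      using sol sub that unfolding rsol_def by blast
    have g_nz: "g x > 0" if "x \<in> {xs - t..xs + t}" for x
      using g_pos[of x] sub that by force
    have deriv: "\<exists>r. (\<rho> has_real_derivative r) (at x) \<and>
        a x * g x * r = - l * k x * h x - (e x + l) * u x" if x: "x \<in> {xs - t..xs + t}" for x
    proof -
      have x': "x \<in> {0<..<X}" using sub x by blast
      obtain h' where h': "(h has_real_derivative h') (at x)"
        "a x * h' = (\<beta> x - l * k x) * h x - (e x + l) * u x"
        using sol x' unfolding rsol_def by blast
      obtain g' where g': "(g has_real_derivative g') (at x)" "a x * g' = \<beta> x * g x"
        using g_deriv[OF x'] by blast
      have "(\<rho> has_real_derivative (h' * g x - h x * g') / (g x * g x)) (at x)"
        unfolding \<rho>_def by (rule DERIV_divide[OF h'(1) g'(1)]) (use g_nz[OF x] in simp)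
      moreover have "a x * g x * ((h' * g x - h x * g') / (g x * g x)) =
          (a x * h') - h x * (a x * g') / g x"
        using g_nz[OF x] by (simp add: field_simps)
      ultimately show ?thesis
        using g_nz[OF x] unfolding h'(2) g'(2) by (auto simp: algebra_simps)
    qed
    have "continuous_on {xs - t..xs + t} (\<lambda>x. \<bar>\<rho> x\<bar>)"
      by (intro continuous_on_rabs continuous_at_imp_continuous_on ballI)
        (use deriv DERIV_isCont in blast)
    moreover have "{xs - t..xs + t} \<noteq> {}" using t by auto
    ultimately obtain y where y: "y \<in> {xs - t..xs + t}"
      and max: "\<And>x. x \<in> {xs - t..xs + t} \<Longrightarrow> \<bar>\<rho> x\<bar> \<le> \<bar>\<rho> y\<bar>"
      using continuous_attains_sup[of "{xs - t..xs + t}" "\<lambda>x. \<bar>\<rho> x\<bar>"] by auto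
    obtain r where r: "(\<rho> has_real_derivative r) (at y)"
        "a y * g y * r = - l * k y * h y - (e y + l) * u y" using deriv[OF y] by blast
    have favourable: "a y * g y * r * sgn (\<rho> y) \<ge> 0"
    proof (cases "y = xs \<or> \<rho> y = 0")
      case True then show ?thesis by (auto simp: a_xs)
    next
      case False
      have gy: "g y > 0" using g_nz[OF y] .
      have abs_deriv: "((\<lambda>x. sgn (\<rho> y) * \<rho> x) has_real_derivative sgn (\<rho> y) * r) (at y)"
        by (rule DERIV_cmult[OF r(1)])
      have le: "sgn (\<rho> y) * \<rho> x \<le> sgn (\<rho> y) * \<rho> y" if "x \<in> {xs - t..xs + t}" for x
        using max[OF that] by (auto simp: sgn_if abs_if split: if_splits)
      show ?thesis
      proof (cases "y < xs")
        case True
        have "sgn (\<rho> y) * r \<le> 0"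
        proof (rule ccontr)
          assume "\<not> sgn (\<rho> y) * r \<le> 0"
          then obtain d where d: "d > 0" "\<forall>h>0. h < d \<longrightarrow> sgn (\<rho> y) * \<rho> y < sgn (\<rho> y) * \<rho> (y + h)"
            using DERIV_pos_inc_right[OF abs_deriv] by auto
          define s where "s = min (d / 2) (xs - y)"
          have "s > 0" "s < d" "y + s \<in> {xs - t..xs + t}"
            using d(1) True y t(1) unfolding s_def by (auto simp: min_def)
          then show False using d(2) le by force
        qed
        moreover have "a y < 0" using a_neg[of y] True sub y by force
        ultimately have "(a y * g y) * (sgn (\<rho> y) * r) \<ge> 0"
          using gy by (intro mult_nonpos_nonpos) (auto simp: mult_le_0_iff)
        then show ?thesis by (simp add: mult_ac)
      next
        case False
        then have gt: "y > xs" using \<open>\<not> (y = xs \<or> \<rho> y = 0)\<close> by auto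
        have "sgn (\<rho> y) * r \<ge> 0"
        proof (rule ccontr)
          assume "\<not> sgn (\<rho> y) * r \<ge> 0"
          then obtain d where d: "d > 0" "\<forall>h>0. h < d \<longrightarrow> sgn (\<rho> y) * \<rho> y < sgn (\<rho> y) * \<rho> (y - h)"
            using DERIV_neg_dec_left[OF abs_deriv] by auto
          define s where "s = min (d / 2) (y - xs)"
          have "s > 0" "s < d" "y - s \<in> {xs - t..xs + t}"
            using d(1) gt y t(1) unfolding s_def by (auto simp: min_def)
          then show False using d(2) le by force
        qed
        moreover have "a y > 0" using a_pos[of y] gt subsetD[OF sub y] by auto
        ultimately have "(a y * g y) * (sgn (\<rho> y) * r) \<ge> 0"
          using gy by (metis mult_nonneg_nonneg less_imp_le)
        then show ?thesis by (simp add: mult_ac)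
      qed
    qed
    define R where "R = \<bar>\<rho> y\<bar>"
    have h_le: "\<bar>h x\<bar> \<le> g2 * R" if "x \<in> {xs - t..xs + t}" for x
    proof -
      have "\<bar>h x\<bar> = \<bar>g x\<bar> * \<bar>\<rho> x\<bar>" using g_nz[OF that] unfolding \<rho>_def by (simp add: abs_mult[symmetric])
      also have "\<dots> \<le> g2 * R" using g2 max[OF that] sub that unfolding R_def
        by (intro mult_mono) force+
      finally show ?thesis .
    qed
    have xs_I: "xs \<in> {xs - t..xs + t}" using t(1) by auto
    have "\<bar>u y - u xs\<bar> \<le> (l * (g2 * R)) * \<bar>y - xs\<bar>"
    proof -
      have "norm (u y - u xs) \<le> (l * (g2 * R)) * norm (y - xs)"
      proof (rule field_differentiable_bound[OF convex_real_interval(5)])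
        show "(u has_real_derivative - l * h z) (at z within {xs - t..xs + t})"
          if "z \<in> {xs - t..xs + t}" for z
          using deriv_u[OF that] by (rule has_field_derivative_at_within)
        show "norm (- l * h z) \<le> l * (g2 * R)" if "z \<in> {xs - t..xs + t}" for z
          using h_le[OF that] l by (auto simp: abs_mult)
      qed (use y xs_I in auto)
      then show ?thesis by simp
    qed
    also have "\<dots> \<le> (l * (g2 * R)) * t"
      using y l g2 unfolding R_def by (intro mult_left_mono) auto
    finally have u_diff: "\<bar>u y\<bar> \<le> \<bar>u xs\<bar> + l * (g2 * R) * t" by linarith
    have "l * k xs * \<bar>h xs\<bar> = (e xs + l) * \<bar>u xs\<bar>"
      using arg_cong[OF rsol_sonic[OF sol], of abs] l e_xs kxs by (simp add: abs_mult)
    moreover have "e xs * \<bar>u xs\<bar> \<le> (e xs + l) * \<bar>u xs\<bar>" using l by (intro mult_right_mono) auto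
    ultimately have u_xs: "\<bar>u xs\<bar> \<le> l * k xs * \<bar>h xs\<bar> / e xs"
      using e_xs by (simp add: field_simps)
    have y': "y \<in> {0..X}" using y sub by force
    have "l * (k y * g y * R) \<le> (\<bar>e y\<bar> + l) * \<bar>u y\<bar>"
    proof -
      have "h y = g y * \<rho> y" using g_nz[OF y] unfolding \<rho>_def by simp
      then have "h y * sgn (\<rho> y) = g y * R" unfolding R_def abs_sgn by (simp only: mult.assoc)
      moreover have "0 \<le> - l * k y * (h y * sgn (\<rho> y)) - (e y + l) * (u y * sgn (\<rho> y))"
        using favourable unfolding r(2) by (simp add: algebra_simps)
      ultimately have "0 \<le> - l * k y * (g y * R) - (e y + l) * (u y * sgn (\<rho> y))" by simp
      moreover have "- ((e y + l) * (u y * sgn (\<rho> y))) \<le> \<bar>(e y + l) * (u y * sgn (\<rho> y))\<bar>" by linarith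
      moreover have "\<bar>(e y + l) * (u y * sgn (\<rho> y))\<bar> \<le> (\<bar>e y\<bar> + l) * \<bar>u y\<bar>"
        unfolding abs_mult using l by (intro mult_mono) (auto simp: sgn_if)
      ultimately show ?thesis by (simp add: algebra_simps)
    qed
    also have "\<dots> \<le> E * (l * k xs * \<bar>h xs\<bar> / e xs + l * (g2 * R) * t)"
      using ek(2)[OF y'] l u_diff u_xs E unfolding E_def by (intro mult_mono) auto
    finally have "l * (k y * g y * R) \<le> l * (E * (k xs * \<bar>h xs\<bar> / e xs) + E * t * g2 * R)"
      by (simp add: algebra_simps)
    then have "k y * g y * R \<le> E * (k xs * \<bar>h xs\<bar> / e xs) + E * t * g2 * R"
      using l(1) by simp
    moreover have "k1 * g1 * R \<le> k y * g y * R"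
    proof (rule mult_right_mono)
      show "k1 * g1 \<le> k y * g y"
        using k1(1) g1(1) k1(2)[OF y'] g1(2)[OF y'] by (intro mult_mono) auto
    qed (simp add: R_def)
    moreover have "E * t * g2 * R \<le> k1 * g1 * R / 2"
      using mult_right_mono[OF tE, of R] unfolding R_def by simp
    ultimately have "k1 * g1 * R \<le> 2 * (E * (k xs * \<bar>h xs\<bar> / e xs))" by linarith
    then have "R \<le> 2 * (E * (k xs * \<bar>h xs\<bar> / e xs)) / (k1 * g1)"
      using k1(1) g1(1) by (subst pos_le_divide_eq) (auto simp: mult_ac)
    then have "R \<le> 2 * E * k xs / e xs / (k1 * g1) * \<bar>h xs\<bar>" by (simp add: mult_ac)
    then have "g2 * R \<le> g2 * (2 * E * k xs / e xs / (k1 * g1) * \<bar>h xs\<bar>)"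
      using g2(1) by (intro mult_left_mono) auto
    then show ?thesis using h_le[OF x] unfolding C_def by (simp add: mult_ac)
  qed
  show ?thesis using that[OF t(1) C sub main] .
qed

definition regular_bound ::
  "real \<Rightarrow> real \<Rightarrow> complex \<Rightarrow> (real \<Rightarrow> complex) \<Rightarrow> (real \<Rightarrow> complex) \<Rightarrow> bool" where
  "regular_bound t K l u h \<longleftrightarrow> (\<exists>z'. \<forall>x. x \<in> {0<..<X} \<longrightarrow> t \<le> \<bar>x - xs\<bar> \<longrightarrow>
     ((\<lambda>x. (u x, h x)) has_vector_derivative z' x) (at x) \<and>
     norm (z' x) \<le> K * (1 + norm l) * norm (u x, h x))"

lemma sol_regular_bound:
  assumes "t > 0"
  obtains K where "K > 0"
    "\<And>l u h. sol l u h \<Longrightarrow> regular_bound t K l u h"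
proof -
  obtain ek where ek: "ek > 0" "\<And>x. x \<in> {0..X} \<Longrightarrow> \<bar>e x\<bar> \<le> ek"
    using continuous_on_Icc_bound[OF cont(5)] by blast
  obtain bk where bk: "bk > 0" "\<And>x. x \<in> {0..X} \<Longrightarrow> \<bar>\<beta> x\<bar> \<le> bk"
    using continuous_on_Icc_bound[OF cont(2)] by blast
  obtain kk where kk: "kk > 0" "\<And>x. x \<in> {0..X} \<Longrightarrow> \<bar>k x\<bar> \<le> kk"
    using continuous_on_Icc_bound[OF cont(3)] by blast
  let ?S = "{0..X} \<inter> {x. t \<le> \<bar>x - xs\<bar>}"
  have "compact ?S"
    by (intro compact_Int_closed closed_Collect_le) (auto intro!: continuous_intros)
  moreover have "continuous_on ?S (\<lambda>x. \<bar>a x\<bar>)"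
    by (intro continuous_on_rabs continuous_on_subset[OF cont(1)]) auto
  moreover have "\<bar>a x\<bar> > 0" if "x \<in> ?S" for x
    using that a_neg[of x] a_pos[of x] assms by (cases "x < xs"; cases "x = xs") auto
  ultimately obtain m where m: "m > 0" "\<And>x. x \<in> ?S \<Longrightarrow> m \<le> \<bar>a x\<bar>"
    using continuous_on_compact_pos_bound[of ?S "\<lambda>x. \<bar>a x\<bar>"] by blast
  define c where "c = bk + kk + ek + 1"
  have c: "c > 0" "bk + kk * norm l \<le> c * (1 + norm l)" "ek + norm l \<le> c * (1 + norm l)" for l :: complex
  proof -
    show "c > 0" unfolding c_def using ek bk kk by simp
    show "bk + kk * norm l \<le> c * (1 + norm l)" "ek + norm l \<le> c * (1 + norm l)"
      unfolding c_def using ek(1) bk(1) kk(1) by (simp_all add: algebra_simps)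
  qed
  define K where "K = 1 + 2 * c / m"
  have "K > 0" unfolding K_def using c(1) m(1) by (simp add: add_pos_pos)
  have pointwise: "\<exists>z'. ((\<lambda>x. (u x, h x)) has_vector_derivative z') (at x) \<and>
        norm z' \<le> K * (1 + norm l) * norm (u x, h x)"
    if sol: "sol l u h" and x: "x \<in> {0<..<X}" "t \<le> \<bar>x - xs\<bar>" for l u h x
  proof -
    obtain h' where h': "(u has_vector_derivative - l * h x) (at x)"
      "(h has_vector_derivative h') (at x)"
      "of_real (a x) * h' = (of_real (\<beta> x) - l * of_real (k x)) * h x - (of_real (e x) + l) * u x"
      using sol x unfolding sol_def by blast
    define n where "n = norm (u x, h x)"
    have n: "norm (u x) \<le> n" "norm (h x) \<le> n" "n \<ge> 0"
      unfolding n_def using norm_fst_le[of "u x" "h x"] norm_snd_le[of "h x" "u x"] by auto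
    have x': "x \<in> {0..X}" "x \<in> ?S" using x by auto
    have "m * norm h' \<le> \<bar>a x\<bar> * norm h'" using m(2)[OF x'(2)] by (intro mult_right_mono) auto
    also have "\<dots> = norm ((of_real (\<beta> x) - l * of_real (k x)) * h x - (of_real (e x) + l) * u x)"
      unfolding h'(3)[symmetric] by (simp add: norm_mult)
    also have "\<dots> \<le> norm (of_real (\<beta> x) - l * of_real (k x)) * norm (h x)
        + norm (of_real (e x) + l) * norm (u x)"
      by (metis norm_mult norm_triangle_ineq4)
    also have "\<dots> \<le> (c * (1 + norm l)) * n + (c * (1 + norm l)) * n"
    proof (intro add_mono mult_mono)
      have "norm (of_real (\<beta> x) - l * of_real (k x)) \<le> \<bar>\<beta> x\<bar> + norm l * \<bar>k x\<bar>"
        by (metis norm_mult norm_of_real norm_triangle_ineq4)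
      also have "\<dots> \<le> bk + kk * norm l"
        using bk(2)[OF x'(1)] mult_right_mono[OF kk(2)[OF x'(1)], of "norm l"] by (simp add: mult.commute)
      finally show "norm (of_real (\<beta> x) - l * of_real (k x)) \<le> c * (1 + norm l)" using c(2)[of l] by linarith
      have "norm (of_real (e x) + l) \<le> \<bar>e x\<bar> + norm l"
        by (metis norm_of_real norm_triangle_ineq)
      then show "norm (of_real (e x) + l) \<le> c * (1 + norm l)" using ek(2)[OF x'(1)] c(3)[of l] by linarith
    qed (use n c(1) in auto)
    finally have "norm h' \<le> 2 * c / m * (1 + norm l) * n" using m(1) by (simp add: field_simps)
    moreover have "norm (- l * h x) \<le> (1 + norm l) * n"
      using n by (auto simp: norm_mult intro!: mult_mono)
    moreover have "norm (- l * h x, h') \<le> norm (- l * h x) + norm h'" by (rule norm_Pair_le)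
    ultimately have "norm (- l * h x, h') \<le> K * (1 + norm l) * n"
      unfolding K_def by (simp add: algebra_simps)
    then show ?thesis unfolding n_def
      using has_vector_derivative_Pair[OF h'(1,2)] by blast
  qed
  have "regular_bound t K l u h" if "sol l u h" for l u h
    unfolding regular_bound_def using pointwise[OF that] by (intro choice) blast
  then show ?thesis by (rule that[OF \<open>K > 0\<close>])
qed

lemma sol_unique_zero:
  assumes sol: "sol (of_real l) u h" and "l > 0" "h xs = 0" and x: "x \<in> {0<..<X}"
  shows "u x = 0 \<and> h x = 0"
proof -
  obtain t C where t: "t > 0" "C > 0" "{xs - t..xs + t} \<subseteq> {0<..<X}"
    and bnd: "\<And>l' u h x. 0 < l' \<Longrightarrow> l' \<le> l \<Longrightarrow> rsol l' u h \<Longrightarrow> x \<in> {xs - t..xs + t} \<Longrightarrow> \<bar>h x\<bar> \<le> C * \<bar>h xs\<bar>"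
    by (rule rsol_near_sonic_bound[OF \<open>l > 0\<close>]) (rule that)
  have h0: "h x = 0" if "x \<in> {xs - t..xs + t}" for x
    using bnd[OF \<open>l > 0\<close> order_refl rsol_Re[OF sol] that] bnd[OF \<open>l > 0\<close> order_refl rsol_Im[OF sol] that]
      \<open>h xs = 0\<close> by (simp add: complex_eq_iff)
  have "(of_real (e xs) + of_real l :: complex) \<noteq> 0"
    using e_xs \<open>l > 0\<close> by (metis add_pos_pos of_real_add of_real_eq_0_iff less_irrefl)
  then have uxs: "u xs = 0" using sol_sonic[OF sol] \<open>h xs = 0\<close> by auto
  have u0: "u x = 0" if "x \<in> {xs - t..xs + t}" for x
  proof -
    have "u x = u xs"
    proof (rule has_derivative_zero_unique[OF convex_real_interval(5)])
      show "(u has_derivative (\<lambda>h. 0)) (at y within {xs - t..xs + t})" if "y \<in> {xs - t..xs + t}" for y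
      proof -
        have "(u has_vector_derivative - of_real l * h y) (at y)"
          using sol t(3) that unfolding sol_def by blast
        then show ?thesis using h0[OF that] unfolding has_vector_derivative_def
          by (auto intro: has_derivative_at_withinI)
      qed
    qed (use that t(1) in auto)
    then show ?thesis using uxs by simp
  qed
  show ?thesis
  proof (cases "x \<in> {xs - t..xs + t}")
    case True then show ?thesis using h0 u0 by auto
  next
    case False
    obtain K where K: "K > 0" "\<And>l u h. sol l u h \<Longrightarrow> regular_bound t K l u h"
      by (rule sol_regular_bound[OF t(1)]) (rule that)
    obtain z' where z': "\<forall>x. x \<in> {0<..<X} \<longrightarrow> t \<le> \<bar>x - xs\<bar> \<longrightarrow>
        ((\<lambda>x. (u x, h x)) has_vector_derivative z' x) (at x) \<and>
        norm (z' x) \<le> K * (1 + l) * norm (u x, h x)"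
      using K(2)[OF sol] \<open>l > 0\<close> unfolding regular_bound_def by auto
    have "norm (u x, h x) = 0"
    proof (cases "x < xs")
      case True
      then have "x \<le> xs - t" using False t(1) by auto
      from norm_gronwall(2)[OF this, of "\<lambda>x. (u x, h x)" z' "K * (1 + l)"]
      show ?thesis using z' x xs t h0[of "xs - t"] u0[of "xs - t"] by (auto simp: zero_prod_def[symmetric])
    next
      case False
      then have "xs + t \<le> x" using \<open>x \<notin> {xs - t..xs + t}\<close> t(1) by auto
      from norm_gronwall(1)[OF this, of "\<lambda>x. (u x, h x)" z' "K * (1 + l)"]
      show ?thesis using z' x xs t h0[of "xs + t"] u0[of "xs + t"] by (auto simp: zero_prod_def[symmetric])
    qed
    then show ?thesis by (simp add: zero_prod_def)
  qed
qed

end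

context sonic_system
begin

lemma sol_of_rsol:
  assumes "rsol l u h" shows "sol (of_real l) (\<lambda>x. of_real (u x)) (\<lambda>x. of_real (h x))"
  unfolding sol_def
proof (intro ballI conjI)
  fix x assume "x \<in> {0<..<X}"
  with assms obtain h' where h': "(u has_real_derivative - l * h x) (at x)"
    "(h has_real_derivative h') (at x)"
    "a x * h' = (\<beta> x - l * k x) * h x - (e x + l) * u x"
    unfolding rsol_def by blast
  show "((\<lambda>x. complex_of_real (u x)) has_vector_derivative - of_real l * of_real (h x)) (at x)"
    using has_vector_derivative_of_real[OF h'(1)] by simp
  show "\<exists>h'. ((\<lambda>x. complex_of_real (h x)) has_vector_derivative h') (at x) \<and> of_real (a x) * h' =
      (of_real (\<beta> x) - of_real l * of_real (k x)) * of_real (h x) - (of_real (e x) + of_real l) * of_real (u x)"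
    using has_vector_derivative_of_real[OF h'(2)] arg_cong[OF h'(3), of complex_of_real] by auto
qed

lemma rsol_ratio:
  assumes sol: "sol (of_real l) u h" and "l > 0" "h xs \<noteq> 0" and x: "x \<in> {0<..<X}"
  shows "u x / h xs \<in> \<real>" "h x / h xs \<in> \<real>"
proof -
  have "sol (of_real l) (\<lambda>x. of_real (Im (inverse (h xs) * u x))) (\<lambda>x. of_real (Im (inverse (h xs) * h x)))"
    by (rule sol_of_rsol[OF rsol_Im[OF sol_scale[OF sol]]])
  moreover have "complex_of_real (Im (inverse (h xs) * h xs)) = 0"
    using left_inverse[OF assms(3)] by (metis one_complex.sel(2) of_real_0)
  ultimately have "complex_of_real (Im (inverse (h xs) * u x)) = 0 \<and>
      complex_of_real (Im (inverse (h xs) * h x)) = 0"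
    using sol_unique_zero[OF _ \<open>l > 0\<close> _ x] by blast
  then have "Im (inverse (h xs) * u x) = 0" "Im (inverse (h xs) * h x) = 0"
    by (simp_all only: of_real_eq_0_iff)
  then show "u x / h xs \<in> \<real>" "h x / h xs \<in> \<real>"
    by (simp_all add: complex_is_Real_iff divide_inverse mult.commute)
qed

definition end_rate :: "real \<Rightarrow> real \<Rightarrow> complex \<Rightarrow> real" where
  "end_rate K r l = K * (1 + norm l) * exp (K * (1 + norm l) * r)"

lemma sol_limits:
  obtains s t K where "0 < s" "s < xs" "xs < t" "t < X" "K > 0"
    "\<And>l u h. sol l u h \<Longrightarrow> \<exists>L. ((\<lambda>x. (u x, h x)) \<longlongrightarrow> L) (at_left X) \<and>
       (\<forall>x. t \<le> x \<longrightarrow> x < X \<longrightarrow> norm ((u x, h x) - L) \<le> end_rate K (X - t) l * norm (u t, h t) * (X - x))"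
    "\<And>l u h. sol l u h \<Longrightarrow> \<exists>L. ((\<lambda>x. (u x, h x)) \<longlongrightarrow> L) (at_right 0) \<and>
       (\<forall>x. 0 < x \<longrightarrow> x \<le> s \<longrightarrow> norm ((u x, h x) - L) \<le> end_rate K s l * norm (u s, h s) * x)"
proof -
  define d where "d = min (xs / 2) ((X - xs) / 2)"
  have d: "d > 0" "d \<le> xs / 2" "d \<le> (X - xs) / 2" unfolding d_def using xs by (auto simp: min_def)
  obtain K where K: "K > 0" "\<And>l u h. sol l u h \<Longrightarrow> regular_bound d K l u h"
    by (rule sol_regular_bound[OF d(1)]) (rule that)
  show ?thesis
  proof (rule that[of "xs - d" "xs + d" K])
    show "0 < xs - d" "xs - d < xs" "xs < xs + d" "xs + d < X" "K > 0" using d xs K(1) by auto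
    fix l u h assume sol: "sol l u h"
    obtain z' where z': "\<forall>x. x \<in> {0<..<X} \<longrightarrow> d \<le> \<bar>x - xs\<bar> \<longrightarrow>
        ((\<lambda>x. (u x, h x)) has_vector_derivative z' x) (at x) \<and>
        norm (z' x) \<le> K * (1 + norm l) * norm (u x, h x)"
      using K(2)[OF sol] unfolding regular_bound_def by blast
    have K': "K * (1 + norm l) \<ge> 0" using K(1) by simp
    obtain L where "((\<lambda>x. (u x, h x)) \<longlongrightarrow> L) (at_left X)"
      "\<And>x. xs + d \<le> x \<Longrightarrow> x < X \<Longrightarrow> norm ((u x, h x) - L)
        \<le> end_rate K (X - (xs + d)) l * norm (u (xs + d), h (xs + d)) * (X - x)"
      unfolding end_rate_def
      by (rule gronwall_limit_left[of "xs + d" X "K * (1 + norm l)" "\<lambda>x. (u x, h x)" z'])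
        (use z' K' d xs in auto)
    then show "\<exists>L. ((\<lambda>x. (u x, h x)) \<longlongrightarrow> L) (at_left X) \<and>
       (\<forall>x. xs + d \<le> x \<longrightarrow> x < X \<longrightarrow> norm ((u x, h x) - L)
          \<le> end_rate K (X - (xs + d)) l * norm (u (xs + d), h (xs + d)) * (X - x))" by blast
    obtain L where "((\<lambda>x. (u x, h x)) \<longlongrightarrow> L) (at_right 0)"
      "\<And>x. 0 < x \<Longrightarrow> x \<le> xs - d \<Longrightarrow> norm ((u x, h x) - L)
        \<le> end_rate K (xs - d) l * norm (u (xs - d), h (xs - d)) * x"
      unfolding end_rate_def
      by (rule gronwall_limit_right[of 0 "xs - d" "K * (1 + norm l)" "\<lambda>x. (u x, h x)" z', simplified])
        (use z' K' d xs in auto)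
    then show "\<exists>L. ((\<lambda>x. (u x, h x)) \<longlongrightarrow> L) (at_right 0) \<and>
       (\<forall>x. 0 < x \<longrightarrow> x \<le> xs - d \<longrightarrow> norm ((u x, h x) - L)
          \<le> end_rate K (xs - d) l * norm (u (xs - d), h (xs - d)) * x)" by blast
  qed
qed

abbreviation "J \<equiv> G X - G 0"
abbreviation "M \<equiv> a X * g X - a 0 * g 0"

lemma J_pos: "J > 0"
proof -
  have "G 0 < G X"
    by (rule DERIV_pos_imp_increasing_open) (use xs G_deriv g_pos cont(6) in fastforce)+
  then show ?thesis by simp
qed

lemma rsol_right_growth:
  assumes sol: "rsol l u h" and l: "l > 0" and le: "\<And>y. xs \<le> y \<Longrightarrow> y \<le> x \<Longrightarrow> c * - u y \<le> h y"
    and x: "xs \<le> x" "x < X"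
  shows "- u xs * exp (l * c * (x - xs)) \<le> - u x"
proof -
  have "- u xs * exp (- l * c * xs) \<le> - u x * exp (- l * c * x)"
  proof (rule DERIV_nonneg_imp_nondecreasing[OF x(1)])
    fix y assume y: "xs \<le> y" "y \<le> x"
    then have "(u has_real_derivative - l * h y) (at y)" using sol x xs unfolding rsol_def by auto
    then have "((\<lambda>y. - u y * exp (- l * c * y)) has_real_derivative
        l * (h y - c * - u y) * exp (- l * c * y)) (at y)"
      by (auto intro!: derivative_eq_intros simp: algebra_simps)
    moreover have "l * (h y - c * - u y) * exp (- l * c * y) \<ge> 0" using le[OF y] l by simp
    ultimately show "\<exists>r. ((\<lambda>y. - u y * exp (- l * c * y)) has_real_derivative r) (at y) \<and> 0 \<le> r" by blast
  qed
  then have "- u xs * exp (- l * c * xs) * exp (l * c * x) \<le> - u x * exp (- l * c * x) * exp (l * c * x)"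
    by (rule mult_right_mono) simp
  then show ?thesis by (simp add: mult.assoc algebra_simps flip: exp_add)
qed

text \<open>The formal exponential rate \<open>\<mu>\<close> of the regular mode solves \<open>a \<mu>\<^sup>2 + k \<mu> = 1\<close> (where \<open>h = - \<mu> u\<close>,
  \<open>u \<approx> exp (l \<integral> \<mu>)\<close>). A constant below \<open>\<mu>\<close> is a barrier on the right of the sonic point, and
  \<open>2 / k\<close>, which lies between the two roots where \<open>a < 0\<close>, is a barrier on the left.\<close>

lemma rsol_right_barrier:
  obtains c L where "c > 0" "L > 0"
    "\<And>l u h x. l > L \<Longrightarrow> rsol l u h \<Longrightarrow> h xs = 1 \<Longrightarrow> xs \<le> x \<Longrightarrow> x < X \<Longrightarrow> c * - u x < h x"
proof -
  obtain ek where ek: "ek > 0" "\<And>x. x \<in> {0..X} \<Longrightarrow> \<bar>e x\<bar> \<le> ek"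
    using continuous_on_Icc_bound[OF cont(5)] by blast
  obtain bk where bk: "bk > 0" "\<And>x. x \<in> {0..X} \<Longrightarrow> \<bar>\<beta> x\<bar> \<le> bk"
    using continuous_on_Icc_bound[OF cont(2)] by blast
  obtain kk where kk: "kk > 0" "\<And>x. x \<in> {0..X} \<Longrightarrow> \<bar>k x\<bar> \<le> kk"
    using continuous_on_Icc_bound[OF cont(3)] by blast
  obtain ak where ak: "ak > 0" "\<And>x. x \<in> {0..X} \<Longrightarrow> \<bar>a x\<bar> \<le> ak"
    using continuous_on_Icc_bound[OF cont(1)] by blast
  define c where "c = 1 / (4 * (kk + ak + 1))"
  have c: "c > 0" "c \<le> 1" "c * kk \<le> 1 / 4" "c * ak \<le> 1 / 4"
    unfolding c_def using kk(1) ak(1) by (auto simp: field_simps)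
  define L where "L = 2 * (bk + ek)"
  have L: "L > 0" unfolding L_def using bk(1) ek(1) by simp
  have main: "c * - u x < h x"
    if l: "l > L" and sol: "rsol l u h" and h1: "h xs = 1" and x: "xs \<le> x" "x < X" for l u h x
  proof (rule ccontr)
    assume neg: "\<not> c * - u x < h x"
    have l0: "l > 0" using l L by simp
    have du: "(u has_real_derivative - l * h y) (at y)" if "y \<in> {0<..<X}" for y
      using sol that unfolding rsol_def by blast
    have k_xs: "k xs > 0" "k xs \<le> kk" using k_pos[of xs] kk(2)[of xs] xs by auto
    have p_xs: "- u xs = l * k xs / (e xs + l)"
      using rsol_sonic[OF sol] h1 e_xs l0 by (simp add: field_simps)
    have "l * k xs / (e xs + l) \<le> k xs"
      using e_xs l0 k_xs by (simp add: field_simps)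
    then have "c * - u xs \<le> c * kk" unfolding p_xs using c(1) k_xs by (intro mult_left_mono) auto
    then have start: "h xs - c * - u xs > 0" using h1 c(3) by simp
    have p_xs_pos: "- u xs > 0" unfolding p_xs using e_xs l0 k_xs by simp
    have contf: "continuous_on {xs..x} (\<lambda>y. h y - c * - u y)"
    proof (intro continuous_at_imp_continuous_on ballI)
      fix y assume y: "y \<in> {xs..x}"
      then have "isCont u y" "isCont h y"
        using sol x xs unfolding rsol_def by (force dest: DERIV_isCont)+
      then show "isCont (\<lambda>y. h y - c * - u y) y" by (intro continuous_intros)
    qed
    obtain z where z: "xs < z" "z \<le> x" "h z - c * - u z = 0"
        "\<And>y. xs \<le> y \<Longrightarrow> y < z \<Longrightarrow> h y - c * - u y > 0"
      by (rule continuous_on_first_zero[OF contf start, of x]) (use neg x in auto)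
    have "- u xs * exp (l * c * (z - xs)) \<le> - u z"
    proof (rule rsol_right_growth[OF sol l0])
      show "c * - u y \<le> h y" if "xs \<le> y" "y \<le> z" for y
        using z(3) z(4)[of y] that by (cases "y = z") auto
    qed (use z x in auto)
    moreover have "- u xs * exp (l * c * (z - xs)) > 0" using p_xs_pos by (rule mult_pos_pos) simp
    ultimately have p: "- u z > 0" by linarith
    have z': "z \<in> {0<..<X}" "z \<in> {0..X}" using z x xs by auto
    obtain h' where h': "(h has_real_derivative h') (at z)"
        "a z * h' = (\<beta> z - l * k z) * h z - (e z + l) * u z"
      using sol z'(1) unfolding rsol_def by blast
    have az: "a z > 0" "a z \<le> ak" using a_pos[of z] ak(2)[OF z'(2)] z x by auto
    have df: "((\<lambda>y. h y - c * - u y) has_real_derivative h' - c * (l * h z)) (at z)"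
      using h'(1) du[OF z'(1)] by (auto intro!: derivative_eq_intros)
    have hz: "h z = c * - u z" using z(3) by simp
    have "a z * (h' - c * (l * h z)) = - u z * (l * (1 - c * k z - a z * c * c) + c * \<beta> z + e z)"
    proof -
      have "a z * (h' - c * (l * h z)) = a z * h' - a z * (c * (l * h z))" by (simp add: right_diff_distrib)
      then show ?thesis unfolding h'(2) hz by (simp add: algebra_simps)
    qed
    also have "\<dots> > 0"
    proof (rule mult_pos_pos[OF p])
      have "c * k z \<le> c * kk" using kk(2)[OF z'(2)] c(1) by (intro mult_left_mono) auto
      moreover have "a z * c * c \<le> ak * c * 1" using az c by (intro mult_mono) auto
      then have "a z * c * c \<le> c * ak" by (simp only: mult.commute mult_1_right)
      ultimately have "1 / 2 \<le> 1 - c * k z - a z * c * c" using c by linarith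
      then have "l * (1 / 2) \<le> l * (1 - c * k z - a z * c * c)" using l0 by (intro mult_left_mono) auto
      moreover have "\<bar>c * \<beta> z\<bar> \<le> 1 * bk" unfolding abs_mult using c bk(2)[OF z'(2)] by (intro mult_mono) auto
      moreover have "\<bar>e z\<bar> \<le> ek" using ek(2)[OF z'(2)] .
      moreover have "0 < T + y + w" if "l * (1 / 2) \<le> T" "\<bar>y\<bar> \<le> 1 * bk" "\<bar>w\<bar> \<le> ek" for T y w
      proof -
        have "- bk \<le> y" "- ek \<le> w" using that by (simp_all add: abs_le_iff)
        moreover have "bk + ek < T" using that(1) l unfolding L_def by simp
        ultimately show ?thesis by linarith
      qed
      ultimately show "0 < l * (1 - c * k z - a z * c * c) + c * \<beta> z + e z" by blast
    qed
    finally have "h' - c * (l * h z) > 0" using az by (simp add: zero_less_mult_iff)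
    then obtain d where d: "d > 0" "\<forall>s>0. s < d \<longrightarrow> h (z - s) - c * - u (z - s) < h z - c * - u z"
      using DERIV_pos_inc_left[OF df] by blast
    define s where "s = min (d / 2) (z - xs)"
    have "s > 0" "s < d" "xs \<le> z - s" "z - s < z" using d(1) z(1) unfolding s_def by auto
    then show False using d(2) z(3) z(4)[of "z - s"] by force
  qed
  show ?thesis by (rule that[OF c(1) L]) (rule main)
qed

lemma rsol_left_barrier:
  obtains L where "L > 0"
    "\<And>l u h x. l > L \<Longrightarrow> rsol l u h \<Longrightarrow> h xs = 1 \<Longrightarrow> 0 < x \<Longrightarrow> x \<le> xs \<Longrightarrow> 0 < h x \<and> h x < 2 / k x * - u x"
proof -
  obtain ek where ek: "ek > 0" "\<And>x. x \<in> {0..X} \<Longrightarrow> \<bar>e x\<bar> \<le> ek"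
    using continuous_on_Icc_bound[OF cont(5)] by blast
  obtain k1 where k1: "k1 > 0" "\<And>x. x \<in> {0..X} \<Longrightarrow> k1 \<le> k x"
    using continuous_on_compact_pos_bound[OF cont(3) compact_Icc k_pos] by blast
  have k_nz: "\<And>x. x \<in> {0..X} \<Longrightarrow> k x \<noteq> 0" using k_pos by force
  have sub: "{0..xs} \<subseteq> {0..X}" using xs by auto
  have "continuous_on {0..xs} (\<lambda>x. 4 * (a x + (k x / 2)\<^sup>2) / (k x)\<^sup>2)"
    using continuous_on_subset[OF cont(1) sub] continuous_on_subset[OF cont(3) sub] k_nz sub
    by (intro continuous_intros) auto
  moreover have "4 * (a x + (k x / 2)\<^sup>2) / (k x)\<^sup>2 > 0" if "x \<in> {0..xs}" for x
    using hyperbolic[OF that] k_nz[of x] that xs by auto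
  ultimately obtain \<delta> where \<delta>: "\<delta> > 0" "\<And>x. x \<in> {0..xs} \<Longrightarrow> \<delta> \<le> 4 * (a x + (k x / 2)\<^sup>2) / (k x)\<^sup>2"
    using continuous_on_compact_pos_bound[of "{0..xs}", OF _ compact_Icc] by blast
  have "continuous_on {0..X} (\<lambda>x. 2 * a x * k' x / (k x)\<^sup>2 + 2 * \<beta> x / k x + e x)"
    using cont k_nz by (intro continuous_intros) auto
  then obtain c where c: "c > 0" "\<And>x. x \<in> {0..X} \<Longrightarrow> \<bar>2 * a x * k' x / (k x)\<^sup>2 + 2 * \<beta> x / k x + e x\<bar> \<le> c"
    using continuous_on_Icc_bound by blast
  define L where "L = max (c / \<delta>) ek"
  have L: "L > 0" unfolding L_def using ek(1) by simp
  have main: "0 < h x \<and> h x < 2 / k x * - u x"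
    if l: "l > L" and sol: "rsol l u h" and h1: "h xs = 1" and x: "0 < x" "x \<le> xs" for l u h x
  proof (rule ccontr)
    define f where "f = (\<lambda>y. 2 / k y * - u y - h y)"
    assume "\<not> (0 < h x \<and> h x < 2 / k x * - u x)"
    then have neg: "min (h x) (f x) \<le> 0" unfolding f_def by auto
    have l0: "l > 0" "l > ek" "l * \<delta> > c"
    proof -
      show "l > 0" using l L by linarith
      show "l > ek" using l unfolding L_def by simp
      have "c / \<delta> < l" using l unfolding L_def by simp
      then show "l * \<delta> > c" using \<delta>(1) by (simp add: pos_divide_less_eq)
    qed
    have in_X: "y \<in> {0<..<X}" "y \<in> {0..X}" if "0 < y" "y \<le> xs" for y using that xs by auto
    have du: "(u has_real_derivative - l * h y) (at y)" if "y \<in> {0<..<X}" for y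
      using sol that unfolding rsol_def by blast
    have k_xs: "k xs > 0" using k_pos[of xs] xs by auto
    have p_xs: "- u xs = l * k xs / (e xs + l)"
      using rsol_sonic[OF sol] h1 e_xs l0 by (simp add: field_simps)
    have p_xs_pos: "- u xs > 0" unfolding p_xs using e_xs l0 k_xs by simp
    have "e xs < l" using ek(2)[of xs] xs l0 by auto
    then have "2 / k xs * - u xs > 1" unfolding p_xs using k_xs e_xs l0 by (simp add: field_simps)
    then have start: "min (h (xs - 0)) (f (xs - 0)) > 0" unfolding f_def using h1 by simp
    have contf: "continuous_on {0..xs - x} (\<lambda>s. min (h (xs - s)) (f (xs - s)))"
    proof (intro continuous_on_min)
      have "isCont u y" "isCont h y" "isCont k y" "k y \<noteq> 0" if "x \<le> y" "y \<le> xs" for y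
        using sol x xs that k_deriv[of y] k_nz[of y] unfolding rsol_def by (force dest: DERIV_isCont)+
      then have "continuous_on {x..xs} h" "continuous_on {x..xs} f"
        unfolding f_def by (auto intro!: continuous_at_imp_continuous_on continuous_intros)
      then show "continuous_on {0..xs - x} (\<lambda>s. h (xs - s))" "continuous_on {0..xs - x} (\<lambda>s. f (xs - s))"
        by (auto intro!: continuous_on_compose2[of "{x..xs}" _ _ "\<lambda>s. xs - s"] continuous_intros)
    qed
    obtain w where w: "0 < w" "w \<le> xs - x" "min (h (xs - w)) (f (xs - w)) = 0"
        "\<And>y. 0 \<le> y \<Longrightarrow> y < w \<Longrightarrow> min (h (xs - y)) (f (xs - y)) > 0"
      by (rule continuous_on_first_zero[OF contf start, of "xs - x"]) (use neg x in auto)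
    define z where "z = xs - w"
    have z: "x \<le> z" "z < xs" "z > 0" using w x unfolding z_def by auto
    have zmin: "h z \<ge> 0" "f z \<ge> 0" "h z = 0 \<or> f z = 0" using w(3) unfolding z_def by (auto simp: min_def split: if_splits)
    have above: "h y > 0" "f y > 0" if "z < y" "y \<le> xs" for y
      using w(4)[of "xs - y"] that unfolding z_def by auto
    note zX = in_X[OF z(3) less_imp_le[OF z(2)]]
    have "- u z * exp (- l * (2 / k1) * z) \<ge> - u xs * exp (- l * (2 / k1) * xs)"
    proof (rule DERIV_nonpos_imp_nonincreasing[OF less_imp_le[OF z(2)]])
      fix y assume y: "z \<le> y" "y \<le> xs"
      have yX: "y \<in> {0<..<X}" "y \<in> {0..X}" using in_X[of y] y z by auto
      have ge: "h y \<ge> 0" "h y \<le> 2 / k y * - u y"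
        using above[of y] zmin y unfolding f_def by (cases "y = z"; fastforce)+
      then have "- u y \<ge> 0" using k_pos[OF yX(2)] by (smt (verit) divide_pos_pos mult_less_0_iff)
      moreover have "2 / k y \<le> 2 / k1" using k1(1) k1(2)[OF yX(2)] by (simp add: frac_le)
      ultimately have "h y \<le> 2 / k1 * - u y" using ge(2) by (smt (verit) mult_right_mono)
      then have "l * (h y - 2 / k1 * - u y) \<le> 0" using l0 by (intro mult_nonneg_nonpos) auto
      then have "l * (h y - 2 / k1 * - u y) * exp (- l * (2 / k1) * y) \<le> 0"
        by (rule mult_nonpos_nonneg) simp
      moreover have "((\<lambda>y. - u y * exp (- l * (2 / k1) * y)) has_real_derivative
          l * (h y - 2 / k1 * - u y) * exp (- l * (2 / k1) * y)) (at y)"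
        using du[OF yX(1)] k1(1) by (auto intro!: derivative_eq_intros simp: algebra_simps)
      ultimately show "\<exists>r. ((\<lambda>y. - u y * exp (- l * (2 / k1) * y)) has_real_derivative r) (at y) \<and> r \<le> 0"
        by blast
    qed
    moreover have "- u xs * exp (- l * (2 / k1) * xs) > 0" using p_xs_pos by (rule mult_pos_pos) simp
    ultimately have "- u z * exp (- l * (2 / k1) * z) > 0" by linarith
    then have p: "- u z > 0" by (simp add: zero_less_mult_iff mult_less_0_iff)
    have az: "a z < 0" using a_neg[of z] z by auto
    obtain h' where h': "(h has_real_derivative h') (at z)"
        "a z * h' = (\<beta> z - l * k z) * h z - (e z + l) * u z"
      using sol zX(1) unfolding rsol_def by blast
    have no_desc: False if D: "(\<phi> has_real_derivative r) (at z)" "a z * r > 0" "\<phi> z = 0"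
      and pos: "\<And>y. z < y \<Longrightarrow> y \<le> xs \<Longrightarrow> \<phi> y > 0" for \<phi> r
    proof -
      have "r < 0" using D(2) az by (simp add: zero_less_mult_iff)
      then obtain d where d: "d > 0" "\<forall>s>0. s < d \<longrightarrow> \<phi> z > \<phi> (z + s)"
        using DERIV_neg_dec_right[OF D(1)] by blast
      define s where "s = min (d / 2) (xs - z)"
      have "s > 0" "s < d" "z < z + s" "z + s \<le> xs" using d(1) z unfolding s_def by auto
      then show False using d(2) D(3) pos[of "z + s"] by force
    qed
    from zmin(3) show False
    proof
      assume hz: "h z = 0"
      have "(e z + l) * - u z > 0" using p ek(2)[OF zX(2)] l0 by (intro mult_pos_pos) auto
      then have "a z * h' > 0" unfolding h'(2) hz by simp
      then show False by (rule no_desc[OF h'(1) _ hz above(1)])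
    next
      assume fz: "f z = 0"
      have kz: "k z > 0" using k_pos[OF zX(2)] .
      have hz: "h z = 2 / k z * - u z" using fz unfolding f_def by simp
      have df: "(f has_real_derivative (- 2 * k' z / (k z)\<^sup>2 * - u z + 2 / k z * (l * h z) - h')) (at z)"
        unfolding f_def using du[OF zX(1)] k_deriv[OF zX(1)] h'(1) kz
        by (auto intro!: derivative_eq_intros simp: field_simps power2_eq_square)
      have "a z * (- 2 * k' z / (k z)\<^sup>2 * - u z + 2 / k z * (l * h z) - h') =
          a z * (- 2 * k' z / (k z)\<^sup>2 * - u z + 2 / k z * (l * h z)) - a z * h'"
        by (simp add: algebra_simps)
      also have "\<dots> = - u z * (l * (4 * (a z + (k z / 2)\<^sup>2) / (k z)\<^sup>2)
          - (2 * a z * k' z / (k z)\<^sup>2 + 2 * \<beta> z / k z + e z))"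
        unfolding h'(2) hz using kz by (simp add: field_simps power2_eq_square)
      also have "\<dots> > 0"
      proof (rule mult_pos_pos[OF p])
        have "l * \<delta> \<le> l * (4 * (a z + (k z / 2)\<^sup>2) / (k z)\<^sup>2)"
          using \<delta>(2)[of z] z l0 by (intro mult_left_mono) auto
        then show "0 < l * (4 * (a z + (k z / 2)\<^sup>2) / (k z)\<^sup>2)
          - (2 * a z * k' z / (k z)\<^sup>2 + 2 * \<beta> z / k z + e z)"
          using c(2)[OF zX(2)] l0(3) by linarith
      qed
      finally show False by (rule no_desc[OF df _ fz above(2)])
    qed
  qed
  show ?thesis by (rule that[OF L]) (rule main)
qed

lemma rsol_dominant:
  obtains L where "L > 0"
    "\<And>l u h uR hR uL hL. l > L \<Longrightarrow> rsol l u h \<Longrightarrow> h xs = 1 \<Longrightarrow>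
       (u \<longlongrightarrow> uR) (at_left X) \<Longrightarrow> (h \<longlongrightarrow> hR) (at_left X) \<Longrightarrow>
       (u \<longlongrightarrow> uL) (at_right 0) \<Longrightarrow> (h \<longlongrightarrow> hL) (at_right 0) \<Longrightarrow>
       \<bar>l * J * (a 0 * hL - k 0 * uL) + M * uL\<bar> < l * J * (a X * hR - k X * uR) + M * uR"
proof -
  obtain c L1 where c: "c > 0" "L1 > 0"
    "\<And>l u h x. l > L1 \<Longrightarrow> rsol l u h \<Longrightarrow> h xs = 1 \<Longrightarrow> xs \<le> x \<Longrightarrow> x < X \<Longrightarrow> c * - u x < h x"
    by (rule rsol_right_barrier) (rule that)
  obtain L2 where L2: "L2 > 0"
    "\<And>l u h x. l > L2 \<Longrightarrow> rsol l u h \<Longrightarrow> h xs = 1 \<Longrightarrow> 0 < x \<Longrightarrow> x \<le> xs \<Longrightarrow> 0 < h x \<and> h x < 2 / k x * - u x"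
    by (rule rsol_left_barrier) (rule that)
  obtain k1 where k1: "k1 > 0" "\<And>x. x \<in> {0..X} \<Longrightarrow> k1 \<le> k x"
    using continuous_on_compact_pos_bound[OF cont(3) compact_Icc k_pos] by blast
  have kX: "k X > 0" "k 0 > 0" using k_pos xs by auto
  define c3 where "c3 = \<bar>a 0\<bar> * (2 / k1) + k 0 + k X / 2"
  have c3: "c3 > 0" unfolding c3_def using kX k1(1) by (simp add: add_nonneg_pos)
  define L where "L = max (max L1 L2) (max (2 * \<bar>M\<bar> / (J * k X)) (2 * c3 / (k X * c * (X - xs))))"
  have main: "\<bar>l * J * (a 0 * hL - k 0 * uL) + M * uL\<bar> < l * J * (a X * hR - k X * uR) + M * uR"
    if l: "l > L" and sol: "rsol l u h" and h1: "h xs = 1" and lim: "(u \<longlongrightarrow> uR) (at_left X)"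
      "(h \<longlongrightarrow> hR) (at_left X)" "(u \<longlongrightarrow> uL) (at_right 0)" "(h \<longlongrightarrow> hL) (at_right 0)" for l u h uR hR uL hL
  proof -
    have l0: "l > L1" "l > L2" "l > 0" using l c(2) unfolding L_def by auto
    have lM: "\<bar>M\<bar> \<le> l * J * k X / 2"
    proof -
      have "2 * \<bar>M\<bar> / (J * k X) \<le> l" using l unfolding L_def by auto
      then show ?thesis using J_pos kX by (simp add: pos_divide_le_eq algebra_simps)
    qed
    have lc: "2 * c3 / k X < l * c * (X - xs)"
    proof -
      have "2 * c3 / (k X * c * (X - xs)) < l" using l unfolding L_def by auto
      then have "2 * c3 < l * (k X * c * (X - xs))" using kX c(1) xs by (subst (asm) pos_divide_less_eq) auto
      then show ?thesis using kX by (subst pos_divide_less_eq) (auto simp: mult_ac)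
    qed
    have k_xs: "k xs > 0" using k_pos[of xs] xs by auto
    define P where "P = - u xs"
    have "P = l * k xs / (e xs + l)"
      unfolding P_def using rsol_sonic[OF sol] h1 e_xs l0 by (simp add: field_simps)
    then have P: "P > 0" using e_xs l0 k_xs by simp
    have right: "c * - u x < h x" if "xs \<le> x" "x < X" for x using c(3)[OF l0(1) sol h1 that] .
    have evX: "\<forall>\<^sub>F x in at_left X. x \<in> {xs<..<X}" using xs by (intro eventually_at_leftI) auto
    have ev0: "\<forall>\<^sub>F x in at_right 0. x \<in> {0<..<xs}" using xs by (intro eventually_at_rightI) auto
    have uR: "P * exp (l * c * (X - xs)) \<le> - uR"
    proof (rule tendsto_le[OF trivial_limit_at_left_real])
      show "((\<lambda>x. - u x) \<longlongrightarrow> - uR) (at_left X)" by (intro tendsto_intros lim)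
      show "((\<lambda>x. P * exp (l * c * (x - xs))) \<longlongrightarrow> P * exp (l * c * (X - xs))) (at_left X)"
        by (intro tendsto_intros)
      show "\<forall>\<^sub>F x in at_left X. P * exp (l * c * (x - xs)) \<le> - u x"
        using evX
      proof eventually_elim
        case (elim x)
        have "c * - u y \<le> h y" if "xs \<le> y" "y \<le> x" for y using right[of y] that elim by auto
        then show ?case unfolding P_def
          by (rule rsol_right_growth[OF sol l0(3)]) (use elim in auto)
      qed
    qed
    have "2 * c3 / k X < exp (l * c * (X - xs))" using lc exp_ge_add_one_self[of "l * c * (X - xs)"] by linarith
    then have "P * (2 * c3 / k X) < P * exp (l * c * (X - xs))" using P by (intro mult_strict_left_mono)
    then have uR': "P * (2 * c3 / k X) < - uR" using uR by linarith
    then have uR_pos: "- uR > 0" using P c3 kX by (smt (verit) divide_pos_pos mult_pos_pos)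
    have "hR \<ge> c * - uR"
    proof (rule tendsto_le[OF trivial_limit_at_left_real lim(2)])
      show "((\<lambda>x. c * - u x) \<longlongrightarrow> c * - uR) (at_left X)" by (intro tendsto_intros lim)
      show "\<forall>\<^sub>F x in at_left X. c * - u x \<le> h x"
        using evX
      proof eventually_elim
        case (elim x)
        then show ?case using right[of x] by simp
      qed
    qed
    then have hR: "hR \<ge> 0" using c(1) uR_pos by (smt (verit) mult_nonneg_nonneg)
    have aX: "a X > 0" using a_pos[of X] xs by auto
    have lJ: "l * J > 0" using l0 J_pos by simp
    have "l * J * k X / 2 * (P * (2 * c3 / k X)) < l * J * k X / 2 * - uR"
      using uR' lJ kX by (intro mult_strict_left_mono) auto
    also have "l * J * k X / 2 * - uR \<le> l * J * (k X * - uR) - \<bar>M\<bar> * - uR"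
    proof -
      have "l * J * (k X * - uR) = l * J * k X / 2 * - uR + l * J * k X / 2 * - uR" by simp
      then show ?thesis using mult_right_mono[OF lM, of "- uR"] uR_pos by linarith
    qed
    also have "\<dots> \<le> l * J * (a X * hR - k X * uR) + M * uR"
    proof -
      have "0 \<le> l * J * (a X * hR)" using lJ aX hR by simp
      moreover have "M * - uR \<le> \<bar>M\<bar> * - uR" using uR_pos by (intro mult_right_mono) auto
      ultimately show ?thesis by (simp add: algebra_simps)
    qed
    also have "l * J * k X / 2 * (P * (2 * c3 / k X)) = l * J * (c3 * P)"
      using kX(1) by (simp only: times_divide_eq_left times_divide_eq_right) simp
    finally have big: "l * J * (c3 * P) < l * J * (a X * hR - k X * uR) + M * uR" .
    have left: "0 < h x" "h x < 2 / k x * - u x" if "0 < x" "x \<le> xs" for x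
      using L2(2)[OF l0(2) sol h1 that] by auto
    have u_le: "- u x \<le> P" if "0 < x" "x \<le> xs" for x
      unfolding P_def
    proof (rule DERIV_nonneg_imp_nondecreasing[OF that(2)])
      fix y assume y: "x \<le> y" "y \<le> xs"
      then have "(u has_real_derivative - l * h y) (at y)" using sol xs that unfolding rsol_def by auto
      then have "((\<lambda>y. - u y) has_real_derivative l * h y) (at y)" by (auto intro!: derivative_eq_intros)
      moreover have "l * h y \<ge> 0" using left(1)[of y] y that l0 by simp
      ultimately show "\<exists>r. ((\<lambda>y. - u y) has_real_derivative r) (at y) \<and> 0 \<le> r" by blast
    qed
    have u_ge: "0 \<le> - u x" if "0 < x" "x \<le> xs" for x
    proof -
      have "k x > 0" using k_pos[of x] that xs by auto
      then show ?thesis using left[OF that] by (smt (verit) divide_pos_pos mult_less_0_iff)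
    qed
    have h_le: "h x \<le> 2 / k1 * P" if "0 < x" "x \<le> xs" for x
    proof -
      have "k1 \<le> k x" using k1(2)[of x] that xs by auto
      then have "2 / k x \<le> 2 / k1" using k1(1) by (simp add: frac_le)
      then have "2 / k x * - u x \<le> 2 / k1 * P"
        using u_ge[OF that] u_le[OF that] k1(1) by (intro mult_mono) auto
      then show ?thesis using left(2)[OF that] by linarith
    qed
    have "- uL \<le> P" "0 \<le> - uL" "hL \<le> 2 / k1 * P" "0 \<le> hL"
    proof -
      have negu: "((\<lambda>x. - u x) \<longlongrightarrow> - uL) (at_right 0)" by (intro tendsto_intros lim)
      show "- uL \<le> P" by (rule tendsto_upperbound[OF negu _ trivial_limit_at_right_real]) (use ev0 in \<open>eventually_elim, use u_le in auto\<close>)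
      show "0 \<le> - uL" by (rule tendsto_lowerbound[OF negu _ trivial_limit_at_right_real]) (use ev0 in \<open>eventually_elim, use u_ge in auto\<close>)
      show "hL \<le> 2 / k1 * P" by (rule tendsto_upperbound[OF lim(4) _ trivial_limit_at_right_real]) (use ev0 in \<open>eventually_elim, use h_le in auto\<close>)
      show "0 \<le> hL" by (rule tendsto_lowerbound[OF lim(4) _ trivial_limit_at_right_real]) (use ev0 in \<open>eventually_elim, use left in force\<close>)
    qed
    note L = this
    have "\<bar>l * J * (a 0 * hL - k 0 * uL) + M * uL\<bar> \<le> \<bar>l * J * (a 0 * hL - k 0 * uL)\<bar> + \<bar>M * uL\<bar>"
      by (rule abs_triangle_ineq)
    also have "\<dots> \<le> l * J * (\<bar>a 0\<bar> * (2 / k1 * P) + k 0 * P) + l * J * k X / 2 * P"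
    proof (rule add_mono)
      have "\<bar>a 0 * hL - k 0 * uL\<bar> \<le> \<bar>a 0\<bar> * \<bar>hL\<bar> + k 0 * \<bar>uL\<bar>"
        using kX by (metis abs_mult abs_of_pos abs_triangle_ineq4)
      also have "\<dots> \<le> \<bar>a 0\<bar> * (2 / k1 * P) + k 0 * P"
        using L kX by (intro add_mono mult_left_mono) auto
      finally have "l * J * \<bar>a 0 * hL - k 0 * uL\<bar> \<le> l * J * (\<bar>a 0\<bar> * (2 / k1 * P) + k 0 * P)"
        using lJ by (intro mult_left_mono) auto
      then show "\<bar>l * J * (a 0 * hL - k 0 * uL)\<bar> \<le> l * J * (\<bar>a 0\<bar> * (2 / k1 * P) + k 0 * P)"
        unfolding abs_mult[of "l * J"] abs_of_pos[OF lJ] .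
      show "\<bar>M * uL\<bar> \<le> l * J * k X / 2 * P"
        unfolding abs_mult using lM L lJ kX by (intro mult_mono) auto
    qed
    also have "\<dots> = l * J * (c3 * P)" unfolding c3_def by (simp add: field_simps)
    finally show ?thesis using big by linarith
  qed
  have "L > 0" unfolding L_def using c(2) by auto
  then show ?thesis using main by (rule that)
qed

end

section \<open>Analytic families of solutions\<close>

lemma holomorphic_on_seq_limit:
  assumes "open S" and hol: "\<And>n. f n holomorphic_on S" and cont: "continuous_on S B"
    and \<epsilon>: "\<epsilon> \<longlonglongrightarrow> (0::real)"
    and le: "\<And>n z. z \<in> S \<Longrightarrow> norm (f n z - F z) \<le> B z * \<epsilon> n"
  shows "F holomorphic_on S"
proof (rule holomorphic_uniform_sequence[OF \<open>open S\<close> hol])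
  fix x assume "x \<in> S"
  then obtain d where d: "d > 0" "cball x d \<subseteq> S" using \<open>open S\<close> open_contains_cball by blast
  have "bounded (B ` cball x d)"
    by (intro compact_imp_bounded compact_continuous_image continuous_on_subset[OF cont d(2)]) auto
  then obtain b where b: "b > 0" "\<And>z. z \<in> cball x d \<Longrightarrow> \<bar>B z\<bar> \<le> b" by (auto simp: bounded_pos)
  have "uniform_limit (cball x d) f F sequentially"
  proof (rule uniform_limitI)
    fix e :: real assume "e > 0"
    then have "e / b > 0" using b(1) by simp
    then have "\<forall>\<^sub>F n in sequentially. \<bar>\<epsilon> n\<bar> < e / b" using \<epsilon> by (auto simp: tendsto_iff dist_real_def)
    then show "\<forall>\<^sub>F n in sequentially. \<forall>z\<in>cball x d. dist (f n z) (F z) < e"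
    proof eventually_elim
      case (elim n)
      show ?case
      proof
        fix z assume z: "z \<in> cball x d"
        have "dist (f n z) (F z) \<le> B z * \<epsilon> n" using le[of z n] z d(2) by (auto simp: dist_norm)
        also have "\<dots> \<le> \<bar>B z\<bar> * \<bar>\<epsilon> n\<bar>" by (metis abs_ge_self abs_mult)
        also have "\<dots> \<le> b * \<bar>\<epsilon> n\<bar>" using b(2)[OF z] by (intro mult_right_mono) auto
        also have "\<dots> < e" using elim b(1) by (simp add: field_simps)
        finally show "dist (f n z) (F z) < e" .
      qed
    qed
  qed
  with d show "\<exists>d>0. cball x d \<subseteq> S \<and> uniform_limit (cball x d) f F sequentially" by blast
qed

locale sonic_family = sonic_system +
  fixes S :: "complex set" and u h :: "complex \<Rightarrow> real \<Rightarrow> complex"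
  assumes S: "open S" "connected S" "\<And>x. x \<ge> 0 \<Longrightarrow> complex_of_real x \<in> S"
    and sol: "\<And>l. l \<in> S \<Longrightarrow> sol l (u l) (h l)"
    and nonzero: "\<And>l. l \<in> S \<Longrightarrow> \<exists>x\<in>{0<..<X}. h l x \<noteq> 0 \<or> u l x \<noteq> 0"
    and hol: "\<And>x. x \<in> {0<..<X} \<Longrightarrow> (\<lambda>l. u l x) holomorphic_on S"
      "\<And>x. x \<in> {0<..<X} \<Longrightarrow> (\<lambda>l. h l x) holomorphic_on S"
begin

definition "uR l = Lim (at_left X) (u l)"
definition "hR l = Lim (at_left X) (h l)"
definition "uL l = Lim (at_right 0) (u l)"
definition "hL l = Lim (at_right 0) (h l)"

definition "detR l = l * of_real J * (of_real (a X) * hR l - of_real (k X) * uR l) + of_real M * uR l"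
definition "detL l = l * of_real J * (of_real (a 0) * hL l - of_real (k 0) * uL l) + of_real M * uL l"

lemma tendsto_ends:
  assumes "l \<in> S"
  shows "(u l \<longlongrightarrow> uR l) (at_left X)" "(h l \<longlongrightarrow> hR l) (at_left X)"
    "(u l \<longlongrightarrow> uL l) (at_right 0)" "(h l \<longlongrightarrow> hL l) (at_right 0)"
proof -
  obtain L where L: "((\<lambda>x. (u l x, h l x)) \<longlongrightarrow> L) (at_left X)"
    using sol_limits sol[OF assms] by metis
  show "(u l \<longlongrightarrow> uR l) (at_left X)" "(h l \<longlongrightarrow> hR l) (at_left X)"
    unfolding uR_def hR_def using tendsto_fst[OF L] tendsto_snd[OF L]
    by (simp_all add: tendsto_Lim[OF trivial_limit_at_left_real])
  obtain L where L: "((\<lambda>x. (u l x, h l x)) \<longlongrightarrow> L) (at_right 0)"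
    using sol_limits sol[OF assms] by metis
  show "(u l \<longlongrightarrow> uL l) (at_right 0)" "(h l \<longlongrightarrow> hL l) (at_right 0)"
    unfolding uL_def hL_def using tendsto_fst[OF L] tendsto_snd[OF L]
    by (simp_all add: tendsto_Lim[OF trivial_limit_at_right_real])
qed

lemma holomorphic_ends: "uR holomorphic_on S" "hR holomorphic_on S" "uL holomorphic_on S" "hL holomorphic_on S"
proof -
  obtain s t K where st: "0 < s" "s < xs" "xs < t" "t < X" "K > 0"
    and R: "\<And>l u h. sol l u h \<Longrightarrow> \<exists>L. ((\<lambda>x. (u x, h x)) \<longlongrightarrow> L) (at_left X) \<and>
       (\<forall>x. t \<le> x \<longrightarrow> x < X \<longrightarrow> norm ((u x, h x) - L) \<le> end_rate K (X - t) l * norm (u t, h t) * (X - x))"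
    and L: "\<And>l u h. sol l u h \<Longrightarrow> \<exists>L. ((\<lambda>x. (u x, h x)) \<longlongrightarrow> L) (at_right 0) \<and>
       (\<forall>x. 0 < x \<longrightarrow> x \<le> s \<longrightarrow> norm ((u x, h x) - L) \<le> end_rate K s l * norm (u s, h s) * x)"
    by (rule sol_limits) (rule that)
  define \<epsilon> where "\<epsilon> n = min s (X - t) / real (Suc n)" for n
  have \<epsilon>: "\<epsilon> n > 0" "\<epsilon> n \<le> s" "\<epsilon> n \<le> X - t" for n
  proof -
    have "\<epsilon> n \<le> min s (X - t) / 1" unfolding \<epsilon>_def using st by (intro divide_left_mono) auto
    then show "\<epsilon> n \<le> s" "\<epsilon> n \<le> X - t" by auto
    show "\<epsilon> n > 0" unfolding \<epsilon>_def using st by auto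
  qed
  have \<epsilon>0: "\<epsilon> \<longlonglongrightarrow> 0" unfolding \<epsilon>_def by (rule real_tendsto_divide_at_top[OF tendsto_const])
      (rule filterlim_compose[OF filterlim_real_sequentially filterlim_Suc])
  have cont_hol: "continuous_on S (\<lambda>l. u l x)" "continuous_on S (\<lambda>l. h l x)" if "x \<in> {0<..<X}" for x
    using hol[OF that] holomorphic_on_imp_continuous_on by blast+
  have contR: "continuous_on S (\<lambda>l. end_rate K (X - t) l * norm (u l t, h l t))"
    and contL: "continuous_on S (\<lambda>l. end_rate K s l * norm (u l s, h l s))"
    unfolding end_rate_def using st by (intro continuous_intros cont_hol; simp)+
  have comp: "norm (y - y') \<le> b" "norm (w - w') \<le> b" if "norm ((y, w) - (y', w')) \<le> b" for y w y' w' :: complex and b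
    using that norm_fst_le[of "y - y'" "w - w'"] norm_snd_le[of "w - w'" "y - y'"] by auto
  have "norm ((u l x, h l x) - (uR l, hR l)) \<le> end_rate K (X - t) l * norm (u l t, h l t) * (X - x)"
    if "l \<in> S" "t \<le> x" "x < X" for l x
    using R[OF sol[OF that(1)]] that tendsto_Pair[OF tendsto_ends(1,2)[OF that(1)]]
    by (metis tendsto_unique trivial_limit_at_left_real)
  note R' = comp[OF this]
  have "norm ((u l x, h l x) - (uL l, hL l)) \<le> end_rate K s l * norm (u l s, h l s) * x"
    if "l \<in> S" "0 < x" "x \<le> s" for l x
    using L[OF sol[OF that(1)]] that tendsto_Pair[OF tendsto_ends(3,4)[OF that(1)]]
    by (metis tendsto_unique trivial_limit_at_right_real)
  note L' = comp[OF this]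
  have Rn: "t \<le> X - \<epsilon> n" "X - \<epsilon> n < X" "X - \<epsilon> n \<in> {0<..<X}" "\<epsilon> n \<in> {0<..<X}" for n
    using \<epsilon>[of n] st by auto
  show "uR holomorphic_on S"
    by (rule holomorphic_on_seq_limit[OF S(1) _ contR \<epsilon>0, of "\<lambda>n l. u l (X - \<epsilon> n)"])
      (use hol Rn R'(1)[OF _ Rn(1,2)] in auto)
  show "hR holomorphic_on S"
    by (rule holomorphic_on_seq_limit[OF S(1) _ contR \<epsilon>0, of "\<lambda>n l. h l (X - \<epsilon> n)"])
      (use hol Rn R'(2)[OF _ Rn(1,2)] in auto)
  show "uL holomorphic_on S"
    by (rule holomorphic_on_seq_limit[OF S(1) _ contL \<epsilon>0, of "\<lambda>n l. u l (\<epsilon> n)"])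
      (use hol Rn L'(1)[OF _ \<epsilon>(1,2)] in auto)
  show "hL holomorphic_on S"
    by (rule holomorphic_on_seq_limit[OF S(1) _ contL \<epsilon>0, of "\<lambda>n l. h l (\<epsilon> n)"])
      (use hol Rn L'(2)[OF _ \<epsilon>(1,2)] in auto)
qed

lemma detR_holomorphic: "detR holomorphic_on S" and detL_holomorphic: "detL holomorphic_on S"
  unfolding detR_def detL_def by (intro holomorphic_intros holomorphic_ends)+

lemma zero_in_S: "0 \<in> S" using S(3)[of 0] by simp

lemma u_zero: "x \<in> {0<..<X} \<Longrightarrow> u 0 x = 0"
proof -
  assume x: "x \<in> {0<..<X}"
  have "u 0 x = u 0 xs"
  proof (rule has_derivative_zero_unique[OF convex_real_interval(8)])
    show "(u 0 has_derivative (\<lambda>h. 0)) (at y within {0<..<X})" if "y \<in> {0<..<X}" for y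
      using sol[OF zero_in_S] that unfolding sol_def has_vector_derivative_def
      by (auto intro: has_derivative_at_withinI)
  qed (use x xs_in in auto)
  also have "u 0 xs = 0" using sol_sonic[OF sol[OF zero_in_S]] e_xs by simp
  finally show ?thesis .
qed

lemma h_zero: "x \<in> {0<..<X} \<Longrightarrow> h 0 x = h 0 xs / of_real (g xs) * of_real (g x)"
proof -
  assume x: "x \<in> {0<..<X}"
  have g_nz: "complex_of_real (g y) \<noteq> 0" if "y \<in> {0<..<X}" for y using g_pos[of y] that by auto
  have deriv: "\<exists>d. ((\<lambda>y. h 0 y / of_real (g y)) has_vector_derivative d) (at y) \<and> of_real (a y) * d = 0"
    if y: "y \<in> {0<..<X}" for y
  proof -
    obtain h' where h': "(h 0 has_vector_derivative h') (at y)"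
      "of_real (a y) * h' = of_real (\<beta> y) * h 0 y"
      using bspec[OF sol[OF zero_in_S, unfolded sol_def] y] by (auto simp: u_zero[OF y])
    obtain g' where g': "(g has_real_derivative g') (at y)" "a y * g' = \<beta> y * g y"
      using g_deriv[OF y] by blast
    have inv: "((\<lambda>y. complex_of_real (inverse (g y))) has_vector_derivative
        of_real (- (g' / (g y)\<^sup>2))) (at y)"
      using g'(1) g_nz[OF y]
      by (intro has_vector_derivative_of_real) (auto intro!: derivative_eq_intros simp: power2_eq_square divide_inverse)
    have "((\<lambda>y. h 0 y * complex_of_real (inverse (g y))) has_vector_derivative
        h 0 y * of_real (- (g' / (g y)\<^sup>2)) + h' * complex_of_real (inverse (g y))) (at y)"
      by (rule has_vector_derivative_mult[OF h'(1) inv])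
    moreover have "complex_of_real (a y) * (h 0 y * of_real (- (g' / (g y)\<^sup>2)) + h' * complex_of_real (inverse (g y))) = 0"
    proof -
      have "complex_of_real (a y) * (h 0 y * of_real (- (g' / (g y)\<^sup>2)) + h' * complex_of_real (inverse (g y)))
        = (complex_of_real (a y) * h') / of_real (g y) - of_real (a y * g') * h 0 y / (of_real (g y))\<^sup>2"
        by (simp add: field_simps)
      also have "\<dots> = 0" unfolding h'(2) g'(2) using g_nz[OF y] by (simp add: power2_eq_square)
      finally show ?thesis .
    qed
    ultimately show ?thesis by (auto simp: divide_inverse)
  qed
  have "h 0 x / of_real (g x) = h 0 xs / of_real (g xs)"
  proof (rule has_derivative_zero_unique_strong_connected[of "{0<..<X}" "{xs}" "\<lambda>y. h 0 y / of_real (g y)" xs])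
    show "continuous_on {0<..<X} (\<lambda>y. h 0 y / complex_of_real (g y))"
      by (intro continuous_at_imp_continuous_on ballI)
        (use deriv has_vector_derivative_continuous in blast)
    fix y assume y: "y \<in> {0<..<X} - {xs}"
    then obtain d where d: "((\<lambda>y. h 0 y / of_real (g y)) has_vector_derivative d) (at y)" "of_real (a y) * d = 0"
      using deriv by blast
    have "a y \<noteq> 0" using a_neg[of y] a_pos[of y] y by force
    then have "d = 0" using d(2) by simp
    then show "((\<lambda>y. h 0 y / complex_of_real (g y)) has_derivative (\<lambda>h. 0)) (at y within {0<..<X})"
      using d(1) unfolding has_vector_derivative_def by (auto intro: has_derivative_at_withinI)
  qed (use x xs_in in auto)
  then show ?thesis using g_nz[OF x] by (simp add: field_simps)
qed

lemma h_xs_nonzero: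
  assumes "l \<ge> 0" shows "h (of_real l) xs \<noteq> 0"
proof
  assume 0: "h (of_real l) xs = 0"
  obtain x where x: "x \<in> {0<..<X}" "h (of_real l) x \<noteq> 0 \<or> u (of_real l) x \<noteq> 0"
    using nonzero[OF S(3)[OF assms]] by blast
  show False
  proof (cases "l = 0")
    case True then show ?thesis using h_zero[OF x(1)] u_zero[OF x(1)] 0 x(2) by simp
  next
    case False
    then show ?thesis using sol_unique_zero[OF sol[OF S(3)[OF assms]] _ 0 x(1)] assms x(2) by auto
  qed
qed

lemma ratio_real:
  assumes "l \<ge> 0" "x \<in> {0<..<X}"
  shows "u (of_real l) x / h (of_real l) xs \<in> \<real>" "h (of_real l) x / h (of_real l) xs \<in> \<real>"
proof -
  have "u (of_real l) x / h (of_real l) xs \<in> \<real> \<and> h (of_real l) x / h (of_real l) xs \<in> \<real>"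
  proof (cases "l = 0")
    case True then show ?thesis
      using u_zero[OF assms(2)] h_zero[OF assms(2)] h_xs_nonzero[of 0] by (auto simp: complex_is_Real_iff)
  next
    case False
    then show ?thesis using rsol_ratio[OF sol[OF S(3)[OF assms(1)]] _ h_xs_nonzero[OF assms(1)] assms(2)] assms(1)
      by auto
  qed
  then show "u (of_real l) x / h (of_real l) xs \<in> \<real>" "h (of_real l) x / h (of_real l) xs \<in> \<real>" by auto
qed

lemma ends_real:
  assumes "l \<ge> 0"
  shows "uR (of_real l) / h (of_real l) xs \<in> \<real>" "hR (of_real l) / h (of_real l) xs \<in> \<real>"
    "uL (of_real l) / h (of_real l) xs \<in> \<real>" "hL (of_real l) / h (of_real l) xs \<in> \<real>"
proof -
  have real: "L / h (of_real l) xs \<in> \<real>"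
    if "(f \<longlongrightarrow> L) F" "F \<noteq> bot" "\<forall>\<^sub>F x in F. f x / h (of_real l) xs \<in> \<real>" for f L and F :: "real filter"
    using Lim_in_closed_set[OF closed_complex_Reals that(3,2) tendsto_divide[OF that(1) tendsto_const h_xs_nonzero[OF assms]]] .
  have ev: "\<forall>\<^sub>F x in at_left X. x \<in> {0<..<X}" "\<forall>\<^sub>F x in at_right 0. x \<in> {0<..<X}"
    using xs by (auto intro: eventually_at_leftI eventually_at_rightI)
  note lim = tendsto_ends[OF S(3)[OF assms]] and ratio = ratio_real[OF assms]
  show "uR (of_real l) / h (of_real l) xs \<in> \<real>" "hR (of_real l) / h (of_real l) xs \<in> \<real>"
    using lim by (auto intro!: real trivial_limit_at_left_real eventually_mono[OF ev(1)] ratio)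
  show "uL (of_real l) / h (of_real l) xs \<in> \<real>" "hL (of_real l) / h (of_real l) xs \<in> \<real>"
    using lim by (auto intro!: real trivial_limit_at_right_real eventually_mono[OF ev(2)] ratio)
qed

lemma det_real:
  assumes "l \<ge> 0"
  shows "detR (of_real l) / h (of_real l) xs \<in> \<real>" "detL (of_real l) / h (of_real l) xs \<in> \<real>"
proof -
  have real: "(of_real r1 * (of_real r2 * y - of_real r3 * w) + of_real r4 * w) / z \<in> \<real>"
    if "y / z \<in> \<real>" "w / z \<in> \<real>" for r1 r2 r3 r4 and y w z :: complex
  proof -
    have "(of_real r1 * (of_real r2 * y - of_real r3 * w) + of_real r4 * w) / z
        = of_real r1 * (of_real r2 * (y / z) - of_real r3 * (w / z)) + of_real r4 * (w / z)"
      by (simp add: add_divide_distrib diff_divide_distrib right_diff_distrib)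
    moreover have "\<dots> \<in> \<real>" by (intro Reals_add Reals_mult Reals_diff Reals_of_real that)
    ultimately show ?thesis by (simp only:)
  qed
  show "detR (of_real l) / h (of_real l) xs \<in> \<real>" "detL (of_real l) / h (of_real l) xs \<in> \<real>"
    unfolding detR_def detL_def of_real_mult[symmetric] by (intro real ends_real[OF assms])+
qed

lemma det_dominant:
  obtains L where "L > 0" "\<And>l. l > L \<Longrightarrow>
    \<bar>Re (detL (of_real l) / h (of_real l) xs)\<bar> < Re (detR (of_real l) / h (of_real l) xs)"
proof -
  obtain L where L: "L > 0"
    "\<And>l u h uR hR uL hL. l > L \<Longrightarrow> rsol l u h \<Longrightarrow> h xs = 1 \<Longrightarrow>
       (u \<longlongrightarrow> uR) (at_left X) \<Longrightarrow> (h \<longlongrightarrow> hR) (at_left X) \<Longrightarrow>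
       (u \<longlongrightarrow> uL) (at_right 0) \<Longrightarrow> (h \<longlongrightarrow> hL) (at_right 0) \<Longrightarrow>
       \<bar>l * J * (a 0 * hL - k 0 * uL) + M * uL\<bar> < l * J * (a X * hR - k X * uR) + M * uR"
    by (rule rsol_dominant) (rule that)
  show ?thesis
  proof (rule that[OF L(1)])
    fix l assume l: "l > L"
    then have l0: "l \<ge> 0" using L(1) by simp
    let ?l = "complex_of_real l"
    let ?c = "inverse (h ?l xs)"
    note lim = tendsto_ends[OF S(3)[OF l0]] and nz = h_xs_nonzero[OF l0]
    have rs: "rsol l (\<lambda>x. Re (?c * u ?l x)) (\<lambda>x. Re (?c * h ?l x))"
      by (rule rsol_Re[OF sol_scale[OF sol[OF S(3)[OF l0]]]])
    have Re: "Re (of_real r1 * (of_real r2 * y - of_real r3 * w) + of_real r4 * w)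
      = r1 * (r2 * Re y - r3 * Re w) + r4 * Re w" for r1 r2 r3 r4 y w by simp
    have one: "Re (?c * h ?l xs) = 1" using left_inverse[OF nz] by (metis one_complex.sel(1))
    have "\<bar>l * J * (a 0 * Re (?c * hL ?l) - k 0 * Re (?c * uL ?l)) + M * Re (?c * uL ?l)\<bar>
      < l * J * (a X * Re (?c * hR ?l) - k X * Re (?c * uR ?l)) + M * Re (?c * uR ?l)"
      by (rule L(2)[OF l rs one]) (intro tendsto_Re tendsto_mult_left lim)+
    moreover have "Re ((of_real r0 * of_real r1 * (of_real r2 * y - of_real r3 * w) + of_real r4 * w) / z)
      = r0 * r1 * (r2 * Re (inverse z * y) - r3 * Re (inverse z * w)) + r4 * Re (inverse z * w)" for r0 r1 r2 r3 r4 y w z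
    proof -
      have "(of_real r0 * of_real r1 * (of_real r2 * y - of_real r3 * w) + of_real r4 * w) / z =
          of_real (r0 * r1) * (of_real r2 * (inverse z * y) - of_real r3 * (inverse z * w)) + of_real r4 * (inverse z * w)"
        by (simp add: divide_inverse algebra_simps)
      then show ?thesis by (simp only: Re)
    qed
    ultimately show "\<bar>Re (detL ?l / h ?l xs)\<bar> < Re (detR ?l / h ?l xs)"
      unfolding detR_def detL_def by (simp only:)
  qed
qed

lemma ends_zero:
  "uR 0 = 0" "uL 0 = 0" "hR 0 = h 0 xs / of_real (g xs) * of_real (g X)"
  "hL 0 = h 0 xs / of_real (g xs) * of_real (g 0)"
proof -
  note lim = tendsto_ends[OF zero_in_S]
  have ev: "\<forall>\<^sub>F x in at_left X. x \<in> {0<..<X}" "\<forall>\<^sub>F x in at_right 0. x \<in> {0<..<X}"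
    using xs by (auto intro: eventually_at_leftI eventually_at_rightI)
  have gl: "(g \<longlongrightarrow> g X) (at_left X)" "(g \<longlongrightarrow> g 0) (at_right 0)"
    using continuous_on_Icc_at_leftD[OF cont(7)] continuous_on_Icc_at_rightD[OF cont(7)] xs by auto
  have eq: "y = z" if "(f \<longlongrightarrow> y) F" "(f' \<longlongrightarrow> z) F" "F \<noteq> bot" "\<forall>\<^sub>F x in F. x \<in> {0<..<X}"
      "\<And>x. x \<in> {0<..<X} \<Longrightarrow> f x = f' x" for f f' :: "real \<Rightarrow> complex" and y z F
  proof (rule tendsto_unique[OF that(3) _ that(2)])
    show "(f' \<longlongrightarrow> y) F"
      by (rule Lim_transform_eventually[OF that(1)]) (rule eventually_mono[OF that(4)], rule that(5))
  qed
  note eqR = eq[OF _ _ trivial_limit_at_left_real ev(1)] and eqL = eq[OF _ _ trivial_limit_at_right_real ev(2)]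
  show "uR 0 = 0" by (rule eqR[OF lim(1) tendsto_const u_zero])
  show "uL 0 = 0" by (rule eqL[OF lim(3) tendsto_const u_zero])
  show "hR 0 = h 0 xs / of_real (g xs) * of_real (g X)"
    by (rule eqR[OF lim(2) tendsto_mult_left[OF tendsto_of_real[OF gl(1)]] h_zero])
  show "hL 0 = h 0 xs / of_real (g xs) * of_real (g 0)"
    by (rule eqL[OF lim(4) tendsto_mult_left[OF tendsto_of_real[OF gl(2)]] h_zero])
qed

lemma det_zero: "detR 0 = 0" "detL 0 = 0"
  unfolding detR_def detL_def using ends_zero by simp_all

lemma h_bounded:
  obtains C where "\<And>l x. 0 < l \<Longrightarrow> l \<le> 1 \<Longrightarrow> x \<in> {0<..<X} \<Longrightarrow> norm (h (of_real l) x) \<le> C"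
proof -
  obtain t C where t: "t > 0" "C > 0" "{xs - t..xs + t} \<subseteq> {0<..<X}"
    and bnd: "\<And>l u h x. 0 < l \<Longrightarrow> l \<le> 1 \<Longrightarrow> rsol l u h \<Longrightarrow> x \<in> {xs - t..xs + t} \<Longrightarrow> \<bar>h x\<bar> \<le> C * \<bar>h xs\<bar>"
    by (rule rsol_near_sonic_bound[OF zero_less_one]) (rule that)
  obtain K where K: "K > 0" "\<And>l u h. sol l u h \<Longrightarrow> regular_bound t K l u h"
    by (rule sol_regular_bound[OF t(1)]) (rule that)
  have sub: "of_real ` {0..1} \<subseteq> S" using S(3) by auto
  have bdd: "\<exists>b. \<forall>l\<in>{0..1}. norm (u (of_real l) x) \<le> b \<and> norm (h (of_real l) x) \<le> b" if x: "x \<in> {0<..<X}" for x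
  proof -
    have "bounded ((\<lambda>l. u l x) ` of_real ` {0..1})" "bounded ((\<lambda>l. h l x) ` of_real ` {0..1})"
      by (intro compact_imp_bounded compact_continuous_image continuous_on_of_real_id compact_Icc
          continuous_on_subset[OF holomorphic_on_imp_continuous_on[OF hol(1)[OF x]] sub]
          continuous_on_subset[OF holomorphic_on_imp_continuous_on[OF hol(2)[OF x]] sub])+
    then obtain b1 b2 where "\<And>l. l \<in> {0..1} \<Longrightarrow> norm (u (of_real l) x) \<le> b1"
      "\<And>l. l \<in> {0..1} \<Longrightarrow> norm (h (of_real l) x) \<le> b2"
      unfolding bounded_iff by (metis imageI)
    then show ?thesis by (intro exI[of _ "max b1 b2"]) (auto intro: max.coboundedI1 max.coboundedI2)
  qed
  have pts: "xs \<in> {0<..<X}" "xs - t \<in> {0<..<X}" "xs + t \<in> {0<..<X}"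
    by (rule subsetD[OF t(3)], use t(1) in simp)+
  obtain b0 where b0: "\<And>l. l \<in> {0..1} \<Longrightarrow> norm (h (of_real l) xs) \<le> b0" using bdd[OF pts(1)] by blast
  obtain b1 where b1: "\<And>l. l \<in> {0..1} \<Longrightarrow> norm (u (of_real l) (xs - t)) \<le> b1 \<and> norm (h (of_real l) (xs - t)) \<le> b1"
    using bdd[OF pts(2)] by blast
  obtain b2 where b2: "\<And>l. l \<in> {0..1} \<Longrightarrow> norm (u (of_real l) (xs + t)) \<le> b2 \<and> norm (h (of_real l) (xs + t)) \<le> b2"
    using bdd[OF pts(3)] by blast
  have main: "norm (h (of_real l) x) \<le> max (C * b0 + C * b0) (exp (K * 2 * X) * max (b1 + b1) (b2 + b2))"
    if l: "0 < l" "l \<le> 1" and x: "x \<in> {0<..<X}" for l x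
  proof -
    have lS: "of_real l \<in> S" using S(3) l by simp
    have l': "l \<in> {0..1}" using l by simp
    show ?thesis
    proof (cases "x \<in> {xs - t..xs + t}")
      case True
      have "\<bar>Re (h (of_real l) x)\<bar> \<le> C * \<bar>Re (h (of_real l) xs)\<bar>" "\<bar>Im (h (of_real l) x)\<bar> \<le> C * \<bar>Im (h (of_real l) xs)\<bar>"
        using bnd[OF l rsol_Re[OF sol[OF lS]] True] bnd[OF l rsol_Im[OF sol[OF lS]] True] by auto
      moreover have "\<bar>Re (h (of_real l) xs)\<bar> \<le> b0" "\<bar>Im (h (of_real l) xs)\<bar> \<le> b0"
        using abs_Re_le_cmod[of "h (of_real l) xs"] abs_Im_le_cmod[of "h (of_real l) xs"] b0[OF l'] by auto
      ultimately have "\<bar>Re (h (of_real l) x)\<bar> \<le> C * b0" "\<bar>Im (h (of_real l) x)\<bar> \<le> C * b0"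
        using t(2) by (meson less_imp_le mult_left_mono order_trans)+
      then show ?thesis using cmod_le[of "h (of_real l) x"] by linarith
    next
      case False
      define z where "z x = (u (of_real l) x, h (of_real l) x)" for x
      obtain z' where z': "\<forall>x. x \<in> {0<..<X} \<longrightarrow> t \<le> \<bar>x - xs\<bar> \<longrightarrow>
          (z has_vector_derivative z' x) (at x) \<and> norm (z' x) \<le> K * (1 + l) * norm (z x)"
        using K(2)[OF sol[OF lS]] l unfolding regular_bound_def z_def by auto
      have z_le: "norm (z (xs - t)) \<le> max (b1 + b1) (b2 + b2)" "norm (z (xs + t)) \<le> max (b1 + b1) (b2 + b2)"
        unfolding z_def using b1[OF l'] b2[OF l']
        by (intro order_trans[OF norm_Pair_le]; linarith)+
      have exp_le: "exp (K * (1 + l) * r) \<le> exp (K * 2 * X)" if "0 \<le> r" "r \<le> X" for r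
        using K(1) l that by (auto intro!: mult_mono)
      have "norm (z x) \<le> exp (K * 2 * X) * max (b1 + b1) (b2 + b2)"
      proof (cases "x < xs")
        case True
        then have le: "x \<le> xs - t" using False t(1) by auto
        have "norm (z x) \<le> exp (K * (1 + l) * (xs - t - x)) * norm (z (xs - t))"
          by (rule norm_gronwall(2)[OF le, where z' = z']) (use z' x pts in auto)
        also have "\<dots> \<le> exp (K * 2 * X) * max (b1 + b1) (b2 + b2)"
          using x pts le by (intro mult_mono exp_le z_le) auto
        finally show ?thesis .
      next
        case False
        then have le: "xs + t \<le> x" using \<open>x \<notin> {xs - t..xs + t}\<close> t(1) by auto
        have "norm (z x) \<le> exp (K * (1 + l) * (x - (xs + t))) * norm (z (xs + t))"
          by (rule norm_gronwall(1)[OF le, where z' = z']) (use z' x pts in auto)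
        also have "\<dots> \<le> exp (K * 2 * X) * max (b1 + b1) (b2 + b2)"
          using x pts le by (intro mult_mono exp_le z_le) auto
        finally show ?thesis .
      qed
      then show ?thesis using norm_snd_le[of "h (of_real l) x" "u (of_real l) x"] unfolding z_def by linarith
    qed
  qed
  show ?thesis by (rule that[OF main])
qed

lemma h_integral:
  assumes "l \<in> S" shows "((\<lambda>x. l * h l x) has_integral (uL l - uR l)) {0<..<X}"
proof -
  define f where "f x = (if x = 0 then uL l else if x = X then uR l else u l x)" for x
  have f_ends: "f 0 = uL l" "f X = uR l" unfolding f_def using xs by auto
  note lim = tendsto_ends[OF assms]
  have X: "0 < X" using xs by simp
  have evX: "\<forall>\<^sub>F x in at_left X. u l x = f x"
    using eventually_at_leftI[of 0 X "\<lambda>x. x \<in> {0<..<X}"] X by (auto elim!: eventually_mono simp: f_def)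
  have ev0: "\<forall>\<^sub>F x in at_right 0. u l x = f x"
    using eventually_at_rightI[of 0 X "\<lambda>x. x \<in> {0<..<X}"] X by (auto elim!: eventually_mono simp: f_def)
  have D: "(f has_vector_derivative - l * h l x) (at x)" if x: "x \<in> {0<..<X}" for x
  proof (rule has_vector_derivative_transform_within_open[of "u l" _ x "{0<..<X}"])
    show "(u l has_vector_derivative - l * h l x) (at x)" using sol[OF assms] x unfolding sol_def by blast
  qed (use x in \<open>auto simp: f_def\<close>)
  have "continuous_on {0..X} f"
  proof (rule continuous_on_IccI[OF _ _ _ X])
    show "(f \<longlongrightarrow> f 0) (at_right 0)"
      unfolding f_ends by (rule Lim_transform_eventually[OF lim(3) ev0])
    show "(f \<longlongrightarrow> f X) (at_left X)"
      unfolding f_ends by (rule Lim_transform_eventually[OF lim(1) evX])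
    show "f \<midarrow>x\<rightarrow> f x" if "0 < x" "x < X" for x
      using has_vector_derivative_continuous[OF D[of x]] that by (simp add: continuous_within)
  qed
  then have "((\<lambda>x. - l * h l x) has_integral (f X - f 0)) {0..X}"
    by (rule fundamental_theorem_of_calculus_interior[OF less_imp_le[OF X]]) (use D in auto)
  then have "((\<lambda>x. - (- l * h l x)) has_integral - (f X - f 0)) {0..X}" by (rule has_integral_neg)
  then show ?thesis using X by (simp add: has_integral_Icc_iff_Ioo f_ends)
qed

lemma u_jump_deriv: "deriv uR 0 - deriv uL 0 = - (h 0 xs / of_real (g xs) * of_real J)"
proof -
  define \<epsilon> where "\<epsilon> n = 1 / real (Suc n)" for n
  have \<epsilon>: "0 < \<epsilon> n" "\<epsilon> n \<le> 1" for n unfolding \<epsilon>_def by auto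
  have \<epsilon>0: "\<epsilon> \<longlonglongrightarrow> 0" unfolding \<epsilon>_def using LIMSEQ_inverse_real_of_nat by (simp add: inverse_eq_divide)
  define l where "l n = complex_of_real (\<epsilon> n)" for n
  have lS: "l n \<in> S" for n unfolding l_def using S(3) \<epsilon>(1)[of n] by simp
  have l_nz: "l n \<noteq> 0" for n unfolding l_def using \<epsilon>(1)[of n] by simp
  have l0: "l \<longlonglongrightarrow> 0" unfolding l_def using tendsto_of_real[OF \<epsilon>0, where 'a = complex] by simp
  have l_at: "filterlim l (at 0) sequentially" using l0 l_nz by (simp add: filterlim_at)
  obtain C where C: "\<And>l x. 0 < l \<Longrightarrow> l \<le> 1 \<Longrightarrow> x \<in> {0<..<X} \<Longrightarrow> norm (h (of_real l) x) \<le> C"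
    by (rule h_bounded) blast
  have int: "(h (l n) has_integral (uL (l n) - uR (l n)) / l n) {0<..<X}" for n
  proof -
    have "(\<lambda>x. inverse (l n) * (l n * h (l n) x)) = h (l n)"
      using l_nz[of n] by (simp add: fun_eq_iff flip: mult.assoc)
    then show ?thesis
      using has_integral_mult_right[OF h_integral[OF lS[of n]], of "inverse (l n)"]
      by (simp add: divide_inverse mult.commute)
  qed
  have pt: "(\<lambda>n. h (l n) x) \<longlonglongrightarrow> h 0 x" if "x \<in> {0<..<X}" for x
  proof (rule continuous_on_tendsto_compose[OF _ l0 zero_in_S])
    show "continuous_on S (\<lambda>l. h l x)" using hol(2)[OF that] by (rule holomorphic_on_imp_continuous_on)
  qed (simp add: lS)
  have "(\<lambda>n. integral {0<..<X} (h (l n))) \<longlonglongrightarrow> integral {0<..<X} (h 0)"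
  proof (rule dominated_convergence(2))
    show "h (l n) integrable_on {0<..<X}" for n using int by blast
    show "(\<lambda>x. C) integrable_on {0<..<X}"
      unfolding integrable_on_Icc_iff_Ioo[symmetric] by (rule integrable_const_ivl)
    show "norm (h (l n) x) \<le> C" if "x \<in> {0<..<X}" for n x
      unfolding l_def by (rule C[OF \<epsilon> that])
  qed (rule pt)
  moreover have "integral {0<..<X} (h (l n)) = (uL (l n) - uR (l n)) / l n" for n
    using int by (rule integral_unique)
  moreover have "integral {0<..<X} (h 0) = h 0 xs / of_real (g xs) * of_real J"
  proof -
    have X: "0 < X" using xs by simp
    have "(g has_integral J) {0..X}"
      by (rule fundamental_theorem_of_calculus_interior[OF less_imp_le[OF X] cont(6)])
        (use G_deriv in \<open>auto simp: has_real_derivative_iff_has_vector_derivative\<close>)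
    then have "((\<lambda>x. complex_of_real (g x)) has_integral of_real J) {0..X}" by (rule has_integral_of_real)
    then have "((\<lambda>x. h 0 xs / of_real (g xs) * complex_of_real (g x)) has_integral h 0 xs / of_real (g xs) * of_real J) {0<..<X}"
      unfolding has_integral_Icc_iff_Ioo by (rule has_integral_mult_right)
    then have "(h 0 has_integral h 0 xs / of_real (g xs) * of_real J) {0<..<X}"
      by (rule has_integral_eq[rotated]) (use h_zero in auto)
    then show ?thesis by (rule integral_unique)
  qed
  ultimately have lim1: "(\<lambda>n. (uL (l n) - uR (l n)) / l n) \<longlonglongrightarrow> h 0 xs / of_real (g xs) * of_real J" by simp
  have "((\<lambda>z. uL z - uR z) has_field_derivative deriv uL 0 - deriv uR 0) (at 0)"
    by (intro DERIV_diff holomorphic_derivI[OF _ S(1) zero_in_S] holomorphic_ends)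
  then have "((\<lambda>z. (uL z - uR z) / z) \<longlongrightarrow> deriv uL 0 - deriv uR 0) (at 0)"
    by (simp add: has_field_derivative_iff ends_zero)
  then have "(\<lambda>n. (uL (l n) - uR (l n)) / l n) \<longlonglongrightarrow> deriv uL 0 - deriv uR 0"
    by (rule filterlim_compose[OF _ l_at])
  from tendsto_unique[OF sequentially_bot this lim1] show ?thesis by (simp add: algebra_simps)
qed

lemma det_deriv_eq: "deriv detR 0 = deriv detL 0"
proof -
  note D = holomorphic_derivI[OF _ S(1) zero_in_S]
  have R: "deriv detR 0 = of_real J * (of_real (a X) * hR 0) + of_real M * deriv uR 0"
  proof (rule DERIV_imp_deriv)
    show "(detR has_field_derivative of_real J * (of_real (a X) * hR 0) + of_real M * deriv uR 0) (at 0)"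
      unfolding detR_def using D[OF holomorphic_ends(1)] D[OF holomorphic_ends(2)]
      by (auto intro!: derivative_eq_intros simp: ends_zero)
  qed
  have L: "deriv detL 0 = of_real J * (of_real (a 0) * hL 0) + of_real M * deriv uL 0"
  proof (rule DERIV_imp_deriv)
    show "(detL has_field_derivative of_real J * (of_real (a 0) * hL 0) + of_real M * deriv uL 0) (at 0)"
      unfolding detL_def using D[OF holomorphic_ends(3)] D[OF holomorphic_ends(4)]
      by (auto intro!: derivative_eq_intros simp: ends_zero)
  qed
  have "deriv detR 0 - deriv detL 0 = of_real J * (of_real (a X) * hR 0 - of_real (a 0) * hL 0)
      + of_real M * (deriv uR 0 - deriv uL 0)"
    unfolding R L by (simp add: algebra_simps)
  also have "\<dots> = 0"
  proof -
    have "of_real J * (of_real (a X) * (\<kappa> * of_real (g X)) - of_real (a 0) * (\<kappa> * of_real (g 0)))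
      + of_real M * - (\<kappa> * of_real J) = 0" for \<kappa> :: complex
      by (simp add: algebra_simps)
    then show ?thesis unfolding u_jump_deriv ends_zero .
  qed
  finally show ?thesis by simp
qed

end

section \<open>The linearized Saint-Venant equations at a roll wave\<close>

lemma real_analytic_on_imp_has_vector_derivative:
  assumes "real_analytic_on f S" "x \<in> S"
  obtains f' where "(f has_vector_derivative f') (at x)"
proof -
  obtain r a where r: "r > 0" and sums: "\<And>y. \<bar>y - x\<bar> < r \<Longrightarrow> (\<lambda>n. a n * complex_of_real (y - x) ^ n) sums f y"
    using assms unfolding real_analytic_on_def by blast
  have "summable (\<lambda>n. a n * complex_of_real (r / 2) ^ n)"
    using sums[of "x + r / 2"] r by (auto simp: sums_iff)
  then obtain d where "((\<lambda>z. \<Sum>n. a n * z ^ n) has_field_derivative d) (at (complex_of_real 0))"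
    using termdiffs_strong[of a "complex_of_real (r / 2)" 0] r by auto
  from has_vector_derivative_real_field[OF this]
  have "((\<lambda>t. \<Sum>n. a n * complex_of_real t ^ n) has_vector_derivative d) (at (0::real))" .
  then have "((\<lambda>t. \<Sum>n. a n * complex_of_real t ^ n) has_vector_derivative d) (at (x - x))" by simp
  moreover have "((\<lambda>y. y - x) has_vector_derivative 1) (at x)"
    by (auto intro!: derivative_eq_intros simp flip: has_real_derivative_iff_has_vector_derivative)
  ultimately have "((\<lambda>y. \<Sum>n. a n * complex_of_real (y - x) ^ n) has_vector_derivative d) (at x)"
    using vector_diff_chain_at[of "\<lambda>y. y - x" 1 x "\<lambda>t. \<Sum>n. a n * complex_of_real t ^ n" d] by (simp add: o_def)
  moreover have "x \<in> {x - r<..<x + r}" using r by simp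
  moreover have "(\<Sum>n. a n * complex_of_real (y - x) ^ n) = f y" if "y \<in> {x - r<..<x + r}" for y
    using sums[of y] that by (auto simp: sums_iff abs_less_iff)
  ultimately have "(f has_vector_derivative d) (at x)"
    by (rule has_vector_derivative_transform_within_open[OF _ open_greaterThanLessThan])
  then show ?thesis by (rule that)
qed

locale saint_venant_wave =
  fixes F Hs Hm X xs :: real and H :: "real \<Rightarrow> real"
  assumes wave: "roll_wave F Hs Hm X H" and sonic: "xs \<in> {0<..<X}" "H xs = Hs"
begin

abbreviation "c \<equiv> wave_speed F Hs"
abbreviation "q0 \<equiv> flux_const F Hs"
abbreviation "Q \<equiv> Q_profile F Hs H"

definition "U x = c - q0 / H x"
definition "g x = profile_rhs F Hs (H x)"
definition "a x = H x / F\<^sup>2 - q0\<^sup>2 / (H x)\<^sup>2"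
definition "k x = 2 * q0 / H x"
definition "k' x = - 2 * q0 * g x / (H x)\<^sup>2"
definition "e x = 2 * U x / H x + 2 * q0 * g x / (H x)\<^sup>2"
definition "\<beta> x = 1 - 2 * U x * q0 / (H x)\<^sup>2 - (1 / F\<^sup>2 + 2 * q0\<^sup>2 / (H x) ^ 3) * g x"

lemma F: "F > 2" and Hs: "Hs > 0" and Hm: "(1 + 2 * F + sqrt (1 + 4 * F)) / (2 * F\<^sup>2) * Hs < Hm" "Hm < Hs"
  and X: "X > 0"
  and H_ge: "\<And>x. x \<in> {0..X} \<Longrightarrow> Hm \<le> H x"
  and H_deriv_within: "\<And>x. x \<in> {0..X} \<Longrightarrow> (H has_real_derivative g x) (at x within {0..X})"
  using wave unfolding roll_wave_def roll_wave_params_def g_def by auto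

lemma q0_eq: "q0 = Hs * sqrt Hs / F"
proof -
  have "Hs powr (3 / 2) = Hs powr (1 + 1 / 2)" by simp
  also have "\<dots> = Hs * sqrt Hs" using Hs by (subst powr_add) (simp add: powr_half_sqrt)
  finally show ?thesis unfolding flux_const_def by simp
qed

lemma q0_pos: "q0 > 0" unfolding q0_eq using F Hs by simp

lemma q0_sq: "q0\<^sup>2 = Hs ^ 3 / F\<^sup>2"
  unfolding q0_eq using Hs by (simp add: power_divide power_mult_distrib power2_eq_square power3_eq_cube)

lemma c_sq: "c\<^sup>2 = Hs * (1 + 1 / F)\<^sup>2"
  unfolding wave_speed_def using Hs by (simp add: power_mult_distrib)

lemma c_q0: "c * q0 = Hs\<^sup>2 * (1 + 1 / F) / F"
  unfolding wave_speed_def q0_eq using Hs by (simp add: power2_eq_square mult_ac)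

lemma Hm_pos: "Hm > 0"
proof -
  have "(1 + 2 * F + sqrt (1 + 4 * F)) / (2 * F\<^sup>2) * Hs > 0" using F Hs by (intro mult_pos_pos divide_pos_pos) (auto intro: add_pos_nonneg)
  then show ?thesis using Hm by linarith
qed

lemma H_pos: "x \<in> {0..X} \<Longrightarrow> H x > 0"
  using H_ge[of x] Hm_pos by auto

lemma numerator_pos:
  assumes "y \<ge> Hm" shows "y\<^sup>2 + (Hs - c\<^sup>2) * y + q0\<^sup>2 / Hs > 0"
proof -
  define d where "d = sqrt (1 + 4 * F)"
  define rp where "rp = (1 + 2 * F + d) / (2 * F\<^sup>2) * Hs"
  define rm where "rm = (1 + 2 * F - d) / (2 * F\<^sup>2) * Hs"
  have d: "d\<^sup>2 = 1 + 4 * F" "d \<ge> 0" unfolding d_def using F by auto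
  have F0: "F \<noteq> 0" using F by simp
  have sum: "rp + rm = Hs * (2 * F + 1) / F\<^sup>2" unfolding rp_def rm_def using F0 by (simp add: field_simps)
  have "rp * rm = ((1 + 2 * F)\<^sup>2 - d\<^sup>2) / (4 * F ^ 4) * Hs\<^sup>2"
    unfolding rp_def rm_def using F0 by (simp add: field_simps power2_eq_square power4_eq_xxxx)
  also have "\<dots> = Hs\<^sup>2 / F\<^sup>2" unfolding d(1) using F0 by (simp add: field_simps power2_eq_square power4_eq_xxxx)
  finally have prod: "rp * rm = Hs\<^sup>2 / F\<^sup>2" .
  have "y\<^sup>2 + (Hs - c\<^sup>2) * y + q0\<^sup>2 / Hs = y\<^sup>2 - (Hs * (2 * F + 1) / F\<^sup>2) * y + Hs\<^sup>2 / F\<^sup>2"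
    unfolding c_sq q0_sq using F0 Hs by (simp add: field_simps power2_eq_square power3_eq_cube)
  also have "\<dots> = (y - rp) * (y - rm)" unfolding sum[symmetric] prod[symmetric] by (simp add: algebra_simps power2_eq_square)
  also have "\<dots> > 0"
  proof (rule mult_pos_pos)
    show "y - rp > 0" using Hm(1) assms unfolding rp_def d_def by simp
    moreover have "rm \<le> rp" unfolding rp_def rm_def using d(2) Hs by (intro mult_right_mono divide_right_mono) auto
    ultimately show "y - rm > 0" by linarith
  qed
  finally show ?thesis .
qed

lemma denominator_pos: "y > 0 \<Longrightarrow> y\<^sup>2 + Hs * y + Hs\<^sup>2 > 0"
  using Hs by (simp add: add_pos_pos)

lemma g_pos: "x \<in> {0..X} \<Longrightarrow> g x > 0"
  unfolding g_def profile_rhs_def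
  using numerator_pos[OF H_ge] denominator_pos[OF H_pos] F by auto

lemma H_cont: "continuous_on {0..X} H"
  using H_deriv_within DERIV_continuous_on by blast

lemma H_deriv: "x \<in> {0<..<X} \<Longrightarrow> (H has_real_derivative g x) (at x)"
  using H_deriv_within[of x] by (simp add: at_within_Icc_at)

lemma H_strict:
  assumes "0 \<le> x" "x < y" "y \<le> X" shows "H x < H y"
proof (rule DERIV_pos_imp_increasing_open[OF assms(2)])
  show "\<exists>d. (H has_real_derivative d) (at z) \<and> 0 < d" if "x < z" "z < y" for z
    using H_deriv[of z] g_pos[of z] that assms by auto
  show "continuous_on {x..y} H" by (rule continuous_on_subset[OF H_cont]) (use assms in auto)
qed

lemma H_left: "0 \<le> x \<Longrightarrow> x < xs \<Longrightarrow> H x < Hs" and H_right: "xs < x \<Longrightarrow> x \<le> X \<Longrightarrow> Hs < H x"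
  using H_strict[of x xs] H_strict[of xs x] sonic by auto

lemma a_eq: "x \<in> {0..X} \<Longrightarrow> a x = (H x - Hs) * ((H x)\<^sup>2 + Hs * H x + Hs\<^sup>2) / (F\<^sup>2 * (H x)\<^sup>2)"
  unfolding a_def q0_sq using H_pos[of x] F by (simp add: field_simps power2_eq_square power3_eq_cube)

text \<open>The stationary profile equation, divided out by the common factor \<open>H - Hs\<close>.\<close>

lemma a_g: "x \<in> {0..X} \<Longrightarrow> a x * g x = H x - (U x)\<^sup>2"
proof -
  assume x: "x \<in> {0..X}"
  note pos = H_pos[OF x] denominator_pos[OF H_pos[OF x]]
  have F0: "F \<noteq> 0" using F by simp
  have "a x * g x = (H x - Hs) * ((H x)\<^sup>2 + (Hs - c\<^sup>2) * H x + q0\<^sup>2 / Hs) / (H x)\<^sup>2"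
    unfolding a_eq[OF x] g_def profile_rhs_def using pos F0 by simp
  also have "(H x - Hs) * ((H x)\<^sup>2 + (Hs - c\<^sup>2) * H x + q0\<^sup>2 / Hs)
      = (H x) ^ 3 - c\<^sup>2 * (H x)\<^sup>2 + (q0\<^sup>2 / Hs - Hs\<^sup>2 + Hs * c\<^sup>2) * H x - q0\<^sup>2"
    using Hs by (simp add: field_simps power2_eq_square power3_eq_cube)
  also have "q0\<^sup>2 / Hs - Hs\<^sup>2 + Hs * c\<^sup>2 = 2 * (c * q0)"
    unfolding q0_sq c_sq c_q0 using Hs F0 by (simp add: field_simps power2_eq_square power3_eq_cube)
  finally show ?thesis unfolding U_def using pos by (simp add: field_simps power2_eq_square power3_eq_cube)
qed

lemma U_deriv: "x \<in> {0<..<X} \<Longrightarrow> (U has_real_derivative q0 * g x / (H x)\<^sup>2) (at x)"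
  unfolding U_def using H_pos[of x]
  by (auto intro!: derivative_eq_intros H_deriv simp: power2_eq_square)

lemma g_deriv:
  assumes x: "x \<in> {0<..<X}"
  shows "\<exists>g'. (g has_real_derivative g') (at x) \<and> a x * g' = \<beta> x * g x"
proof -
  have x': "x \<in> {0..X}" using x by auto
  note pos = H_pos[OF x'] denominator_pos[OF H_pos[OF x']]
  have "(profile_rhs F Hs has_real_derivative
      F\<^sup>2 * (((2 * H x + (Hs - c\<^sup>2)) * ((H x)\<^sup>2 + Hs * H x + Hs\<^sup>2)
        - ((H x)\<^sup>2 + (Hs - c\<^sup>2) * H x + q0\<^sup>2 / Hs) * (2 * H x + Hs))
        / (((H x)\<^sup>2 + Hs * H x + Hs\<^sup>2) * ((H x)\<^sup>2 + Hs * H x + Hs\<^sup>2)))) (at (H x))"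
    unfolding profile_rhs_def
    by (rule DERIV_cmult, rule DERIV_divide) (use pos in \<open>auto intro!: derivative_eq_intros\<close>)
  from DERIV_chain2[OF this H_deriv[OF x]] obtain g' where g': "(g has_real_derivative g') (at x)"
    unfolding g_def by blast
  have da: "(a has_real_derivative (1 / F\<^sup>2 + 2 * q0\<^sup>2 / (H x) ^ 3) * g x) (at x)"
    unfolding a_def using pos(1) F
    by (auto intro!: derivative_eq_intros H_deriv[OF x] simp: field_simps power2_eq_square power3_eq_cube)
  have "((\<lambda>x. H x - (U x)\<^sup>2) has_real_derivative g x - 2 * U x * (q0 * g x / (H x)\<^sup>2)) (at x)"
    by (auto intro!: derivative_eq_intros H_deriv[OF x] U_deriv[OF x])
  then have "((\<lambda>x. a x * g x) has_real_derivative g x - 2 * U x * (q0 * g x / (H x)\<^sup>2)) (at x)"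
    by (rule has_field_derivative_transform_within_open[OF _ open_greaterThanLessThan x]) (simp add: a_g)
  from DERIV_unique[OF DERIV_mult[OF da g'] this]
  have "a x * g' = \<beta> x * g x" unfolding \<beta>_def by (simp add: algebra_simps)
  then show ?thesis using g' by blast
qed

lemma at_sonic: "U xs = sqrt Hs" "g xs = F * (F - 2) / 3"
proof -
  have F0: "F \<noteq> 0" using F by simp
  show "U xs = sqrt Hs" unfolding U_def sonic(2) q0_eq wave_speed_def using Hs F0 by (simp add: field_simps)
  have num: "Hs\<^sup>2 + (Hs - c\<^sup>2) * Hs + q0\<^sup>2 / Hs = Hs\<^sup>2 * ((F - 2) / F)"
    unfolding c_sq q0_sq using Hs F0 by (simp add: field_simps power2_eq_square power3_eq_cube)
  have den: "Hs\<^sup>2 + Hs * Hs + Hs\<^sup>2 = 3 * Hs\<^sup>2" by (simp add: power2_eq_square)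
  show "g xs = F * (F - 2) / 3"
    unfolding g_def profile_rhs_def sonic(2) num den using Hs F0 by (simp add: power2_eq_square)
qed

lemma sonic_system: "sonic_system X xs a \<beta> k k' e H g"
proof
  note cont = H_cont
  have nz: "\<forall>x\<in>{0..X}. H x \<noteq> 0" using H_pos by force
  have den: "\<forall>x\<in>{0..X}. (H x)\<^sup>2 + Hs * H x + Hs\<^sup>2 \<noteq> 0" using denominator_pos[OF H_pos] by force
  show cg: "continuous_on {0..X} g" unfolding g_def profile_rhs_def
    using den by (intro continuous_intros cont) auto
  have cU: "continuous_on {0..X} U" unfolding U_def using nz by (intro continuous_intros cont)
  show "continuous_on {0..X} a" unfolding a_def using nz by (intro continuous_intros cont) (use F in auto)
  show "continuous_on {0..X} \<beta>" unfolding \<beta>_def using nz by (intro continuous_intros cont cg cU) auto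
  show "continuous_on {0..X} k" unfolding k_def using nz by (intro continuous_intros cont)
  show "continuous_on {0..X} k'" unfolding k'_def using nz by (intro continuous_intros cont cg) auto
  show "continuous_on {0..X} e" unfolding e_def using nz by (intro continuous_intros cont cg cU) auto
  show "0 < xs" "xs < X" using sonic by auto
  show "a x < 0" if "0 \<le> x" "x < xs" for x
    using a_eq[of x] H_left[OF that] denominator_pos[of "H x"] H_pos[of x] F that sonic
    by (auto simp: divide_less_0_iff mult_less_0_iff)
  show "a x > 0" if "xs < x" "x \<le> X" for x
    using a_eq[of x] H_right[OF that] denominator_pos[of "H x"] H_pos[of x] F that sonic by auto
  show "a xs = 0" using a_eq[of xs] sonic by simp
  have F0: "F \<noteq> 0" using F by simp
  have root: "sqrt Hs * q0 = Hs\<^sup>2 / F" unfolding q0_eq using Hs by (simp add: power2_eq_square)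
  have \<beta>1: "2 * sqrt Hs * q0 / Hs\<^sup>2 = 2 / F" using root Hs F0 by (simp add: field_simps)
  have \<beta>2: "(1 / F\<^sup>2 + 2 * q0\<^sup>2 / Hs ^ 3) * (F * (F - 2) / 3) = (F - 2) / F"
    unfolding q0_sq using Hs F0 by (simp add: field_simps power2_eq_square)
  show "\<beta> xs = 0" unfolding \<beta>_def at_sonic sonic(2) \<beta>1 \<beta>2 using F0 by (simp add: field_simps)
  show "e xs > 0" unfolding e_def at_sonic sonic(2) using Hs q0_pos F by (intro add_pos_pos) auto
  show "k x > 0" if "x \<in> {0..X}" for x unfolding k_def using q0_pos H_pos[OF that] by simp
  show "(k has_real_derivative k' x) (at x)" if "x \<in> {0<..<X}" for x
    unfolding k_def k'_def using H_pos[of x] that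
    by (auto intro!: derivative_eq_intros H_deriv simp: power2_eq_square)
  show "0 < a x + (k x / 2)\<^sup>2" if "x \<in> {0..xs}" for x
    unfolding a_def k_def using H_pos[of x] that sonic F by (simp add: power_divide)
qed (use g_pos H_cont H_deriv g_deriv in auto)

sublocale sonic_system X xs a \<beta> k k' e H g
  by (rule sonic_system)

lemma Q_eq: "x \<in> {0..X} \<Longrightarrow> Q x = H x * U x"
  unfolding Q_profile_def U_def using H_pos[of x] by (simp add: right_diff_distrib mult.commute)

lemma lin_flux2_eq:
  assumes "x \<in> {0..X}"
  shows "lin_flux2 F Hs H h q x = of_real (c - k x) * lin_flux1 F Hs h q x + of_real (a x) * h x"
proof -
  have nz: "H x \<noteq> 0" using H_pos[OF assms] by simp
  have Q: "2 * Q x / H x - c = c - k x" "- (Q x)\<^sup>2 / (H x)\<^sup>2 + H x / F\<^sup>2 = a x - c * (c - k x)"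
    unfolding Q_eq[OF assms] a_def k_def U_def using nz
    by (simp_all add: field_simps power2_eq_square)
  show ?thesis unfolding lin_flux2_def lin_flux1_def Q by (simp add: algebra_simps)
qed

lemma eigen_solution_imp_sol:
  assumes "eigen_solution F Hs X H l h q"
  shows "sol l (lin_flux1 F Hs h q) h"
  unfolding sol_def
proof
  fix x assume x: "x \<in> {0<..<X}"
  then have x': "x \<in> {0..X}" by auto
  have nz: "H x \<noteq> 0" using H_pos[OF x'] by simp
  have analytic: "real_analytic_on h {0<..<X}" "real_analytic_on q {0<..<X}"
    and eqs: "l * h x + vector_derivative (lin_flux1 F Hs h q) (at x) = 0"
      "l * q x + vector_derivative (lin_flux2 F Hs H h q) (at x) =
          h x - of_real (2 * Q x / (H x)\<^sup>2) * q x + of_real (2 * (Q x)\<^sup>2 / (H x) ^ 3) * h x"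
    using assms x unfolding eigen_solution_def by auto
  obtain h' where h': "(h has_vector_derivative h') (at x)"
    using real_analytic_on_imp_has_vector_derivative[OF analytic(1) x] .
  obtain q' where q': "(q has_vector_derivative q') (at x)"
    using real_analytic_on_imp_has_vector_derivative[OF analytic(2) x] .
  let ?u = "lin_flux1 F Hs h q"
  have "(?u has_vector_derivative - of_real c * h' + q') (at x)"
    unfolding lin_flux1_def by (intro has_vector_derivative_add has_vector_derivative_mult_right h' q')
  then have u': "(?u has_vector_derivative - l * h x) (at x)"
    using eqs(1) vector_derivative_at by (metis add_eq_0_iff mult_minus_left)
  have dk: "((\<lambda>x. of_real (c - k x)) has_vector_derivative complex_of_real (- k' x)) (at x)"
    by (rule has_vector_derivative_of_real) (auto intro!: derivative_eq_intros k_deriv[OF x])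
  have da: "((\<lambda>x. of_real (a x)) has_vector_derivative complex_of_real ((1 / F\<^sup>2 + 2 * q0\<^sup>2 / (H x) ^ 3) * g x)) (at x)"
    unfolding a_def using nz F
    by (intro has_vector_derivative_of_real)
      (auto intro!: derivative_eq_intros H_deriv[OF x] simp: field_simps power2_eq_square power3_eq_cube)
  let ?v' = "(of_real (c - k x) * (- l * h x) + of_real (- k' x) * ?u x)
      + (of_real (a x) * h' + of_real ((1 / F\<^sup>2 + 2 * q0\<^sup>2 / (H x) ^ 3) * g x) * h x)"
  have "((\<lambda>x. of_real (c - k x) * ?u x + of_real (a x) * h x) has_vector_derivative ?v') (at x)"
    by (intro has_vector_derivative_add has_vector_derivative_mult dk da u' h')
  then have "(lin_flux2 F Hs H h q has_vector_derivative ?v') (at x)"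
    by (rule has_vector_derivative_transform_within_open[OF _ open_greaterThanLessThan x]) (simp add: lin_flux2_eq)
  then have "vector_derivative (lin_flux2 F Hs H h q) (at x) = ?v'" by (rule vector_derivative_at)
  note eq2 = eqs(2)[unfolded this]
  have Qr: "2 * Q x / (H x)\<^sup>2 = 2 * U x / H x" "2 * (Q x)\<^sup>2 / (H x) ^ 3 = 2 * (U x)\<^sup>2 / H x"
    unfolding Q_eq[OF x'] using nz by (simp_all add: field_simps power2_eq_square power3_eq_cube)
  have q_eq: "q x = ?u x + of_real c * h x" unfolding lin_flux1_def by simp
  have "of_real (a x) * h' = (of_real (\<beta> x) - l * of_real (k x)) * h x - (of_real (e x) + l) * ?u x"
  proof -
    have b: "\<beta> x = 1 - 2 * U x / H x * c + 2 * (U x)\<^sup>2 / H x - (1 / F\<^sup>2 + 2 * q0\<^sup>2 / (H x) ^ 3) * g x"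
    proof -
      have "2 * (U x)\<^sup>2 / H x = 2 * U x / H x * c - 2 * U x * q0 / (H x)\<^sup>2"
        using nz by (simp add: U_def field_simps power2_eq_square)
      then show ?thesis unfolding \<beta>_def by simp
    qed
    have ee: "e x = 2 * U x / H x - k' x" unfolding e_def k'_def by simp
    show ?thesis using eq2 unfolding Qr q_eq b ee
      by (simp add: algebra_simps add_divide_distrib)
  qed
  then show "(?u has_vector_derivative - l * h x) (at x) \<and>
     (\<exists>h'. (h has_vector_derivative h') (at x) \<and>
        of_real (a x) * h' = (of_real (\<beta> x) - l * of_real (k x)) * h x - (of_real (e x) + l) * ?u x)"
    using u' h' by blast
qed

end

context saint_venant_wave
begin

lemma evans_eq:
  fixes h q :: "complex \<Rightarrow> real \<Rightarrow> complex"
  assumes lim: "(lin_flux1 F Hs (h l) (q l) \<longlongrightarrow> uR) (at_left X)" "(h l \<longlongrightarrow> hR) (at_left X)"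
    "(lin_flux1 F Hs (h l) (q l) \<longlongrightarrow> uL) (at_right 0)" "(h l \<longlongrightarrow> hL) (at_right 0)"
  shows "evans F Hs X H h q l \<xi> =
    (l * of_real (H X - H 0) * (of_real (a X) * hR - of_real (k X) * uR) + of_real (a X * g X - a 0 * g 0) * uR)
    - exp (\<i> * of_real (\<xi> * X)) *
      (l * of_real (H X - H 0) * (of_real (a 0) * hL - of_real (k 0) * uL) + of_real (a X * g X - a 0 * g 0) * uL)"
proof -
  let ?u = "lin_flux1 F Hs (h l) (q l)" and ?E = "exp (\<i> * of_real (\<xi> * X))"
  define m where "m x = l * of_real (Q x) - complex_of_real (H x - (Q x)\<^sup>2 / (H x)\<^sup>2)" for x
  define v where "v = lin_flux2 F Hs H (h l) (q l)"
  have ends: "0 \<in> {0..X}" "X \<in> {0..X}" using X by auto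
  have ev: "\<forall>\<^sub>F x in at_left X. x \<in> {0<..<X}" "\<forall>\<^sub>F x in at_right 0. x \<in> {0<..<X}"
    using X by (auto intro: eventually_at_leftI eventually_at_rightI)
  have at_ends: "(f \<longlongrightarrow> f X) (at_left X)" "(f \<longlongrightarrow> f 0) (at_right 0)"
    if "continuous_on {0..X} f" for f :: "real \<Rightarrow> complex"
    using continuous_on_Icc_at_leftD[OF that X] continuous_on_Icc_at_rightD[OF that X] by auto
  have jump_eq: "jump X f = f X - f 0" if "continuous_on {0..X} f" for f
    unfolding jump_def using at_ends[OF that]
    by (simp add: tendsto_Lim[OF trivial_limit_at_left_real] tendsto_Lim[OF trivial_limit_at_right_real])
  have bloch: "bloch_jump X \<xi> f = y - ?E * z" if "(f \<longlongrightarrow> y) (at_left X)" "(f \<longlongrightarrow> z) (at_right 0)" for f y z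
    unfolding bloch_jump_def using that
    by (simp add: tendsto_Lim[OF trivial_limit_at_left_real] tendsto_Lim[OF trivial_limit_at_right_real])
  have nz: "\<forall>x\<in>{0..X}. H x \<noteq> 0" using H_pos by force
  have contQ: "continuous_on {0..X} Q" unfolding Q_profile_def by (intro continuous_intros H_cont)
  have j1: "jump X (\<lambda>x. l * of_real (H x)) = l * of_real (H X - H 0)"
    by (subst jump_eq) (auto intro!: continuous_intros H_cont simp: right_diff_distrib)
  have m_eq: "m x = l * (of_real c * of_real (H x) - of_real q0) - of_real (a x * g x)" if "x \<in> {0..X}" for x
  proof -
    have "H x - (Q x)\<^sup>2 / (H x)\<^sup>2 = a x * g x"
      using nz that unfolding Q_eq[OF that] a_g[OF that] by (simp add: power_mult_distrib)
    then show ?thesis unfolding m_def by (simp add: Q_profile_def)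
  qed
  have "continuous_on {0..X} m" unfolding m_def
    using nz by (intro continuous_intros H_cont contQ) auto
  then have j2: "jump X m = l * of_real c * of_real (H X - H 0) - of_real (a X * g X - a 0 * g 0)"
    by (subst jump_eq) (simp_all add: m_eq[OF ends(1)] m_eq[OF ends(2)] algebra_simps)
  have conts: "continuous_on {0..X} (\<lambda>x. complex_of_real (c - k x))" "continuous_on {0..X} (\<lambda>x. complex_of_real (a x))"
    by (intro continuous_intros cont)+
  have v_lim: "(v \<longlongrightarrow> of_real (c - k y) * u' + of_real (a y) * h') Fl"
    if "(?u \<longlongrightarrow> u') Fl" "(h l \<longlongrightarrow> h') Fl" "\<forall>\<^sub>F x in Fl. x \<in> {0<..<X}"
      "((\<lambda>x. complex_of_real (c - k x)) \<longlongrightarrow> of_real (c - k y)) Fl" "((\<lambda>x. complex_of_real (a x)) \<longlongrightarrow> of_real (a y)) Fl"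
    for Fl u' h' y
  proof (rule Lim_transform_eventually)
    show "((\<lambda>x. of_real (c - k x) * ?u x + of_real (a x) * h l x) \<longlongrightarrow> of_real (c - k y) * u' + of_real (a y) * h') Fl"
      by (intro tendsto_add tendsto_mult that)
    show "\<forall>\<^sub>F x in Fl. of_real (c - k x) * ?u x + of_real (a x) * h l x = v x"
      using that(3) by (rule eventually_mono) (simp add: v_def lin_flux2_eq)
  qed
  have b2: "bloch_jump X \<xi> v = (of_real (c - k X) * uR + of_real (a X) * hR)
      - ?E * (of_real (c - k 0) * uL + of_real (a 0) * hL)"
    by (intro bloch v_lim lim ev at_ends[OF conts(1)] at_ends[OF conts(2)])
  have b1: "bloch_jump X \<xi> ?u = uR - ?E * uL" by (rule bloch[OF lim(1,3)])
  have "evans F Hs X H h q l \<xi> = jump X (\<lambda>x. l * of_real (H x)) * bloch_jump X \<xi> v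
      - bloch_jump X \<xi> ?u * jump X m"
    unfolding evans_def det_2 v_def m_def by (simp add: vector_2)
  moreover have "l * J * ((of_real c - kX) * uR + aX * hR - ?E * ((of_real c - k0) * uL + a0 * hL))
      - (uR - ?E * uL) * (l * of_real c * J - M)
    = (l * J * (aX * hR - kX * uR) + M * uR) - ?E * (l * J * (a0 * hL - k0 * uL) + M * uL)"
    for J M kX aX k0 a0 by (simp add: algebra_simps)
  ultimately show ?thesis unfolding j1 j2 b1 b2 by (simp only: of_real_diff[of c])
qed

end

theorem theorem1p15:
  fixes F Hs Hm X xs \<alpha> :: real
    and H :: "real \<Rightarrow> real"
    and h q :: "complex \<Rightarrow> real \<Rightarrow> complex"
    and D :: "complex \<Rightarrow> real \<Rightarrow> complex"
  assumes wave: "roll_wave F Hs Hm X H"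
    and sonic: "xs \<in> {0<..<X}" "H xs = Hs"
    and family: "eigen_family F Hs X H h q"
    and D: "D = evans F Hs X H h q"
    and real_normalization:
      "\<And>l::real. complex_of_real l \<in> spectral_domain F Hs \<Longrightarrow>
         D (complex_of_real l) 0 \<in> \<real> \<and> D (complex_of_real l) (pi / X) \<in> \<real>"
    and nondegenerate: "alpha0 D \<noteq> 0"
    and \<alpha>: "\<alpha> = Re (alpha1 D / (\<i> * alpha0 D))"
  shows
    "((\<forall>\<xi>\<in>{- pi / X..pi / X}. (\<lambda>l. reduced D l \<xi>) holomorphic_on spectral_domain F Hs \<and>
         (\<forall>l\<in>spectral_domain F Hs. D l \<xi> = l * reduced D l \<xi>)) \<and>
      low_freq_expansion X D (alpha0 D) (alpha1 D) \<and>
      alpha1 D / (\<i> * alpha0 D) = complex_of_real \<alpha> \<and>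
      critical_curve_expansion D \<alpha> \<and>
      h 0 xs \<in> \<real> \<and> h 0 xs \<noteq> 0) \<and>
     (alpha0 D \<in> \<real> \<and>
      alpha0 D = (deriv ^^ 2) (\<lambda>l. D l 0) 0 / 2 \<and>
      finite (positive_real_roots (\<lambda>l. D l 0)) \<and>
      (even (num_positive_real_roots (\<lambda>l. D l 0)) \<longleftrightarrow> Re (h 0 xs) * Re (alpha0 D) > 0)) \<and>
     (alpha1 D / \<i> \<in> \<real> \<and>
      alpha1 D = deriv (\<lambda>l. vector_derivative (\<lambda>\<xi>. D l \<xi>) (at 0)) 0 \<and>
      (alpha1 D \<noteq> 0 \<longrightarrow>
         finite (positive_real_roots (\<lambda>l. D l (pi / X))) \<and>
         (even (num_positive_real_roots (\<lambda>l. D l (pi / X))) \<longleftrightarrow>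
            Re (h 0 xs) * Re (alpha1 D / \<i>) < 0))) \<and>
     (\<alpha> > 0 \<longrightarrow> \<not> spectrally_stable X D)"
proof -
  interpret W: saint_venant_wave F Hs Hm X xs H
    by unfold_locales (fact wave sonic)+
  let ?S = "spectral_domain F Hs"
  define u where "u l = lin_flux1 F Hs (h l) (q l)" for l
  have sols: "eigen_solution F Hs X H l (h l) (q l)" "\<exists>x\<in>{0<..<X}. h l x \<noteq> 0 \<or> q l x \<noteq> 0" if "l \<in> ?S" for l
    using family that unfolding eigen_family_def by auto
  have hols: "(\<lambda>l. h l x) holomorphic_on ?S" "(\<lambda>l. q l x) holomorphic_on ?S" if "x \<in> {0<..<X}" for x
    using family that unfolding eigen_family_def by auto
  have S: "open ?S" "connected ?S" "\<And>x. x \<ge> 0 \<Longrightarrow> complex_of_real x \<in> ?S"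
  proof -
    show "open ?S" unfolding spectral_domain_def by (rule open_halfspace_Re_gt)
    show "connected ?S" unfolding spectral_domain_def by (intro convex_connected convex_halfspace_Re_gt)
    have "(F - 2) / (2 * sqrt Hs) > 0" using W.F W.Hs by simp
    then show "complex_of_real x \<in> ?S" if "x \<ge> 0" for x
      unfolding spectral_domain_def using that by simp
  qed
  interpret E: sonic_family X xs W.a W.\<beta> W.k W.k' W.e H W.g ?S u h
  proof
    show "W.sol l (u l) (h l)" if "l \<in> ?S" for l
      unfolding u_def by (rule W.eigen_solution_imp_sol[OF sols(1)[OF that]])
    show "\<exists>x\<in>{0<..<X}. h l x \<noteq> 0 \<or> u l x \<noteq> 0" if "l \<in> ?S" for l
      using sols(2)[OF that] unfolding u_def lin_flux1_def by fastforce
    show "(\<lambda>l. u l x) holomorphic_on ?S" if "x \<in> {0<..<X}" for x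
      unfolding u_def lin_flux1_def by (intro holomorphic_intros hols that)
  qed (use S hols in auto)
  have D_eq: "D l \<xi> = E.detR l - exp (\<i> * of_real (\<xi> * X)) * E.detL l" if "l \<in> ?S" for l \<xi>
    unfolding D E.detR_def E.detL_def
    by (rule W.evans_eq) (use E.tendsto_ends[OF that] in \<open>simp_all add: u_def\<close>)
  obtain L where "\<And>l. l > L \<Longrightarrow>
      \<bar>Re (E.detL (of_real l) / h (of_real l) xs)\<bar> < Re (E.detR (of_real l) / h (of_real l) xs)"
    by (rule E.det_dominant) blast
  then interpret V: evans_split ?S X E.detR E.detL "\<lambda>l. h l xs" D
    by unfold_locales
      (use S W.X E.detR_holomorphic E.detL_holomorphic hols(1)[OF sonic(1)] E.det_zero E.det_deriv_eq D_eq
        real_normalization nondegenerate E.h_xs_nonzero E.det_real in auto)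
  have "h 0 xs \<in> \<real>" "h 0 xs \<noteq> 0" using V.\<eta>_real[of 0] E.h_xs_nonzero[of 0] by simp_all
  then show ?thesis
    using V.reduced_holomorphic V.low_freq V.alpha_eq(2) V.critical_curve V.alpha0_real V.alpha0_second
      V.parity_0 V.alpha1_real V.alpha1_mixed V.parity_pi V.unstable unfolding \<alpha> by blast
qed

end
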